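(* Let $R$ be a commutative Noetherian local ring and let $M$ be a rigid $R$-module. Then $M$ is free if at least one of the following holds: (i) $R$ is Artinian and $M$ is $2$-periodic. (ii) $R$ has depth zero and $M$ is stably isomorphic to $\Omega^n_R I$ for some ideal $I$ of $R$ that is totally reflexive as an $R$-module and some integer $n\geq 0$.
   Context: All modules are finitely generated. $M$ is rigid if $\operatorname{Ext}^1_R(M,M)=0$. $\Omega^n_R X$ denotes the $n$th syzygy in a minimal free resolution of $X$ (with $\Omega^0_R X=X$). Two $R$-modules $X$ and $Y$ are stably isomorphic if $X\oplus F\cong Y\oplus G$ for some (finitely generated) free $R$-modules $F$ and $G$. $M$ is $n$-periodic if $M$ and $\Omega^n_R M$ are stably isomorphic. Write $X^{\ast}=\operatorname{Hom}_R(X,R)$. A reflexive $R$-module $X$ (that is, the natural map $X\to X^{\ast\ast}$ is an isomorphism) is totally reflexive if $\operatorname{Ext}^i_R(X,R)=\operatorname{Ext}^i_R(X^{\ast},R)=0$ for all $i>0$. *)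

theory Defs
  imports "HOL-Algebra.Module" "HOL-Algebra.Ring_Divisibility" "HOL-Library.Extended_Nat"
begin

section \<open>Rings\<close>

locale noetherian_local_ring = cring R + noetherian_ring R for R (structure) +
  assumes unique_maximal: "\<exists>!\<mm>. maximalideal \<mm> R"

definition max_ideal :: "('a, 'r) ring_scheme \<Rightarrow> 'a set"
  where "max_ideal R = (THE \<mm>. maximalideal \<mm> R)"

definition artinian_ring :: "('a, 'r) ring_scheme \<Rightarrow> bool"
  where "artinian_ring R \<longleftrightarrow> ring R \<and>
    (\<forall>I :: nat \<Rightarrow> 'a set. (\<forall>n. ideal (I n) R) \<and> (\<forall>n. I (Suc n) \<subseteq> I n) \<longrightarrow>
       (\<exists>N. \<forall>n\<ge>N. I n = I N))"

text \<open>Multiplication by \<open>xs ! i\<close> is injective on \<open>R/(xs ! 0, \<dots>, xs ! (i - 1))\<close>, and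
  \<open>R/(xs)\<close> is nonzero.\<close>

definition regular_sequence :: "('a, 'r) ring_scheme \<Rightarrow> 'a list \<Rightarrow> bool"
  where "regular_sequence R xs \<longleftrightarrow>
    set xs \<subseteq> carrier R \<and>
    (\<forall>i < length xs. \<forall>r \<in> carrier R.
       xs ! i \<otimes>\<^bsub>R\<^esub> r \<in> genideal R (set (take i xs)) \<longrightarrow> r \<in> genideal R (set (take i xs))) \<and>
    genideal R (set xs) \<noteq> carrier R"

definition ring_depth :: "('a, 'r) ring_scheme \<Rightarrow> enat"
  where "ring_depth R =
    Sup {enat (length xs) | xs. regular_sequence R xs \<and> set xs \<subseteq> max_ideal R}"


section \<open>Modules\<close>

text \<open>The record type \<open>module\<close> extends \<open>ring\<close>, but the locale \<open>module\<close> ignores the fields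
  \<open>mult\<close> and \<open>one\<close>; they are left unspecified in the constructions below. Homomorphisms
  that are elements of a module are extensional, so that equality of such elements is equality
  on the domain.\<close>

definition module_hom ::
    "('a, 'r) ring_scheme \<Rightarrow> ('a, 'b, 'm) module_scheme \<Rightarrow> ('a, 'c, 'n) module_scheme \<Rightarrow> ('b \<Rightarrow> 'c) set"
  where "module_hom R X Y = {f \<in> carrier X \<rightarrow> carrier Y.
    (\<forall>x \<in> carrier X. \<forall>y \<in> carrier X. f (x \<oplus>\<^bsub>X\<^esub> y) = f x \<oplus>\<^bsub>Y\<^esub> f y) \<and>
    (\<forall>a \<in> carrier R. \<forall>x \<in> carrier X. f (a \<odot>\<^bsub>X\<^esub> x) = a \<odot>\<^bsub>Y\<^esub> f x)}"

definition module_iso ::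
    "('a, 'r) ring_scheme \<Rightarrow> ('a, 'b, 'm) module_scheme \<Rightarrow> ('a, 'c, 'n) module_scheme \<Rightarrow> ('b \<Rightarrow> 'c) set"
  where "module_iso R X Y = {f \<in> module_hom R X Y. bij_betw f (carrier X) (carrier Y)}"

definition isomorphic_modules ::
    "('a, 'r) ring_scheme \<Rightarrow> ('a, 'b, 'm) module_scheme \<Rightarrow> ('a, 'c, 'n) module_scheme \<Rightarrow> bool"
  where "isomorphic_modules R X Y \<longleftrightarrow> module_iso R X Y \<noteq> {}"

definition module_span ::
    "('a, 'r) ring_scheme \<Rightarrow> ('a, 'b, 'm) module_scheme \<Rightarrow> 'b set \<Rightarrow> 'b set"
  where "module_span R X A = \<Inter>{N. submodule N R X \<and> A \<subseteq> N}"

definition fin_gen_module :: "('a, 'r) ring_scheme \<Rightarrow> ('a, 'b, 'm) module_scheme \<Rightarrow> bool"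
  where "fin_gen_module R X \<longleftrightarrow>
    (\<exists>A. finite A \<and> A \<subseteq> carrier X \<and> module_span R X A = carrier X)"

definition ideal_mult_module ::
    "('a, 'r) ring_scheme \<Rightarrow> 'a set \<Rightarrow> ('a, 'b, 'm) module_scheme \<Rightarrow> 'b set"
  where "ideal_mult_module R I X = module_span R X {a \<odot>\<^bsub>X\<^esub> x | a x. a \<in> I \<and> x \<in> carrier X}"

definition ideal_module :: "('a, 'r) ring_scheme \<Rightarrow> 'a set \<Rightarrow> ('a, 'a) module"
  where "ideal_module R I = \<lparr>carrier = I, mult = undefined, one = undefined,
    zero = \<zero>\<^bsub>R\<^esub>, add = (\<oplus>\<^bsub>R\<^esub>), smult = (\<otimes>\<^bsub>R\<^esub>)\<rparr>"

abbreviation ring_module :: "('a, 'r) ring_scheme \<Rightarrow> ('a, 'a) module"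
  where "ring_module R \<equiv> ideal_module R (carrier R)"

definition free_power :: "('a, 'r) ring_scheme \<Rightarrow> nat \<Rightarrow> ('a, nat \<Rightarrow> 'a) module"
  where "free_power R n = \<lparr>carrier = (\<Pi>\<^sub>E i \<in> {..<n}. carrier R), mult = undefined, one = undefined,
    zero = (\<lambda>i \<in> {..<n}. \<zero>\<^bsub>R\<^esub>), add = (\<lambda>x y. \<lambda>i \<in> {..<n}. x i \<oplus>\<^bsub>R\<^esub> y i),
    smult = (\<lambda>a x. \<lambda>i \<in> {..<n}. a \<otimes>\<^bsub>R\<^esub> x i)\<rparr>"

text \<open>Only finitely generated free modules are considered.\<close>

definition free_module :: "('a, 'r) ring_scheme \<Rightarrow> ('a, 'b, 'm) module_scheme \<Rightarrow> bool"
  where "free_module R X \<longleftrightarrow> (\<exists>n. isomorphic_modules R X (free_power R n))"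

definition direct_sum_module ::
    "('a, 'b, 'm) module_scheme \<Rightarrow> ('a, 'c, 'n) module_scheme \<Rightarrow> ('a, 'b \<times> 'c) module"
  where "direct_sum_module X Y = \<lparr>carrier = carrier X \<times> carrier Y, mult = undefined, one = undefined,
    zero = (\<zero>\<^bsub>X\<^esub>, \<zero>\<^bsub>Y\<^esub>), add = (\<lambda>(x, y) (x', y'). (x \<oplus>\<^bsub>X\<^esub> x', y \<oplus>\<^bsub>Y\<^esub> y')),
    smult = (\<lambda>a (x, y). (a \<odot>\<^bsub>X\<^esub> x, a \<odot>\<^bsub>Y\<^esub> y))\<rparr>"

definition stably_isomorphic ::
    "('a, 'r) ring_scheme \<Rightarrow> ('a, 'b, 'm) module_scheme \<Rightarrow> ('a, 'c, 'n) module_scheme \<Rightarrow> bool"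
  where "stably_isomorphic R X Y \<longleftrightarrow> (\<exists>p q. isomorphic_modules R
    (direct_sum_module X (free_power R p)) (direct_sum_module Y (free_power R q)))"

definition quotient_module ::
    "('a, 'b, 'm) module_scheme \<Rightarrow> 'b set \<Rightarrow> ('a, 'b set) module"
  where "quotient_module X N = \<lparr>carrier = a_rcosets\<^bsub>X\<^esub> N, mult = undefined, one = undefined,
    zero = N, add = (<+>\<^bsub>X\<^esub>), smult = (\<lambda>a C. \<Union>x \<in> C. N +>\<^bsub>X\<^esub> (a \<odot>\<^bsub>X\<^esub> x))\<rparr>"

definition zero_module :: "('a, 'b, 'm) module_scheme \<Rightarrow> bool"
  where "zero_module X \<longleftrightarrow> carrier X = {\<zero>\<^bsub>X\<^esub>}"

definition hom_module ::
    "('a, 'r) ring_scheme \<Rightarrow> ('a, 'b, 'm) module_scheme \<Rightarrow> ('a, 'c, 'n) module_scheme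
      \<Rightarrow> ('a, 'b \<Rightarrow> 'c) module"
  where "hom_module R X Y = \<lparr>carrier = module_hom R X Y \<inter> extensional (carrier X),
    mult = undefined, one = undefined,
    zero = (\<lambda>x \<in> carrier X. \<zero>\<^bsub>Y\<^esub>), add = (\<lambda>f g. \<lambda>x \<in> carrier X. f x \<oplus>\<^bsub>Y\<^esub> g x),
    smult = (\<lambda>a f. \<lambda>x \<in> carrier X. a \<odot>\<^bsub>Y\<^esub> f x)\<rparr>"

definition dual_module ::
    "('a, 'r) ring_scheme \<Rightarrow> ('a, 'b, 'm) module_scheme \<Rightarrow> ('a, 'b \<Rightarrow> 'a) module"
  where "dual_module R X = hom_module R X (ring_module R)"


section \<open>Free resolutions and syzygies\<close>

text \<open>A resolution \<open>\<dots> \<rightarrow> F 2 \<rightarrow> F 1 \<rightarrow> F 0 \<rightarrow> X \<rightarrow> 0\<close> with \<open>F i = free_power R (rk i)\<close>, augmentation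
  \<open>aug : F 0 \<rightarrow> X\<close> and differentials \<open>diff i : F (i + 1) \<rightarrow> F i\<close>. Over a Noetherian ring every
  finitely generated module has one.\<close>

record ('a, 'b) resolution =
  rk :: "nat \<Rightarrow> nat"
  aug :: "(nat \<Rightarrow> 'a) \<Rightarrow> 'b"
  diff :: "nat \<Rightarrow> (nat \<Rightarrow> 'a) \<Rightarrow> (nat \<Rightarrow> 'a)"

definition res_module ::
    "('a, 'r) ring_scheme \<Rightarrow> ('a, 'b) resolution \<Rightarrow> nat \<Rightarrow> ('a, nat \<Rightarrow> 'a) module"
  where "res_module R F i = free_power R (rk F i)"

definition free_resolution ::
    "('a, 'r) ring_scheme \<Rightarrow> ('a, 'b, 'm) module_scheme \<Rightarrow> ('a, 'b) resolution \<Rightarrow> bool"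
  where "free_resolution R X F \<longleftrightarrow>
    aug F \<in> module_hom R (res_module R F 0) X \<and>
    (\<forall>i. diff F i \<in> module_hom R (res_module R F (Suc i)) (res_module R F i)) \<and>
    aug F ` carrier (res_module R F 0) = carrier X \<and>
    a_kernel (res_module R F 0) X (aug F) = diff F 0 ` carrier (res_module R F 1) \<and>
    (\<forall>i. a_kernel (res_module R F (Suc i)) (res_module R F i) (diff F i)
         = diff F (Suc i) ` carrier (res_module R F (Suc (Suc i))))"

definition minimal_free_resolution ::
    "('a, 'r) ring_scheme \<Rightarrow> ('a, 'b, 'm) module_scheme \<Rightarrow> ('a, 'b) resolution \<Rightarrow> bool"
  where "minimal_free_resolution R X F \<longleftrightarrow> free_resolution R X F \<and>
    (\<forall>i. diff F i ` carrier (res_module R F (Suc i))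
         \<subseteq> ideal_mult_module R (max_ideal R) (res_module R F i))"

text \<open>The syzygy of positive order \<open>Suc k\<close> is the image of \<open>F (k + 1) \<rightarrow> F k\<close>.\<close>

definition res_syzygy ::
    "('a, 'r) ring_scheme \<Rightarrow> ('a, 'b) resolution \<Rightarrow> nat \<Rightarrow> ('a, nat \<Rightarrow> 'a) module"
  where "res_syzygy R F k =
    (res_module R F k)\<lparr>carrier := diff F k ` carrier (res_module R F (Suc k))\<rparr>"

text \<open>\<open>stably_isomorphic_syzygy R Y n X\<close>: \<open>Y\<close> is stably isomorphic to the \<open>n\<close>-th syzygy of \<open>X\<close>.
  The zeroth syzygy \<open>X\<close> and the higher ones live in different types, hence the case distinction.
  Minimal free resolutions are unique up to isomorphism, so their choice is immaterial.\<close>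

definition stably_isomorphic_syzygy ::
    "('a, 'r) ring_scheme \<Rightarrow> ('a, 'c, 'n) module_scheme \<Rightarrow> nat \<Rightarrow> ('a, 'b, 'm) module_scheme \<Rightarrow> bool"
  where "stably_isomorphic_syzygy R Y n X \<longleftrightarrow>
    (case n of
       0 \<Rightarrow> stably_isomorphic R Y X
     | Suc k \<Rightarrow> (\<exists>F. minimal_free_resolution R X F \<and> stably_isomorphic R Y (res_syzygy R F k)))"

definition periodic_module :: "('a, 'r) ring_scheme \<Rightarrow> nat \<Rightarrow> ('a, 'b, 'm) module_scheme \<Rightarrow> bool"
  where "periodic_module R n X \<longleftrightarrow> stably_isomorphic_syzygy R X n X"


section \<open>Ext, rigid and totally reflexive modules\<close>

definition ext_cocycles ::
    "('a, 'r) ring_scheme \<Rightarrow> ('a, 'b) resolution \<Rightarrow> nat \<Rightarrow> ('a, 'c, 'n) module_scheme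
      \<Rightarrow> ((nat \<Rightarrow> 'a) \<Rightarrow> 'c) set"
  where "ext_cocycles R F i Y =
    {f \<in> carrier (hom_module R (res_module R F i) Y).
       compose (carrier (res_module R F (Suc i))) f (diff F i)
         = \<zero>\<^bsub>hom_module R (res_module R F (Suc i)) Y\<^esub>}"

definition ext_coboundaries ::
    "('a, 'r) ring_scheme \<Rightarrow> ('a, 'b) resolution \<Rightarrow> nat \<Rightarrow> ('a, 'c, 'n) module_scheme
      \<Rightarrow> ((nat \<Rightarrow> 'a) \<Rightarrow> 'c) set"
  where "ext_coboundaries R F i Y =
    (case i of
       0 \<Rightarrow> {\<zero>\<^bsub>hom_module R (res_module R F 0) Y\<^esub>}
     | Suc k \<Rightarrow> (\<lambda>g. compose (carrier (res_module R F (Suc k))) g (diff F k))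
                 ` carrier (hom_module R (res_module R F k) Y))"

text \<open>\<open>Ext\<close> is computed from an arbitrarily chosen resolution by finitely generated free modules.
  The definition is meaningful for finitely generated modules over Noetherian rings.\<close>

definition Ext_module ::
    "('a, 'r) ring_scheme \<Rightarrow> nat \<Rightarrow> ('a, 'b, 'm) module_scheme \<Rightarrow> ('a, 'c, 'n) module_scheme
      \<Rightarrow> ('a, ((nat \<Rightarrow> 'a) \<Rightarrow> 'c) set) module"
  where "Ext_module R i X Y =
    (let F = (SOME F. free_resolution R X F)
     in quotient_module
          ((hom_module R (res_module R F i) Y)\<lparr>carrier := ext_cocycles R F i Y\<rparr>)
          (ext_coboundaries R F i Y))"

definition rigid_module :: "('a, 'r) ring_scheme \<Rightarrow> ('a, 'b, 'm) module_scheme \<Rightarrow> bool"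
  where "rigid_module R X \<longleftrightarrow> zero_module (Ext_module R 1 X X)"

definition bidual_map ::
    "('a, 'r) ring_scheme \<Rightarrow> ('a, 'b, 'm) module_scheme \<Rightarrow> 'b \<Rightarrow> (('b \<Rightarrow> 'a) \<Rightarrow> 'a)"
  where "bidual_map R X x = (\<lambda>f \<in> carrier (dual_module R X). f x)"

definition reflexive_module :: "('a, 'r) ring_scheme \<Rightarrow> ('a, 'b, 'm) module_scheme \<Rightarrow> bool"
  where "reflexive_module R X \<longleftrightarrow>
    bidual_map R X \<in> module_iso R X (dual_module R (dual_module R X))"

definition totally_reflexive :: "('a, 'r) ring_scheme \<Rightarrow> ('a, 'b, 'm) module_scheme \<Rightarrow> bool"
  where "totally_reflexive R X \<longleftrightarrow> reflexive_module R X \<and>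
    (\<forall>i>0. zero_module (Ext_module R i X (ring_module R)) \<and>
           zero_module (Ext_module R i (dual_module R X) (ring_module R)))"

end

theory Submission
  imports Defs
begin

text \<open>
  In both cases the maximal ideal \<open>\<mm>\<close> is annihilated by some \<open>z \<noteq> 0\<close>, so that every
  nonzero finitely generated module has a nonzero functional with values in \<open>R z \<cong> R/\<mm>\<close>.

  (i) Let \<open>0 \<rightarrow> X \<rightarrow> F\<^sub>1 \<rightarrow> F\<^sub>0 \<rightarrow> M \<rightarrow> 0\<close> be the start of the minimal resolution. Since \<open>M\<close> and
  \<open>X\<close> agree up to free summands and \<open>Ext\<^sup>1(M, M) = 0\<close>, comparing the lengths of the terms of
  \<open>Hom(-, M)\<close> gives \<open>Ext\<^sup>2(M, M) = 0\<close>, i.e. maps \<open>X \<rightarrow> M\<close> extend to \<open>F\<^sub>1\<close>. As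
  \<open>X \<subseteq> \<mm>F\<^sub>1\<close> is killed by \<open>z\<close>, this makes the identity of \<open>X\<close> take values in \<open>\<mm>X\<close>, so
  \<open>X = 0\<close> and \<open>M\<close> is a direct summand of a free module.

  (ii) Dimension shifting along \<open>Ext\<^sup>i(I, R) = 0\<close> gives \<open>Ext\<^sup>1(I, I) = 0\<close>. Reflexivity and
  depth zero show that \<open>I\<^sup>*\<close> is generated by the inclusion, so that \<open>I\<^sup>* \<cong> R/A\<close> with
  \<open>A = ann I\<close> and \<open>I = ann A\<close>. If \<open>I \<noteq> R\<close>, then \<open>Ext\<^sup>1(I\<^sup>*, R) = 0\<close> yields
  \<open>y \<notin> I\<close> with \<open>\<mm>y \<subseteq> I\<close>. By \<open>Ext\<^sup>1(I, I) = 0\<close> every map \<open>I \<rightarrow> R/I\<close> lifts to a map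
  \<open>I \<rightarrow> R\<close>, which is a multiplication, so \<open>Hom(I, R/I) = 0\<close>; as \<open>y\<close> spans a copy of
  \<open>R/\<mm>\<close> in \<open>R/I\<close>, this forces \<open>I = 0\<close>.
\<close>

section \<open>Module homomorphisms\<close>

text \<open>\<open>Ext_module\<close> is computed from a resolution fixed by choice, whereas the
  modules at hand come with resolutions of their own and agree only up to free summands, often in
  different types. Vanishing of Ext is therefore turned at once into an extension property of maps,
  and freeness into being a retract of a free power. A presentation with the fewest generators
  restores freeness at the end.

  A free summand in the second argument of Ext is harmless only if Ext into \<open>R\<close>
  vanishes. Two balances are needed: the lengths of the modules themselves relate the ranks of
  \<open>F\<^sub>0\<close> and \<open>F\<^sub>1\<close> to those of the free summands in the stable
  isomorphism, and with this relation the lengths of the Hom modules show that every map from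
  \<open>X\<close> to \<open>M\<close> extends to \<open>F\<^sub>1\<close>.

  The argument for \<open>I\<close> in (ii) uses the inclusion into \<open>R\<close> and does not
  apply to the syzygies; hence the descent to \<open>I\<close>, and the return to \<open>M\<close>
  once \<open>I\<close> is \<open>0\<close> or \<open>R\<close>.\<close>

lemma (in abelian_group) eq_if_minus_eq_zero:
  assumes "x \<ominus> y = \<zero>" "x \<in> carrier G" "y \<in> carrier G"
  shows "x = y"
proof -
  have "x = (x \<ominus> y) \<oplus> y"
    using assms(2,3) by (simp add: a_minus_def a_assoc l_neg)
  then show ?thesis using assms by simp
qed

lemma module_homI:
  assumes "\<And>x. x \<in> carrier X \<Longrightarrow> f x \<in> carrier Y"
    and "\<And>x y. x \<in> carrier X \<Longrightarrow> y \<in> carrier X \<Longrightarrow> f (x \<oplus>\<^bsub>X\<^esub> y) = f x \<oplus>\<^bsub>Y\<^esub> f y"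
    and "\<And>a x. a \<in> carrier R \<Longrightarrow> x \<in> carrier X \<Longrightarrow> f (a \<odot>\<^bsub>X\<^esub> x) = a \<odot>\<^bsub>Y\<^esub> f x"
  shows "f \<in> module_hom R X Y"
  using assms by (auto simp: module_hom_def)

lemma module_hom_closed: "f \<in> module_hom R X Y \<Longrightarrow> x \<in> carrier X \<Longrightarrow> f x \<in> carrier Y"
  by (auto simp: module_hom_def)

lemma module_hom_add:
  "f \<in> module_hom R X Y \<Longrightarrow> x \<in> carrier X \<Longrightarrow> y \<in> carrier X \<Longrightarrow> f (x \<oplus>\<^bsub>X\<^esub> y) = f x \<oplus>\<^bsub>Y\<^esub> f y"
  by (auto simp: module_hom_def)

lemma module_hom_smult:
  "f \<in> module_hom R X Y \<Longrightarrow> a \<in> carrier R \<Longrightarrow> x \<in> carrier X \<Longrightarrow> f (a \<odot>\<^bsub>X\<^esub> x) = a \<odot>\<^bsub>Y\<^esub> f x"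
  by (auto simp: module_hom_def)

lemma module_hom_zero:
  assumes "f \<in> module_hom R X Y" "module R X" "module R Y"
  shows "f \<zero>\<^bsub>X\<^esub> = \<zero>\<^bsub>Y\<^esub>"
proof -
  interpret X: module R X by fact
  interpret Y: module R Y by fact
  have "f (\<zero>\<^bsub>R\<^esub> \<odot>\<^bsub>X\<^esub> \<zero>\<^bsub>X\<^esub>) = \<zero>\<^bsub>R\<^esub> \<odot>\<^bsub>Y\<^esub> f \<zero>\<^bsub>X\<^esub>"
    using assms(1) by (rule module_hom_smult) auto
  then show ?thesis
    using module_hom_closed[OF assms(1)] by simp
qed

lemma module_hom_uminus:
  assumes "f \<in> module_hom R X Y" "module R X" "module R Y" "x \<in> carrier X"
  shows "f (\<ominus>\<^bsub>X\<^esub> x) = \<ominus>\<^bsub>Y\<^esub> f x"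
proof -
  interpret X: module R X by fact
  interpret Y: module R Y by fact
  have "f (\<ominus>\<^bsub>R\<^esub> \<one>\<^bsub>R\<^esub> \<odot>\<^bsub>X\<^esub> x) = \<ominus>\<^bsub>R\<^esub> \<one>\<^bsub>R\<^esub> \<odot>\<^bsub>Y\<^esub> f x"
    using assms(1) by (rule module_hom_smult) (use assms in auto)
  then show ?thesis
    using module_hom_closed[OF assms(1)] assms(4) by (simp add: X.smult_l_minus Y.smult_l_minus)
qed

lemma module_hom_minus:
  assumes "f \<in> module_hom R X Y" "module R X" "module R Y" "x \<in> carrier X" "y \<in> carrier X"
  shows "f (x \<ominus>\<^bsub>X\<^esub> y) = f x \<ominus>\<^bsub>Y\<^esub> f y"
proof -
  interpret X: module R X by fact
  show ?thesis
    using assms by (simp add: a_minus_def module_hom_add[OF assms(1)] module_hom_uminus)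
qed

lemma module_hom_comp:
  assumes "f \<in> module_hom R X Y" "g \<in> module_hom R Y Z"
  shows "(\<lambda>x. g (f x)) \<in> module_hom R X Z"
  using assms by (intro module_homI) (simp_all add: module_hom_closed module_hom_add module_hom_smult)

lemma module_hom_id: "(\<lambda>x. x) \<in> module_hom R X X"
  by (intro module_homI) auto

lemma module_hom_const_zero:
  assumes "module R Y"
  shows "(\<lambda>x. \<zero>\<^bsub>Y\<^esub>) \<in> module_hom R X Y"
proof -
  interpret Y: module R Y by fact
  show ?thesis by (intro module_homI) auto
qed

lemma module_hom_add_fun:
  assumes "f \<in> module_hom R X Y" "g \<in> module_hom R X Y" "module R Y"
  shows "(\<lambda>x. f x \<oplus>\<^bsub>Y\<^esub> g x) \<in> module_hom R X Y"
proof -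
  interpret Y: module R Y by fact
  note c = module_hom_closed[OF assms(1)] module_hom_closed[OF assms(2)]
  show ?thesis
    by (intro module_homI)
      (simp_all add: c module_hom_add[OF assms(1)] module_hom_add[OF assms(2)] Y.smult_r_distr
        module_hom_smult[OF assms(1)] module_hom_smult[OF assms(2)] Y.a_ac)
qed

lemma module_hom_smult_fun:
  assumes "f \<in> module_hom R X Y" "a \<in> carrier R" "module R Y"
  shows "(\<lambda>x. a \<odot>\<^bsub>Y\<^esub> f x) \<in> module_hom R X Y"
proof -
  interpret Y: module R Y by fact
  note c = module_hom_closed[OF assms(1)]
  show ?thesis
    using assms(2)
    by (intro module_homI)
      (simp_all add: c module_hom_add[OF assms(1)] Y.smult_r_distr module_hom_smult[OF assms(1)]
        Y.R.m_comm flip: Y.smult_assoc1)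
qed

lemma module_hom_minus_fun:
  assumes "f \<in> module_hom R X Y" "g \<in> module_hom R X Y" "module R Y"
  shows "(\<lambda>x. f x \<ominus>\<^bsub>Y\<^esub> g x) \<in> module_hom R X Y"
proof -
  interpret Y: module R Y by fact
  note c = module_hom_closed[OF assms(1)] module_hom_closed[OF assms(2)]
  show ?thesis
    by (intro module_homI)
      (simp_all add: c module_hom_add[OF assms(1)] module_hom_add[OF assms(2)] Y.smult_r_distr
        module_hom_smult[OF assms(1)] module_hom_smult[OF assms(2)] Y.a_ac a_minus_def Y.minus_add
        Y.smult_r_minus)
qed

lemma module_hom_restrict_domain:
  "f \<in> module_hom R X Y \<Longrightarrow> N \<subseteq> carrier X \<Longrightarrow> f \<in> module_hom R (X\<lparr>carrier := N\<rparr>) Y"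
  by (intro module_homI) (auto simp: module_hom_closed module_hom_add module_hom_smult subset_iff)

lemma module_hom_restrict_codomain:
  "f \<in> module_hom R X Y \<Longrightarrow> f ` carrier X \<subseteq> N \<Longrightarrow> f \<in> module_hom R X (Y\<lparr>carrier := N\<rparr>)"
  by (auto simp: module_hom_def)

lemma module_hom_extend_codomain:
  "f \<in> module_hom R X (Y\<lparr>carrier := N\<rparr>) \<Longrightarrow> N \<subseteq> carrier Y \<Longrightarrow> f \<in> module_hom R X Y"
  by (auto simp: module_hom_def)

lemma module_hom_cong:
  assumes "f \<in> module_hom R X Y" "module R X" "\<And>x. x \<in> carrier X \<Longrightarrow> g x = f x"
  shows "g \<in> module_hom R X Y"
proof -
  interpret X: module R X by fact
  show ?thesis using assms(1,3) by (auto simp: module_hom_def)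
qed

section \<open>Submodules and factorization of homomorphisms\<close>

lemma submodule_kernel:
  assumes "f \<in> module_hom R X Y" "module R X" "module R Y"
  shows "submodule (a_kernel X Y f) R X"
proof -
  interpret X: module R X by fact
  interpret Y: module R Y by fact
  show ?thesis
    using assms
    by (intro X.submoduleI)
      (auto simp: a_kernel_def' module_hom_zero module_hom_uminus module_hom_add[OF assms(1)]
        module_hom_smult[OF assms(1)])
qed

lemma submodule_image:
  assumes "f \<in> module_hom R X Y" "module R X" "module R Y" "submodule N R X"
  shows "submodule (f ` N) R Y"
proof -
  interpret X: module R X by fact
  interpret Y: module R Y by fact
  note N = X.submoduleE[OF assms(4)]
  have N0: "\<zero>\<^bsub>X\<^esub> \<in> N"
    using subgroup.one_closed[OF submodule.axioms(1)[OF assms(4)]] by simp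
  show ?thesis
  proof (rule Y.submoduleI)
    show "f ` N \<subseteq> carrier Y" using N(1) module_hom_closed[OF assms(1)] by auto
    show "\<zero>\<^bsub>Y\<^esub> \<in> f ` N" using module_hom_zero[OF assms(1-3)] N0 by force
    show "\<ominus>\<^bsub>Y\<^esub> a \<in> f ` N" if a: "a \<in> f ` N" for a
    proof -
      obtain x where x: "x \<in> N" "a = f x" using a by auto
      then show ?thesis
        using N(1,3) by (intro image_eqI[of _ _ "\<ominus>\<^bsub>X\<^esub> x"]) (auto simp: module_hom_uminus[OF assms(1-3)])
    qed
    show "a \<oplus>\<^bsub>Y\<^esub> b \<in> f ` N" if ab: "a \<in> f ` N" "b \<in> f ` N" for a b
    proof -
      obtain x y where x: "x \<in> N" "a = f x" "y \<in> N" "b = f y" using ab by auto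
      then show ?thesis
        using N(1,5) by (intro image_eqI[of _ _ "x \<oplus>\<^bsub>X\<^esub> y"]) (auto simp: module_hom_add[OF assms(1)] subset_iff)
    qed
    show "a \<odot>\<^bsub>Y\<^esub> b \<in> f ` N" if ab: "a \<in> carrier R" "b \<in> f ` N" for a b
    proof -
      obtain y where y: "y \<in> N" "b = f y" using ab by auto
      then show ?thesis
        using N(1,4) ab(1)
        by (intro image_eqI[of _ _ "a \<odot>\<^bsub>X\<^esub> y"]) (auto simp: module_hom_smult[OF assms(1)] subset_iff)
    qed
  qed
qed

lemma submodule_subset: "submodule N R X \<Longrightarrow> N \<subseteq> carrier X"
  by (drule submodule.axioms(1), drule subgroup.subset) auto

lemma submodule_zero: "submodule N R X \<Longrightarrow> \<zero>\<^bsub>X\<^esub> \<in> N"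
  by (drule submodule.axioms(1), drule subgroup.one_closed) auto

lemma submodule_add: "submodule N R X \<Longrightarrow> x \<in> N \<Longrightarrow> y \<in> N \<Longrightarrow> x \<oplus>\<^bsub>X\<^esub> y \<in> N"
  by (drule submodule.axioms(1), drule subgroup.m_closed[of _ _ x y]) auto

lemma submodule_smult: "submodule N R X \<Longrightarrow> a \<in> carrier R \<Longrightarrow> x \<in> N \<Longrightarrow> a \<odot>\<^bsub>X\<^esub> x \<in> N"
  by (rule submodule.smult_closed)

lemma submodule_uminus: "module R X \<Longrightarrow> submodule N R X \<Longrightarrow> x \<in> N \<Longrightarrow> \<ominus>\<^bsub>X\<^esub> x \<in> N"
  by (rule module.submoduleE(3))

lemma submodule_minus:
  "module R X \<Longrightarrow> submodule N R X \<Longrightarrow> x \<in> N \<Longrightarrow> y \<in> N \<Longrightarrow> x \<ominus>\<^bsub>X\<^esub> y \<in> N"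
  by (simp add: a_minus_def submodule_add submodule_uminus)

lemma submodule_module: "submodule N R X \<Longrightarrow> module R X \<Longrightarrow> module R (X\<lparr>carrier := N\<rparr>)"
  by (rule submodule.submodule_is_module)

text \<open>Negatives need no separate check, being multiples by
  \<open>\<ominus> \<one>\<close>.\<close>

lemma submoduleI':
  assumes "module R X" "H \<subseteq> carrier X" "\<zero>\<^bsub>X\<^esub> \<in> H"
    and "\<And>a b. a \<in> H \<Longrightarrow> b \<in> H \<Longrightarrow> a \<oplus>\<^bsub>X\<^esub> b \<in> H"
    and "\<And>a x. a \<in> carrier R \<Longrightarrow> x \<in> H \<Longrightarrow> a \<odot>\<^bsub>X\<^esub> x \<in> H"
  shows "submodule H R X"
proof -
  interpret X: module R X by fact
  have "\<ominus>\<^bsub>X\<^esub> a \<in> H" if "a \<in> H" for a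
    using assms(5)[of "\<ominus>\<^bsub>R\<^esub> \<one>\<^bsub>R\<^esub>" a] that assms(2) by (auto simp: X.smult_l_minus subset_iff)
  then show ?thesis using assms by (intro X.submoduleI) auto
qed

text \<open>The universal property of a quotient, without cosets: \<open>Y\<close> plays the part of
  \<open>X\<close> modulo the kernel of \<open>p\<close>. The map \<open>g\<close> is
  \<open>f\<close> applied to a chosen preimage \<open>s y\<close>, and the condition on kernels
  makes the value independent of the choice.\<close>

lemma module_hom_factor:
  assumes p: "p \<in> module_hom R X Y" "p ` carrier X = carrier Y"
    and f: "f \<in> module_hom R X Z"
    and X: "module R X" and Y: "module R Y" and Z: "module R Z"
    and ker: "\<And>x. x \<in> carrier X \<Longrightarrow> p x = \<zero>\<^bsub>Y\<^esub> \<Longrightarrow> f x = \<zero>\<^bsub>Z\<^esub>"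
  obtains g where "g \<in> module_hom R Y Z" "\<And>x. x \<in> carrier X \<Longrightarrow> g (p x) = f x"
proof -
  interpret X: module R X by fact
  interpret Y: module R Y by fact
  interpret Z: module R Z by fact
  note pc = module_hom_closed[OF p(1)] and fc = module_hom_closed[OF f]
  have eq: "f x = f y" if "x \<in> carrier X" "y \<in> carrier X" "p x = p y" for x y
  proof -
    have "p (x \<ominus>\<^bsub>X\<^esub> y) = \<zero>\<^bsub>Y\<^esub>"
      using that pc[of y] by (simp add: module_hom_minus[OF p(1) X Y], simp add: a_minus_def Y.r_neg)
    then have "f (x \<ominus>\<^bsub>X\<^esub> y) = \<zero>\<^bsub>Z\<^esub>" using ker that by simp
    then show ?thesis
      using that fc Z.eq_if_minus_eq_zero by (simp add: module_hom_minus[OF f X Z])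
  qed
  define s where "s y = (SOME x. x \<in> carrier X \<and> p x = y)" for y
  have s: "s y \<in> carrier X" "p (s y) = y" if "y \<in> carrier Y" for y
  proof -
    have "\<exists>x. x \<in> carrier X \<and> p x = y" using that p(2) by (metis imageE)
    from someI_ex[OF this] show "s y \<in> carrier X" "p (s y) = y" by (simp_all add: s_def)
  qed
  have gp: "f (s (p x)) = f x" if "x \<in> carrier X" for x
    using that s pc by (intro eq) auto
  have "(\<lambda>y. f (s y)) \<in> module_hom R Y Z"
  proof (rule module_homI)
    show "f (s y) \<in> carrier Z" if "y \<in> carrier Y" for y using that s fc by auto
    show "f (s (x \<oplus>\<^bsub>Y\<^esub> y)) = f (s x) \<oplus>\<^bsub>Z\<^esub> f (s y)" if "x \<in> carrier Y" "y \<in> carrier Y" for x y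
    proof -
      have "x \<oplus>\<^bsub>Y\<^esub> y = p (s x \<oplus>\<^bsub>X\<^esub> s y)" using that s by (simp add: module_hom_add[OF p(1)])
      then show ?thesis using that s by (simp add: gp module_hom_add[OF f])
    qed
    show "f (s (a \<odot>\<^bsub>Y\<^esub> y)) = a \<odot>\<^bsub>Z\<^esub> f (s y)" if "a \<in> carrier R" "y \<in> carrier Y" for a y
    proof -
      have "a \<odot>\<^bsub>Y\<^esub> y = p (a \<odot>\<^bsub>X\<^esub> s y)" using that s by (simp add: module_hom_smult[OF p(1)])
      then show ?thesis using that s by (simp add: gp module_hom_smult[OF f])
    qed
  qed
  from this gp show ?thesis by (rule that)
qed

lemma module_hom_inv:
  assumes f: "f \<in> module_hom R X Y" and bij: "bij_betw f (carrier X) (carrier Y)" and X: "module R X"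
  shows "inv_into (carrier X) f \<in> module_hom R Y X"
proof -
  interpret X: module R X by fact
  let ?g = "inv_into (carrier X) f"
  have c: "?g y \<in> carrier X" "f (?g y) = y" if "y \<in> carrier Y" for y
    using that bij by (auto simp: bij_betw_def inv_into_into f_inv_into_f)
  have l: "?g (f x) = x" if "x \<in> carrier X" for x
    using that bij by (auto simp: bij_betw_def)
  show ?thesis
  proof (rule module_homI)
    show "?g y \<in> carrier X" if "y \<in> carrier Y" for y using that c by auto
    show "?g (x \<oplus>\<^bsub>Y\<^esub> y) = ?g x \<oplus>\<^bsub>X\<^esub> ?g y" if "x \<in> carrier Y" "y \<in> carrier Y" for x y
      using l[of "?g x \<oplus>\<^bsub>X\<^esub> ?g y"] that c by (simp add: module_hom_add[OF f])
    show "?g (a \<odot>\<^bsub>Y\<^esub> y) = a \<odot>\<^bsub>X\<^esub> ?g y" if "a \<in> carrier R" "y \<in> carrier Y" for a y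
      using l[of "a \<odot>\<^bsub>X\<^esub> ?g y"] that c by (simp add: module_hom_smult[OF f])
  qed
qed

lemma isomorphic_modulesE:
  assumes "isomorphic_modules R X Y" "module R X"
  obtains f g where "f \<in> module_hom R X Y" "g \<in> module_hom R Y X"
    "\<And>x. x \<in> carrier X \<Longrightarrow> g (f x) = x" "\<And>y. y \<in> carrier Y \<Longrightarrow> f (g y) = y"
proof -
  obtain f where f: "f \<in> module_hom R X Y" "bij_betw f (carrier X) (carrier Y)"
    using assms(1) by (auto simp: isomorphic_modules_def module_iso_def)
  show ?thesis
    by (rule that[of f "inv_into (carrier X) f"])
      (use f module_hom_inv[OF f assms(2)] in \<open>auto simp: bij_betw_def f_inv_into_f\<close>)
qed

section \<open>Free modules\<close>

context cring
begin

lemma ideal_module_simps [simp]: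
  "carrier (ideal_module R I) = I" "zero (ideal_module R I) = \<zero>"
  "add (ideal_module R I) = add R" "smult (ideal_module R I) = mult R"
  by (simp_all add: ideal_module_def)

lemma ring_module_module: "module R (ring_module R)"
  by (rule moduleI)
    (auto simp: is_cring l_distr r_distr m_assoc a_ac
      intro!: abelian_groupI bexI[of _ "\<ominus> _"] l_neg)

lemma ideal_module_eq: "ideal_module R I = (ring_module R)\<lparr>carrier := I\<rparr>"
  by (simp add: ideal_module_def)

lemma submodule_ring_module_iff: "submodule I R (ring_module R) \<longleftrightarrow> ideal I R"
proof
  assume I: "submodule I R (ring_module R)"
  have neg: "\<ominus> x \<in> I" if "x \<in> I" for x
    using submodule_smult[OF I, of "\<ominus> \<one>" x] that submodule_subset[OF I]
    by (auto simp: l_minus subset_iff)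
  have "subgroup I (add_monoid R)"
    using neg submodule_subset[OF I] submodule_zero[OF I] submodule_add[OF I]
    by (intro add.subgroupI) auto
  then show "ideal I R"
    using submodule_smult[OF I] submodule_subset[OF I] m_comm
    by (intro idealI ring_axioms) (force simp: subset_iff)+
next
  assume I: "ideal I R"
  then interpret I: ideal I R .
  show "submodule I R (ring_module R)"
    by (rule submoduleI') (use I.a_subset in \<open>auto simp: ring_module_module I.I_l_closed\<close>)
qed

lemma ideal_zero: "ideal I R \<Longrightarrow> \<zero> \<in> I"
  by (rule additive_subgroup.zero_closed[OF ideal.axioms(1)])

lemma ideal_add: "ideal I R \<Longrightarrow> x \<in> I \<Longrightarrow> y \<in> I \<Longrightarrow> x \<oplus> y \<in> I"
  by (rule additive_subgroup.a_closed[OF ideal.axioms(1)])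

lemma ideal_module_module: "ideal I R \<Longrightarrow> module R (ideal_module R I)"
  by (subst ideal_module_eq, rule submodule_module)
    (simp_all add: submodule_ring_module_iff ring_module_module)

lemma free_power_simps [simp]:
  "carrier (free_power R n) = (\<Pi>\<^sub>E i \<in> {..<n}. carrier R)"
  "zero (free_power R n) = (\<lambda>i \<in> {..<n}. \<zero>)"
  "x \<oplus>\<^bsub>free_power R n\<^esub> y = (\<lambda>i \<in> {..<n}. x i \<oplus> y i)"
  "a \<odot>\<^bsub>free_power R n\<^esub> x = (\<lambda>i \<in> {..<n}. a \<otimes> x i)"
  by (simp_all add: free_power_def)

lemma free_power_module: "module R (free_power R n)"
proof (rule moduleI)
  show "abelian_group (free_power R n)"
  proof (rule abelian_groupI)
    fix x assume "x \<in> carrier (free_power R n)"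
    then show "\<exists>y\<in>carrier (free_power R n). y \<oplus>\<^bsub>free_power R n\<^esub> x = \<zero>\<^bsub>free_power R n\<^esub>"
      by (intro bexI[of _ "\<lambda>i \<in> {..<n}. \<ominus> x i"]) (auto simp: PiE_iff l_neg)
  qed (auto simp: PiE_iff a_assoc extensional_def fun_eq_iff intro: a_comm)
qed (auto simp: PiE_iff is_cring l_distr r_distr m_assoc extensional_def fun_eq_iff)

text \<open>For \<open>i \<ge> n\<close> this is the zero vector, so that membership in the free
  power needs no bound on \<open>i\<close>.\<close>

definition unit_vec :: "nat \<Rightarrow> nat \<Rightarrow> nat \<Rightarrow> 'a" where
  "unit_vec n i = (\<lambda>j \<in> {..<n}. if j = i then \<one> else \<zero>)"

lemma unit_vec_closed [simp]: "unit_vec n i \<in> carrier (free_power R n)"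
  by (auto simp: unit_vec_def)

end

section \<open>Linear combinations and the universal property of free powers\<close>

fun lincomb :: "('a, 'b, 'm) module_scheme \<Rightarrow> (nat \<Rightarrow> 'a) \<Rightarrow> (nat \<Rightarrow> 'b) \<Rightarrow> nat \<Rightarrow> 'b" where
  "lincomb X a y 0 = \<zero>\<^bsub>X\<^esub>"
| "lincomb X a y (Suc n) = lincomb X a y n \<oplus>\<^bsub>X\<^esub> a n \<odot>\<^bsub>X\<^esub> y n"

lemma lincomb_cong:
  "(\<And>i. i < n \<Longrightarrow> a i = b i) \<Longrightarrow> (\<And>i. i < n \<Longrightarrow> x i = y i) \<Longrightarrow> lincomb X a x n = lincomb X b y n"
  by (induction n) auto

lemma lincomb_in_submodule:
  assumes "submodule N R X" "\<And>i. i < n \<Longrightarrow> a i \<in> carrier R" "\<And>i. i < n \<Longrightarrow> y i \<in> N"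
  shows "lincomb X a y n \<in> N"
  using assms by (induction n) (auto intro: submodule_zero submodule_add submodule_smult)

lemma lincomb_closed:
  assumes "module R X" "\<And>i. i < n \<Longrightarrow> a i \<in> carrier R" "\<And>i. i < n \<Longrightarrow> y i \<in> carrier X"
  shows "lincomb X a y n \<in> carrier X"
  using assms by (intro lincomb_in_submodule module.carrier_is_submodule)

lemma lincomb_hom:
  assumes "f \<in> module_hom R X Y" "module R X" "module R Y"
    and "\<And>i. i < n \<Longrightarrow> a i \<in> carrier R" "\<And>i. i < n \<Longrightarrow> y i \<in> carrier X"
  shows "f (lincomb X a y n) = lincomb Y a (\<lambda>i. f (y i)) n"
proof -
  interpret X: module R X by fact
  show ?thesis
    using assms(4,5)
    by (induction n) (simp_all add: module_hom_zero[OF assms(1-3)] module_hom_add[OF assms(1)]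
        module_hom_smult[OF assms(1)] lincomb_closed[OF assms(2)])
qed

context cring
begin

lemma hom_free_power_eq:
  assumes f: "f \<in> module_hom R (free_power R n) Y" and Y: "module R Y"
    and x: "x \<in> carrier (free_power R n)"
  shows "f x = lincomb Y x (\<lambda>i. f (unit_vec n i)) n"
proof -
  interpret Y: module R Y by fact
  \<comment> \<open>\<open>t k\<close> is \<open>x\<close> truncated to its first \<open>k\<close>
    coordinates; passing from \<open>t k\<close> to \<open>t (Suc k)\<close> adds one multiple of a
    unit vector, and \<open>t n = x\<close> because vectors are extensional.\<close>
  define t where "t k = (\<lambda>j \<in> {..<n}. if j < k then x j else \<zero>)" for k
  have xc: "x i \<in> carrier R" if "i < n" for i using x that by auto
  have tc: "t k \<in> carrier (free_power R n)" for k using xc by (auto simp: t_def)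
  have "f (t k) = lincomb Y x (\<lambda>i. f (unit_vec n i)) k" if "k \<le> n" for k
    using that
  proof (induction k)
    case 0
    have "t 0 = \<zero>\<^bsub>free_power R n\<^esub>" by (simp add: t_def)
    then show ?case by (simp del: free_power_simps add: module_hom_zero[OF f free_power_module Y])
  next
    case (Suc k)
    have "t (Suc k) = t k \<oplus>\<^bsub>free_power R n\<^esub> x k \<odot>\<^bsub>free_power R n\<^esub> unit_vec n k"
      using Suc.prems xc by (auto simp: t_def unit_vec_def fun_eq_iff less_Suc_eq)
    then show ?case
      using Suc xc tc module.smult_closed[OF free_power_module]
      by (simp del: free_power_simps add: module_hom_add[OF f] module_hom_smult[OF f])
  qed
  moreover have "t n = x" using x by (auto simp: t_def fun_eq_iff PiE_iff extensional_def)
  ultimately show ?thesis by force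
qed

lemma hom_from_free_power:
  assumes Y: "module R Y" and y: "\<And>i. i < n \<Longrightarrow> y i \<in> carrier Y"
  shows "(\<lambda>x. lincomb Y x y n) \<in> module_hom R (free_power R n) Y"
proof (rule module_homI)
  interpret Y: module R Y by fact
  show "lincomb Y x y n \<in> carrier Y" if "x \<in> carrier (free_power R n)" for x
    using that y by (intro lincomb_closed[OF Y]) auto
  have add: "lincomb Y (\<lambda>i. a i \<oplus> b i) y k = lincomb Y a y k \<oplus>\<^bsub>Y\<^esub> lincomb Y b y k"
    if "\<And>i. i < k \<Longrightarrow> a i \<in> carrier R" "\<And>i. i < k \<Longrightarrow> b i \<in> carrier R" "k \<le> n" for a b k
    using that
  proof (induction k)
    case (Suc k)
    then have "lincomb Y a y k \<in> carrier Y" "lincomb Y b y k \<in> carrier Y"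
      using y by (auto intro!: lincomb_closed[OF Y])
    then show ?case using Suc y by (simp add: Y.smult_l_distr Y.a_ac)
  qed simp
  show "lincomb Y (x \<oplus>\<^bsub>free_power R n\<^esub> x') y n = lincomb Y x y n \<oplus>\<^bsub>Y\<^esub> lincomb Y x' y n"
    if "x \<in> carrier (free_power R n)" "x' \<in> carrier (free_power R n)" for x x'
  proof -
    have "lincomb Y (x \<oplus>\<^bsub>free_power R n\<^esub> x') y n = lincomb Y (\<lambda>i. x i \<oplus> x' i) y n"
      by (rule lincomb_cong) auto
    also have "\<dots> = lincomb Y x y n \<oplus>\<^bsub>Y\<^esub> lincomb Y x' y n"
      using that by (intro add) auto
    finally show ?thesis .
  qed
  have smult: "lincomb Y (\<lambda>i. c \<otimes> a i) y k = c \<odot>\<^bsub>Y\<^esub> lincomb Y a y k"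
    if "\<And>i. i < k \<Longrightarrow> a i \<in> carrier R" "c \<in> carrier R" "k \<le> n" for a c k
    using that
  proof (induction k)
    case (Suc k)
    then have "lincomb Y a y k \<in> carrier Y"
      using y by (auto intro!: lincomb_closed[OF Y])
    then show ?case using Suc y by (simp add: Y.smult_r_distr Y.smult_assoc1)
  qed simp
  show "lincomb Y (c \<odot>\<^bsub>free_power R n\<^esub> x) y n = c \<odot>\<^bsub>Y\<^esub> lincomb Y x y n"
    if "c \<in> carrier R" "x \<in> carrier (free_power R n)" for c x
  proof -
    have "lincomb Y (c \<odot>\<^bsub>free_power R n\<^esub> x) y n = lincomb Y (\<lambda>i. c \<otimes> x i) y n"
      by (rule lincomb_cong) auto
    also have "\<dots> = c \<odot>\<^bsub>Y\<^esub> lincomb Y x y n"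
      using that by (intro smult) auto
    finally show ?thesis .
  qed
qed

lemma lincomb_unit_vec:
  assumes Y: "module R Y" and y: "\<And>i. i < n \<Longrightarrow> y i \<in> carrier Y" and i: "i < n"
  shows "lincomb Y (unit_vec n i) y n = y i"
proof -
  interpret Y: module R Y by fact
  have "lincomb Y (unit_vec n i) y k = (if i < k then y i else \<zero>\<^bsub>Y\<^esub>)" if "k \<le> n" for k
    using that y i by (induction k) (auto simp: unit_vec_def less_Suc_eq)
  then show ?thesis using i by simp
qed

text \<open>Projectivity of free powers: send each unit vector to a chosen preimage under
  \<open>q\<close>. Surjectivity of \<open>q\<close> is weakened to an inclusion of images.\<close>

lemma free_power_lift:
  assumes f: "f \<in> module_hom R (free_power R n) Y" and q: "q \<in> module_hom R E Y"
    and im: "f ` carrier (free_power R n) \<subseteq> q ` carrier E"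
    and E: "module R E" and Y: "module R Y"
  obtains g where "g \<in> module_hom R (free_power R n) E"
    "\<And>x. x \<in> carrier (free_power R n) \<Longrightarrow> q (g x) = f x"
proof -
  define y where "y i = (SOME e. e \<in> carrier E \<and> q e = f (unit_vec n i))" for i
  have y: "y i \<in> carrier E" "q (y i) = f (unit_vec n i)" for i
  proof -
    have "\<exists>e. e \<in> carrier E \<and> q e = f (unit_vec n i)"
      using im unit_vec_closed[of n i] by (metis imageE imageI subsetD)
    from someI_ex[OF this] show "y i \<in> carrier E" "q (y i) = f (unit_vec n i)"
      by (simp_all add: y_def)
  qed
  show ?thesis
  proof (rule that)
    show "(\<lambda>x. lincomb E x y n) \<in> module_hom R (free_power R n) E"
      using E y by (intro hom_from_free_power)
    fix x assume x: "x \<in> carrier (free_power R n)"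
    have "q (lincomb E x y n) = lincomb Y x (\<lambda>i. q (y i)) n"
      using x y by (intro lincomb_hom[OF q E Y]) auto
    then show "q (lincomb E x y n) = f x"
      using hom_free_power_eq[OF f Y x] y by simp
  qed
qed

end

section \<open>Presentations, stable retracts and extensions\<close>

text \<open>Only a surjection from a free power, so this amounts to finite generation with chosen
  generators; the relations are the kernel and are not part of the data.\<close>

definition presentation ::
    "('a, 'r) ring_scheme \<Rightarrow> nat \<Rightarrow> ((nat \<Rightarrow> 'a) \<Rightarrow> 'b) \<Rightarrow> ('a, 'b, 'm) module_scheme \<Rightarrow> bool"
  where "presentation R n p X \<longleftrightarrow> module R X \<and> p \<in> module_hom R (free_power R n) X \<and>
    p ` carrier (free_power R n) = carrier X"

definition kernel_module ::
    "('a, 'r) ring_scheme \<Rightarrow> nat \<Rightarrow> ((nat \<Rightarrow> 'a) \<Rightarrow> 'b) \<Rightarrow> ('a, 'b, 'm) module_scheme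
      \<Rightarrow> ('a, nat \<Rightarrow> 'a) module"
  where "kernel_module R n p X = (free_power R n)\<lparr>carrier := a_kernel (free_power R n) X p\<rparr>"

text \<open>\<open>X\<close> is a retract of \<open>Y\<close> in the category of modules modulo maps that factor through a free
  module.\<close>

definition stable_retract ::
    "('a, 'r) ring_scheme \<Rightarrow> ('a, 'b, 'm) module_scheme \<Rightarrow> ('a, 'c, 'n) module_scheme \<Rightarrow> bool"
  where "stable_retract R X Y \<longleftrightarrow> (\<exists>a b k u v. a \<in> module_hom R X Y \<and> b \<in> module_hom R Y X \<and>
    u \<in> module_hom R X (free_power R k) \<and> v \<in> module_hom R (free_power R k) X \<and>
    (\<forall>x \<in> carrier X. x = b (a x) \<oplus>\<^bsub>X\<^esub> v (u x)))"

text \<open>These are the finitely generated projective modules. They stand in for free modules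
  because the property passes to kernels of presentations and along stable retracts.\<close>

definition free_retract :: "('a, 'r) ring_scheme \<Rightarrow> ('a, 'b, 'm) module_scheme \<Rightarrow> bool"
  where "free_retract R X \<longleftrightarrow> (\<exists>k u v. u \<in> module_hom R X (free_power R k) \<and>
    v \<in> module_hom R (free_power R k) X \<and> (\<forall>x \<in> carrier X. v (u x) = x))"

text \<open>Vanishing of \<open>Ext\<^sup>1\<close>, expressed by the extension of maps along the inclusion of the
  kernel in some presentation by a free module; by \<open>ext1_zeroE\<close> below, every presentation
  then has this property.\<close>

definition ext1_zero ::
    "('a, 'r) ring_scheme \<Rightarrow> ('a, 'b, 'm) module_scheme \<Rightarrow> ('a, 'c, 'n) module_scheme \<Rightarrow> bool"
  where "ext1_zero R X Y \<longleftrightarrow> (\<exists>n p. presentation R n p X \<and>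
    (\<forall>f \<in> module_hom R (kernel_module R n p X) Y. \<exists>g \<in> module_hom R (free_power R n) Y.
      \<forall>x \<in> a_kernel (free_power R n) X p. g x = f x))"

lemma kernel_module_simps [simp]:
  "carrier (kernel_module R n p X) = a_kernel (free_power R n) X p"
  "zero (kernel_module R n p X) = zero (free_power R n)"
  "add (kernel_module R n p X) = add (free_power R n)"
  "smult (kernel_module R n p X) = smult (free_power R n)"
  by (simp_all add: kernel_module_def)

lemma a_kernel_iff: "x \<in> a_kernel X Y f \<longleftrightarrow> x \<in> carrier X \<and> f x = \<zero>\<^bsub>Y\<^esub>"
  by (simp add: a_kernel_def')

lemma a_kernel_subset: "a_kernel X Y f \<subseteq> carrier X"
  by (auto simp: a_kernel_iff)

lemma presentationD:
  assumes "presentation R n p X"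
  shows "module R X" "p \<in> module_hom R (free_power R n) X"
    "p ` carrier (free_power R n) = carrier X"
  using assms by (simp_all add: presentation_def)

lemma stable_retract_refl:
  assumes "module R X"
  shows "stable_retract R X X"
proof -
  interpret X: module R X by fact
  note F = X.R.free_power_module[of 0]
  show ?thesis
    unfolding stable_retract_def
    by (intro exI[of _ "\<lambda>x. x"] exI[of _ "0::nat"] exI[of _ "\<lambda>x. \<zero>\<^bsub>X\<^esub>"]
        exI[of _ "\<lambda>x. \<zero>\<^bsub>free_power R 0\<^esub>"])
      (use module_hom_id[of R X] module_hom_const_zero[OF F, of X] module_hom_const_zero[OF assms]
        in auto)
qed

context cring
begin

declare free_power_simps [simp del]

section \<open>Comparison of presentations and dimension shifting\<close>

lemma kernel_module_module: "presentation R n p X \<Longrightarrow> module R (kernel_module R n p X)"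
  unfolding kernel_module_def
  by (rule submodule_module) (auto simp: presentation_def free_power_module intro: submodule_kernel)

lemma presentation_lift:
  assumes "presentation R n p X" "presentation R m q Y" "a \<in> module_hom R X Y"
  obtains \<alpha> where "\<alpha> \<in> module_hom R (free_power R n) (free_power R m)"
    "\<And>x. x \<in> carrier (free_power R n) \<Longrightarrow> q (\<alpha> x) = a (p x)"
proof -
  note p = presentationD[OF assms(1)] and q = presentationD[OF assms(2)]
  have "(\<lambda>x. a (p x)) ` carrier (free_power R n) \<subseteq> q ` carrier (free_power R m)"
    using q(3) module_hom_closed[OF assms(3)] module_hom_closed[OF p(2)] by auto
  then show ?thesis
    by (rule free_power_lift[OF module_hom_comp[OF p(2) assms(3)] q(2)])
      (use free_power_module q(1) that in auto)
qed

text \<open>The two maps of the retraction lift to the free covers. On the kernel of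
  \<open>p\<close> the lifts compose to the identity up to an error \<open>\<tau>\<close>, and this
  error is defined on the whole cover with values in the kernel. Both consequences below rest on
  that: \<open>\<tau>\<close> exhibits a factorization through a free module, and it makes any map
  composed with it extend.\<close>

lemma stable_retract_lift:
  assumes SR: "stable_retract R X Y" and pX: "presentation R n p X" and qY: "presentation R m q Y"
  obtains \<alpha> \<beta> \<tau> where "\<alpha> \<in> module_hom R (free_power R n) (free_power R m)"
    "\<beta> \<in> module_hom R (free_power R m) (free_power R n)"
    "\<tau> \<in> module_hom R (free_power R n) (kernel_module R n p X)"
    "\<And>x. x \<in> a_kernel (free_power R n) X p \<Longrightarrow> \<alpha> x \<in> a_kernel (free_power R m) Y q"
    "\<And>x. x \<in> a_kernel (free_power R m) Y q \<Longrightarrow> \<beta> x \<in> a_kernel (free_power R n) X p"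
    "\<And>x. x \<in> a_kernel (free_power R n) X p \<Longrightarrow> x = \<beta> (\<alpha> x) \<oplus>\<^bsub>free_power R n\<^esub> \<tau> x"
proof -
  note p = presentationD[OF pX] and q = presentationD[OF qY]
  obtain a b k u v where ab: "a \<in> module_hom R X Y" "b \<in> module_hom R Y X"
    and u: "u \<in> module_hom R X (free_power R k)" and v: "v \<in> module_hom R (free_power R k) X"
    and id: "\<And>x. x \<in> carrier X \<Longrightarrow> x = b (a x) \<oplus>\<^bsub>X\<^esub> v (u x)"
    using SR unfolding stable_retract_def by blast
  interpret P: module R "free_power R n" by (rule free_power_module)
  interpret X: module R X by (rule p(1))
  obtain \<alpha> where \<alpha>: "\<alpha> \<in> module_hom R (free_power R n) (free_power R m)"
    "\<And>x. x \<in> carrier (free_power R n) \<Longrightarrow> q (\<alpha> x) = a (p x)"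
    using presentation_lift[OF pX qY ab(1)] by blast
  obtain \<beta> where \<beta>: "\<beta> \<in> module_hom R (free_power R m) (free_power R n)"
    "\<And>x. x \<in> carrier (free_power R m) \<Longrightarrow> p (\<beta> x) = b (q x)"
    using presentation_lift[OF qY pX ab(2)] by blast
  obtain w where w: "w \<in> module_hom R (free_power R k) (free_power R n)"
    "\<And>x. x \<in> carrier (free_power R k) \<Longrightarrow> p (w x) = v x"
    using free_power_lift[OF v p(2) _ free_power_module p(1)] module_hom_closed[OF v] p(3) by blast
  note cl = module_hom_closed[OF p(2)] module_hom_closed[OF \<alpha>(1)] module_hom_closed[OF \<beta>(1)]
    module_hom_closed[OF w(1)] module_hom_closed[OF ab(1)] module_hom_closed[OF ab(2)]
    module_hom_closed[OF u] module_hom_closed[OF v]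
  \<comment> \<open>\<open>\<sigma>\<close> covers the identity of \<open>X\<close>, so
    \<open>x - \<sigma> x\<close> lies in the kernel of \<open>p\<close> for every \<open>x\<close>.
    Its second summand factors through \<open>p\<close> and hence vanishes on the kernel, where
    \<open>\<sigma>\<close> is just \<open>\<beta>\<close> after \<open>\<alpha>\<close>.\<close>
  define \<sigma> where "\<sigma> x = \<beta> (\<alpha> x) \<oplus>\<^bsub>free_power R n\<^esub> w (u (p x))" for x
  have \<sigma>: "\<sigma> \<in> module_hom R (free_power R n) (free_power R n)"
    unfolding \<sigma>_def
    by (intro module_hom_add_fun module_hom_comp[OF \<alpha>(1) \<beta>(1)]
        module_hom_comp[OF module_hom_comp[OF p(2) u] w(1)] free_power_module)
  define \<tau> where "\<tau> x = x \<ominus>\<^bsub>free_power R n\<^esub> \<sigma> x" for x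
  have \<tau>: "\<tau> \<in> module_hom R (free_power R n) (free_power R n)"
    unfolding \<tau>_def by (intro module_hom_minus_fun module_hom_id \<sigma> free_power_module)
  have p\<sigma>: "p (\<sigma> x) = p x" if "x \<in> carrier (free_power R n)" for x
    using that cl id[of "p x"] by (simp add: \<sigma>_def module_hom_add[OF p(2)] \<alpha> \<beta> w)
  have "p (\<tau> x) = \<zero>\<^bsub>X\<^esub>" if "x \<in> carrier (free_power R n)" for x
    using that cl(1)[OF that] module_hom_closed[OF \<sigma> that]
    by (simp add: \<tau>_def module_hom_minus[OF p(2) free_power_module p(1)] p\<sigma>, simp add: a_minus_def X.M.r_neg)
  then have \<tau>': "\<tau> \<in> module_hom R (free_power R n) (kernel_module R n p X)"
    unfolding kernel_module_def using module_hom_closed[OF \<tau>]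
    by (intro module_hom_restrict_codomain \<tau>) (auto simp: a_kernel_iff)
  show ?thesis
  proof (rule that[OF \<alpha>(1) \<beta>(1) \<tau>'])
    show "\<alpha> x \<in> a_kernel (free_power R m) Y q" if "x \<in> a_kernel (free_power R n) X p" for x
      using that cl by (auto simp: a_kernel_iff \<alpha> module_hom_zero[OF ab(1) p(1) q(1)])
    show "\<beta> x \<in> a_kernel (free_power R n) X p" if "x \<in> a_kernel (free_power R m) Y q" for x
      using that cl by (auto simp: a_kernel_iff \<beta> module_hom_zero[OF ab(2) q(1) p(1)])
    show "x = \<beta> (\<alpha> x) \<oplus>\<^bsub>free_power R n\<^esub> \<tau> x" if "x \<in> a_kernel (free_power R n) X p" for x
    proof -
      have x: "x \<in> carrier (free_power R n)" "p x = \<zero>\<^bsub>X\<^esub>" using that by (auto simp: a_kernel_iff)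
      then have "\<sigma> x = \<beta> (\<alpha> x)"
        using cl by (simp add: \<sigma>_def module_hom_zero[OF u p(1) free_power_module]
            module_hom_zero[OF w(1) free_power_module free_power_module])
      then show ?thesis
        using x cl by (simp add: \<tau>_def a_minus_def P.M.a_lcomm[of "\<beta> (\<alpha> x)"] P.M.r_neg)
    qed
  qed
qed

text \<open>Taking syzygies respects stable retracts: the error \<open>\<tau>\<close> factors
  through the inclusion of the kernel into \<open>free_power R n\<close>.\<close>

lemma stable_retract_kernel:
  assumes SR: "stable_retract R X Y" and pX: "presentation R n p X" and qY: "presentation R m q Y"
  shows "stable_retract R (kernel_module R n p X) (kernel_module R m q Y)"
proof -
  obtain \<alpha> \<beta> \<tau> where *: "\<alpha> \<in> module_hom R (free_power R n) (free_power R m)"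
    "\<beta> \<in> module_hom R (free_power R m) (free_power R n)"
    "\<tau> \<in> module_hom R (free_power R n) (kernel_module R n p X)"
    "\<And>x. x \<in> a_kernel (free_power R n) X p \<Longrightarrow> \<alpha> x \<in> a_kernel (free_power R m) Y q"
    "\<And>x. x \<in> a_kernel (free_power R m) Y q \<Longrightarrow> \<beta> x \<in> a_kernel (free_power R n) X p"
    "\<And>x. x \<in> a_kernel (free_power R n) X p \<Longrightarrow> x = \<beta> (\<alpha> x) \<oplus>\<^bsub>free_power R n\<^esub> \<tau> x"
    using stable_retract_lift[OF SR pX qY] by metis
  have \<alpha>: "\<alpha> \<in> module_hom R (kernel_module R n p X) (kernel_module R m q Y)"
    unfolding kernel_module_def using *(4)
    by (intro module_hom_restrict_codomain module_hom_restrict_domain *(1) a_kernel_subset) auto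
  have \<beta>: "\<beta> \<in> module_hom R (kernel_module R m q Y) (kernel_module R n p X)"
    unfolding kernel_module_def using *(5)
    by (intro module_hom_restrict_codomain module_hom_restrict_domain *(2) a_kernel_subset) auto
  have i: "(\<lambda>x. x) \<in> module_hom R (kernel_module R n p X) (free_power R n)"
    unfolding kernel_module_def
    by (intro module_hom_restrict_domain module_hom_id a_kernel_subset)
  show ?thesis
    unfolding stable_retract_def
    by (rule exI[of _ \<alpha>], rule exI[of _ \<beta>], rule exI[of _ n], rule exI[of _ "\<lambda>x. x"], rule exI[of _ \<tau>])
      (use \<alpha> \<beta> i *(3,6) in simp)
qed

text \<open>On the kernel \<open>f\<close> splits into \<open>f\<close> after \<open>\<beta>\<close>
  after \<open>\<alpha>\<close> and \<open>f\<close> after \<open>\<tau>\<close>. In the first part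
  \<open>f\<close> after \<open>\<beta>\<close> lives on the kernel for \<open>Y\<close> and extends
  by hypothesis; the second is already defined on the whole cover. Taking \<open>Y = X\<close> shows
  independence of the presentation.\<close>

lemma ext1_zeroE_stable_retract:
  assumes SR: "stable_retract R X Y" and ext: "ext1_zero R Y Z"
    and pX: "presentation R n p X" and Z: "module R Z"
    and f: "f \<in> module_hom R (kernel_module R n p X) Z"
  obtains g where "g \<in> module_hom R (free_power R n) Z"
    "\<And>x. x \<in> a_kernel (free_power R n) X p \<Longrightarrow> g x = f x"
proof -
  obtain m q where qY: "presentation R m q Y"
    and e: "\<And>f. f \<in> module_hom R (kernel_module R m q Y) Z \<Longrightarrow> \<exists>g \<in> module_hom R (free_power R m) Z.
      \<forall>x \<in> a_kernel (free_power R m) Y q. g x = f x"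
    using ext unfolding ext1_zero_def by blast
  obtain \<alpha> \<beta> \<tau> where *: "\<alpha> \<in> module_hom R (free_power R n) (free_power R m)"
    "\<beta> \<in> module_hom R (free_power R m) (free_power R n)"
    "\<tau> \<in> module_hom R (free_power R n) (kernel_module R n p X)"
    "\<And>x. x \<in> a_kernel (free_power R n) X p \<Longrightarrow> \<alpha> x \<in> a_kernel (free_power R m) Y q"
    "\<And>x. x \<in> a_kernel (free_power R m) Y q \<Longrightarrow> \<beta> x \<in> a_kernel (free_power R n) X p"
    "\<And>x. x \<in> a_kernel (free_power R n) X p \<Longrightarrow> x = \<beta> (\<alpha> x) \<oplus>\<^bsub>free_power R n\<^esub> \<tau> x"
    using stable_retract_lift[OF SR pX qY] by metis
  have \<beta>: "\<beta> \<in> module_hom R (kernel_module R m q Y) (kernel_module R n p X)"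
    unfolding kernel_module_def using *(5)
    by (intro module_hom_restrict_codomain module_hom_restrict_domain *(2) a_kernel_subset) auto
  obtain h where h: "h \<in> module_hom R (free_power R m) Z"
    "\<And>x. x \<in> a_kernel (free_power R m) Y q \<Longrightarrow> h x = f (\<beta> x)"
    using e[OF module_hom_comp[OF \<beta> f]] by blast
  show ?thesis
  proof (rule that)
    show "(\<lambda>x. h (\<alpha> x) \<oplus>\<^bsub>Z\<^esub> f (\<tau> x)) \<in> module_hom R (free_power R n) Z"
      by (intro module_hom_add_fun module_hom_comp[OF *(1) h(1)] module_hom_comp[OF *(3) f] Z)
    fix x assume x: "x \<in> a_kernel (free_power R n) X p"
    have "f x = f (\<beta> (\<alpha> x) \<oplus>\<^bsub>kernel_module R n p X\<^esub> \<tau> x)"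
      using *(6)[OF x] by simp
    also have "\<dots> = h (\<alpha> x) \<oplus>\<^bsub>Z\<^esub> f (\<tau> x)"
      using *(4,5) x module_hom_closed[OF *(3), of x] a_kernel_subset
      by (subst module_hom_add[OF f]) (auto simp: h a_kernel_iff)
    finally show "h (\<alpha> x) \<oplus>\<^bsub>Z\<^esub> f (\<tau> x) = f x" by simp
  qed
qed

lemma ext1_zeroE:
  assumes "ext1_zero R X Z" "presentation R n p X" "module R Z"
    and "f \<in> module_hom R (kernel_module R n p X) Z"
  obtains g where "g \<in> module_hom R (free_power R n) Z"
    "\<And>x. x \<in> a_kernel (free_power R n) X p \<Longrightarrow> g x = f x"
  using ext1_zeroE_stable_retract[OF stable_retract_refl assms] presentationD(1)[OF assms(2)] by metis

lemma ext1_zero_stable_retract_left: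
  assumes "stable_retract R X Y" "ext1_zero R Y Z" "presentation R n p X" "module R Z"
  shows "ext1_zero R X Z"
  unfolding ext1_zero_def
  using assms(3) ext1_zeroE_stable_retract[OF assms] by metis

lemma coordinate_hom: "i < n \<Longrightarrow> (\<lambda>x. x i) \<in> module_hom R (free_power R n) (ring_module R)"
  by (rule module_homI) (auto simp: free_power_simps)

lemma tuple_hom:
  assumes "\<And>i. i < n \<Longrightarrow> g i \<in> module_hom R X (ring_module R)"
  shows "(\<lambda>x. \<lambda>i \<in> {..<n}. g i x) \<in> module_hom R X (free_power R n)"
  using module_hom_closed[OF assms]
  by (intro module_homI)
    (auto simp: free_power_simps module_hom_add[OF assms] module_hom_smult[OF assms] fun_eq_iff)

lemma ext1_zero_free_power:
  assumes "ext1_zero R X (ring_module R)"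
  shows "ext1_zero R X (free_power R k)"
proof -
  obtain n p where pX: "presentation R n p X"
    and e: "\<And>f. f \<in> module_hom R (kernel_module R n p X) (ring_module R) \<Longrightarrow>
      \<exists>g \<in> module_hom R (free_power R n) (ring_module R). \<forall>x \<in> a_kernel (free_power R n) X p. g x = f x"
    using assms unfolding ext1_zero_def by blast
  have "\<exists>g \<in> module_hom R (free_power R n) (free_power R k). \<forall>x \<in> a_kernel (free_power R n) X p. g x = f x"
    if f: "f \<in> module_hom R (kernel_module R n p X) (free_power R k)" for f
  proof -
    have "\<forall>i. \<exists>g. i < k \<longrightarrow> g \<in> module_hom R (free_power R n) (ring_module R) \<and>
        (\<forall>x \<in> a_kernel (free_power R n) X p. g x = f x i)"
      using e[OF module_hom_comp[OF f coordinate_hom]] by blast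
    then obtain g where g: "\<And>i. i < k \<Longrightarrow> g i \<in> module_hom R (free_power R n) (ring_module R)"
      "\<And>i x. i < k \<Longrightarrow> x \<in> a_kernel (free_power R n) X p \<Longrightarrow> g i x = f x i"
      by metis
    show ?thesis
    proof (rule bexI[OF _ tuple_hom[of k g, OF g(1)]], safe)
      fix x assume x: "x \<in> a_kernel (free_power R n) X p"
      then have "f x \<in> carrier (free_power R k)" using module_hom_closed[OF f, of x] by simp
      then show "(\<lambda>i \<in> {..<k}. g i x) = f x"
        using x g(2) by (auto simp: free_power_simps fun_eq_iff PiE_iff extensional_def)
    qed
  qed
  with pX show ?thesis unfolding ext1_zero_def by blast
qed

text \<open>\<open>f\<close> equals \<open>b\<close> after \<open>a\<close> after \<open>f\<close>
  plus \<open>v\<close> after \<open>u\<close> after \<open>f\<close>, so it is enough to extend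
  \<open>a\<close> after \<open>f\<close> into \<open>W\<close> and \<open>u\<close> after
  \<open>f\<close> into a free power. The latter is where vanishing against \<open>R\<close>
  enters.\<close>

lemma ext1_zero_stable_retract_right:
  assumes SR: "stable_retract R Z W" and W: "ext1_zero R X W" and S: "ext1_zero R X (ring_module R)"
    and mod: "module R Z" "module R W"
  shows "ext1_zero R X Z"
proof -
  obtain a b k u v where ab: "a \<in> module_hom R Z W" "b \<in> module_hom R W Z"
    and u: "u \<in> module_hom R Z (free_power R k)" and v: "v \<in> module_hom R (free_power R k) Z"
    and id: "\<And>x. x \<in> carrier Z \<Longrightarrow> x = b (a x) \<oplus>\<^bsub>Z\<^esub> v (u x)"
    using SR unfolding stable_retract_def by blast
  obtain n p where pX: "presentation R n p X" using S unfolding ext1_zero_def by blast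
  have "\<exists>g \<in> module_hom R (free_power R n) Z. \<forall>x \<in> a_kernel (free_power R n) X p. g x = f x"
    if f: "f \<in> module_hom R (kernel_module R n p X) Z" for f
  proof -
    obtain g where g: "g \<in> module_hom R (free_power R n) W"
      "\<And>x. x \<in> a_kernel (free_power R n) X p \<Longrightarrow> g x = a (f x)"
      using ext1_zeroE[OF W pX mod(2) module_hom_comp[OF f ab(1)]] by blast
    obtain h where h: "h \<in> module_hom R (free_power R n) (free_power R k)"
      "\<And>x. x \<in> a_kernel (free_power R n) X p \<Longrightarrow> h x = u (f x)"
      using ext1_zeroE[OF ext1_zero_free_power[OF S] pX free_power_module module_hom_comp[OF f u]] by blast
    have "(\<lambda>x. b (g x) \<oplus>\<^bsub>Z\<^esub> v (h x)) \<in> module_hom R (free_power R n) Z"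
      by (intro module_hom_add_fun module_hom_comp[OF g(1) ab(2)] module_hom_comp[OF h(1) v] mod)
    moreover have "b (g x) \<oplus>\<^bsub>Z\<^esub> v (h x) = f x" if "x \<in> a_kernel (free_power R n) X p" for x
      using that id[of "f x", symmetric] module_hom_closed[OF f, of x] by (simp add: g h)
    ultimately show ?thesis by (intro bexI[of _ "\<lambda>x. b (g x) \<oplus>\<^bsub>Z\<^esub> v (h x)"]) simp_all
  qed
  with pX show ?thesis unfolding ext1_zero_def by blast
qed

text \<open>Dimension shift from a syzygy \<open>K\<close> back to \<open>X\<close>. A map
  \<open>f\<close> from \<open>K\<close> to \<open>X\<close> is lifted along \<open>q\<close> and
  \<open>p\<close> to a map \<open>g\<close> of free powers. On the kernel of \<open>q\<close> it
  takes values in \<open>K\<close>, so self-vanishing for \<open>K\<close> provides \<open>h\<close>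
  into \<open>K\<close> that agrees with \<open>g\<close> there. Then \<open>g - h\<close> descends
  to \<open>K\<close> and, by vanishing against \<open>R\<close>, extends to \<open>l'\<close> on
  the cover of \<open>X\<close>. As \<open>p\<close> kills the values of \<open>h\<close>,
  \<open>p\<close> after \<open>l'\<close> extends \<open>f\<close>.\<close>

lemma ext1_zero_of_kernel:
  assumes pX: "presentation R n p X" and qK: "presentation R m q (kernel_module R n p X)"
    and S: "ext1_zero R X (ring_module R)"
    and K: "ext1_zero R (kernel_module R n p X) (kernel_module R n p X)"
  shows "ext1_zero R X X"
proof -
  note p = presentationD[OF pX] and q = presentationD[OF qK]
  interpret X: module R X by (rule p(1))
  interpret P: module R "free_power R n" by (rule free_power_module)
  have pq: "q x \<in> a_kernel (free_power R n) X p" if "x \<in> carrier (free_power R m)" for x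
    using module_hom_closed[OF q(2) that] by simp
  have "\<exists>g \<in> module_hom R (free_power R n) X. \<forall>x \<in> a_kernel (free_power R n) X p. g x = f x"
    if f: "f \<in> module_hom R (kernel_module R n p X) X" for f
  proof -
    obtain g where g: "g \<in> module_hom R (free_power R m) (free_power R n)"
      "\<And>x. x \<in> carrier (free_power R m) \<Longrightarrow> p (g x) = f (q x)"
      by (rule free_power_lift[OF module_hom_comp[OF q(2) f] p(2) _ free_power_module p(1)])
        (use p(3) module_hom_closed[OF module_hom_comp[OF q(2) f]] in auto)
    have gL: "g \<in> module_hom R (kernel_module R m q (kernel_module R n p X)) (kernel_module R n p X)"
      unfolding kernel_module_def[of R m] kernel_module_def[of R n p X]
      using module_hom_closed[OF g(1)] module_hom_zero[OF f q(1) p(1)]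
      by (intro module_hom_restrict_codomain module_hom_restrict_domain g(1) a_kernel_subset)
        (auto simp: a_kernel_iff g(2))
    obtain h where h: "h \<in> module_hom R (free_power R m) (kernel_module R n p X)"
      "\<And>x. x \<in> a_kernel (free_power R m) (kernel_module R n p X) q \<Longrightarrow> h x = g x"
      using ext1_zeroE[OF K qK q(1) gL] by blast
    have h': "h \<in> module_hom R (free_power R m) (free_power R n)"
      using h(1) a_kernel_subset unfolding kernel_module_def by (rule module_hom_extend_codomain)
    have d: "(\<lambda>x. g x \<ominus>\<^bsub>free_power R n\<^esub> h x) \<in> module_hom R (free_power R m) (free_power R n)"
      by (intro module_hom_minus_fun g(1) h' free_power_module)
    obtain l where l: "l \<in> module_hom R (kernel_module R n p X) (free_power R n)"
      "\<And>x. x \<in> carrier (free_power R m) \<Longrightarrow> l (q x) = g x \<ominus>\<^bsub>free_power R n\<^esub> h x"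
      by (rule module_hom_factor[OF q(2,3) d free_power_module q(1) free_power_module])
        (auto simp: h(2) a_kernel_iff a_minus_def P.M.r_neg module_hom_closed[OF g(1)])
    obtain l' where l': "l' \<in> module_hom R (free_power R n) (free_power R n)"
      "\<And>x. x \<in> a_kernel (free_power R n) X p \<Longrightarrow> l' x = l x"
      using ext1_zeroE[OF ext1_zero_free_power[OF S] pX free_power_module l(1)] by blast
    have "p (l' y) = f y" if y: "y \<in> a_kernel (free_power R n) X p" for y
    proof -
      obtain x where x: "x \<in> carrier (free_power R m)" "y = q x" using y q(3) by auto
      have "p (h x) = \<zero>\<^bsub>X\<^esub>" using module_hom_closed[OF h(1) x(1)] by (simp add: a_kernel_iff)
      moreover have "f y \<in> carrier X" using module_hom_closed[OF f] y by simp
      ultimately show ?thesis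
        using x module_hom_closed[OF g(1)] module_hom_closed[OF h'] y
        by (simp add: l' l module_hom_minus[OF p(2) free_power_module p(1)] g(2)) (simp add: a_minus_def)
    qed
    then show ?thesis by (intro bexI[OF _ module_hom_comp[OF l'(1) p(2)]]) simp
  qed
  with pX show ?thesis unfolding ext1_zero_def by blast
qed

section \<open>Retracts of free modules\<close>

text \<open>With \<open>w\<close> a lift of \<open>v\<close> through \<open>p\<close>, the map
  \<open>w\<close> after \<open>u\<close> is a section of \<open>p\<close>, and
  \<open>r = 1 - w u p\<close> is the projection onto the kernel belonging to this section.\<close>

lemma free_retract_kernel:
  assumes F: "free_retract R X" and pX: "presentation R n p X"
  obtains r where "r \<in> module_hom R (free_power R n) (kernel_module R n p X)"
    "\<And>x. x \<in> a_kernel (free_power R n) X p \<Longrightarrow> r x = x"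
proof -
  note p = presentationD[OF pX]
  interpret X: module R X by (rule p(1))
  interpret P: module R "free_power R n" by (rule free_power_module)
  obtain k u v where u: "u \<in> module_hom R X (free_power R k)" and v: "v \<in> module_hom R (free_power R k) X"
    and id: "\<And>x. x \<in> carrier X \<Longrightarrow> v (u x) = x"
    using F unfolding free_retract_def by blast
  obtain w where w: "w \<in> module_hom R (free_power R k) (free_power R n)"
    "\<And>x. x \<in> carrier (free_power R k) \<Longrightarrow> p (w x) = v x"
    using free_power_lift[OF v p(2) _ free_power_module p(1)] module_hom_closed[OF v] p(3) by blast
  note cl = module_hom_closed[OF p(2)] module_hom_closed[OF w(1)] module_hom_closed[OF u]
  let ?r = "\<lambda>x. x \<ominus>\<^bsub>free_power R n\<^esub> w (u (p x))"
  have r: "?r \<in> module_hom R (free_power R n) (free_power R n)"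
    by (intro module_hom_minus_fun module_hom_id module_hom_comp[OF module_hom_comp[OF p(2) u] w(1)]
        free_power_module)
  have "p (?r x) = \<zero>\<^bsub>X\<^esub>" if "x \<in> carrier (free_power R n)" for x
    using that cl by (simp add: module_hom_minus[OF p(2) free_power_module p(1)] w id)
      (simp add: a_minus_def X.M.r_neg)
  then have "?r \<in> module_hom R (free_power R n) (kernel_module R n p X)"
    unfolding kernel_module_def using module_hom_closed[OF r]
    by (intro module_hom_restrict_codomain r) (auto simp: a_kernel_iff)
  moreover have "?r x = x" if "x \<in> a_kernel (free_power R n) X p" for x
    using that by (simp add: a_kernel_iff module_hom_zero[OF u p(1) free_power_module]
            module_hom_zero[OF w(1) free_power_module free_power_module] a_minus_def)
  ultimately show ?thesis by (rule that)
qed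

lemma free_retract_kernel_module:
  assumes "free_retract R X" "presentation R n p X"
  shows "free_retract R (kernel_module R n p X)"
proof -
  obtain r where r: "r \<in> module_hom R (free_power R n) (kernel_module R n p X)"
    "\<And>x. x \<in> a_kernel (free_power R n) X p \<Longrightarrow> r x = x"
    using free_retract_kernel[OF assms] by blast
  have i: "(\<lambda>x. x) \<in> module_hom R (kernel_module R n p X) (free_power R n)"
    unfolding kernel_module_def
    by (intro module_hom_restrict_domain module_hom_id a_kernel_subset)
  show ?thesis
    unfolding free_retract_def
    by (rule exI[of _ n], rule exI[of _ "\<lambda>x. x"], rule exI[of _ r]) (use r i in simp)
qed

text \<open>The retraction \<open>v\<close> itself serves as presentation; a map on its kernel
  extends by composition with the projection onto the kernel.\<close>

lemma free_retract_ext1_zero: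
  assumes F: "free_retract R X" and X: "module R X" and Z: "module R Z"
  shows "ext1_zero R X Z"
proof -
  obtain k u v where u: "u \<in> module_hom R X (free_power R k)" and v: "v \<in> module_hom R (free_power R k) X"
    and id: "\<And>x. x \<in> carrier X \<Longrightarrow> v (u x) = x"
    using F unfolding free_retract_def by blast
  have "v ` carrier (free_power R k) = carrier X"
    using module_hom_closed[OF v] module_hom_closed[OF u] id by (force simp: image_iff)
  then have P: "presentation R k v X" using v X by (simp add: presentation_def)
  obtain r where r: "r \<in> module_hom R (free_power R k) (kernel_module R k v X)"
    "\<And>x. x \<in> a_kernel (free_power R k) X v \<Longrightarrow> r x = x"
    using free_retract_kernel[OF F P] by blast
  have "\<exists>g \<in> module_hom R (free_power R k) Z. \<forall>x \<in> a_kernel (free_power R k) X v. g x = f x"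
    if f: "f \<in> module_hom R (kernel_module R k v X) Z" for f
    using r by (intro bexI[OF _ module_hom_comp[OF r(1) f]]) auto
  with P show ?thesis unfolding ext1_zero_def by blast
qed

text \<open>Since \<open>Y\<close> has vanishing Ext into every module, so has \<open>X\<close>.
  Extending the identity of the kernel of \<open>p\<close> yields \<open>r\<close>, and
  \<open>1 - r\<close> descends to a section of \<open>p\<close>.\<close>

lemma free_retract_if_stable_retract:
  assumes SR: "stable_retract R X Y" and Y: "free_retract R Y" "module R Y"
    and pX: "presentation R n p X"
  shows "free_retract R X"
proof -
  note p = presentationD[OF pX]
  interpret X: module R X by (rule p(1))
  interpret P: module R "free_power R n" by (rule free_power_module)
  note K = kernel_module_module[OF pX]
  obtain r where r: "r \<in> module_hom R (free_power R n) (kernel_module R n p X)"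
    "\<And>x. x \<in> a_kernel (free_power R n) X p \<Longrightarrow> r x = x"
    using ext1_zeroE_stable_retract[OF SR free_retract_ext1_zero[OF Y K] pX K module_hom_id] by blast
  have r': "r \<in> module_hom R (free_power R n) (free_power R n)"
    using r(1) a_kernel_subset unfolding kernel_module_def by (rule module_hom_extend_codomain)
  obtain s where s: "s \<in> module_hom R X (free_power R n)"
    "\<And>x. x \<in> carrier (free_power R n) \<Longrightarrow> s (p x) = x \<ominus>\<^bsub>free_power R n\<^esub> r x"
    by (rule module_hom_factor[OF p(2,3) module_hom_minus_fun[OF module_hom_id r' free_power_module]
          free_power_module p(1) free_power_module])
      (auto simp: r(2) a_kernel_iff a_minus_def P.M.r_neg)
  have "p (s y) = y" if y: "y \<in> carrier X" for y
  proof -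
    obtain x where x: "x \<in> carrier (free_power R n)" "y = p x" using y p(3) by auto
    moreover have "p (r x) = \<zero>\<^bsub>X\<^esub>" using module_hom_closed[OF r(1) x(1)] by (simp add: a_kernel_iff)
    ultimately show ?thesis
      using module_hom_closed[OF r'] y
      by (simp add: s(2) module_hom_minus[OF p(2) free_power_module p(1)]) (simp add: a_minus_def)
  qed
  then show ?thesis
    unfolding free_retract_def
    by (intro exI[of _ n] exI[of _ s] exI[of _ p]) (use s(1) p(2) in simp)
qed

section \<open>Syzygies in free resolutions\<close>

lemma free_resolution_presentation:
  assumes "free_resolution R X F" "module R X"
  shows "presentation R (rk F 0) (aug F) X"
    and "kernel_module R (rk F 0) (aug F) X = res_syzygy R F 0"
  using assms by (auto simp: free_resolution_def presentation_def kernel_module_def res_syzygy_def res_module_def)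

text \<open>\<open>res_syzygy R F k\<close> is the syzygy of order \<open>k + 1\<close>, so it is
  covered by the free module of index \<open>Suc k\<close>, and the kernel of this cover is the next
  syzygy.\<close>

lemma free_resolution_syzygy:
  assumes F: "free_resolution R X F" and X: "module R X"
  shows "presentation R (rk F (Suc k)) (diff F k) (res_syzygy R F k)"
    and "kernel_module R (rk F (Suc k)) (diff F k) (res_syzygy R F k) = res_syzygy R F (Suc k)"
proof -
  have d: "diff F i \<in> module_hom R (free_power R (rk F (Suc i))) (free_power R (rk F i))" for i
    using F by (simp add: free_resolution_def res_module_def)
  have "submodule (diff F k ` carrier (free_power R (rk F (Suc k)))) R (free_power R (rk F k))"
    by (intro submodule_image[OF d] free_power_module module.carrier_is_submodule)
  then have "module R (res_syzygy R F k)"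
    unfolding res_syzygy_def res_module_def by (intro submodule_module free_power_module)
  then show "presentation R (rk F (Suc k)) (diff F k) (res_syzygy R F k)"
    using d by (auto simp: presentation_def res_syzygy_def res_module_def intro!: module_hom_restrict_codomain)
  have "a_kernel (free_power R (rk F (Suc k))) (res_syzygy R F k) (diff F k)
      = a_kernel (free_power R (rk F (Suc k))) (free_power R (rk F k)) (diff F k)"
    by (auto simp: a_kernel_iff res_syzygy_def res_module_def)
  then show "kernel_module R (rk F (Suc k)) (diff F k) (res_syzygy R F k) = res_syzygy R F (Suc k)"
    using F by (simp add: free_resolution_def kernel_module_def res_syzygy_def res_module_def)
qed

section \<open>From the vanishing of Ext modules to the extension of maps\<close>

lemma restrict_module_hom:
  "f \<in> module_hom R X Y \<Longrightarrow> module R X \<Longrightarrow> restrict f (carrier X) \<in> module_hom R X Y"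
  by (erule module_hom_cong) auto

text \<open>The coset of a cocycle is an element of the Ext module, hence equals the coset of zero,
  namely the coboundaries. The cocycle lies in its own coset because the zero map is a
  coboundary.\<close>

lemma Ext_module_zeroD:
  assumes Ext: "zero_module (Ext_module R (Suc k) X Y)" and F: "F = (SOME F. free_resolution R X F)"
    and res: "free_resolution R X F" and Y: "module R Y" and f: "f \<in> ext_cocycles R F (Suc k) Y"
  shows "f \<in> ext_coboundaries R F (Suc k) Y"
proof -
  interpret Y: module R Y by (rule Y)
  let ?N = "ext_coboundaries R F (Suc k) Y" and ?P = "\<lambda>i. res_module R F i"
  have P: "module R (?P i)" for i by (simp add: res_module_def free_power_module)
  have d: "diff F k \<in> module_hom R (?P (Suc k)) (?P k)"
    using res by (simp add: free_resolution_def)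
  have f': "f \<in> module_hom R (?P (Suc k)) Y" "f \<in> extensional (carrier (?P (Suc k)))"
    using f by (auto simp: ext_cocycles_def hom_module_def)
  let ?o = "\<lambda>i. (\<lambda>x \<in> carrier (?P i). \<zero>\<^bsub>Y\<^esub>)"
  have "?o k \<in> carrier (hom_module R (?P k) Y)"
    using restrict_module_hom[OF module_hom_const_zero[OF Y] P] by (simp add: hom_module_def)
  moreover have "compose (carrier (?P (Suc k))) (?o k) (diff F k) = ?o (Suc k)"
    using module_hom_closed[OF d] by (auto simp: compose_def fun_eq_iff)
  ultimately have o: "?o (Suc k) \<in> ?N"
    by (auto simp: ext_coboundaries_def intro!: image_eqI)
  let ?H = "(hom_module R (?P (Suc k)) Y)\<lparr>carrier := ext_cocycles R F (Suc k) Y\<rparr>"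
  have "?N +>\<^bsub>?H\<^esub> f \<in> a_rcosets\<^bsub>?H\<^esub> ?N"
    using f by (auto simp: A_RCOSETS_def')
  then have "?N +>\<^bsub>?H\<^esub> f = ?N"
    using Ext unfolding Ext_module_def Let_def F[symmetric] quotient_module_def zero_module_def by simp
  moreover have "f = ?o (Suc k) \<oplus>\<^bsub>?H\<^esub> f"
    using f' module_hom_closed[OF f'(1)] by (auto simp: hom_module_def fun_eq_iff extensional_def)
  then have "f \<in> ?N +>\<^bsub>?H\<^esub> f" using o by (auto simp: a_r_coset_def')
  ultimately show ?thesis by simp
qed

text \<open>\<open>Z\<close> is the module covered by the \<open>k\<close>-th term of the
  resolution: \<open>X\<close> itself for \<open>k = 0\<close> and a syzygy otherwise. A map
  \<open>f\<close> on the kernel, composed with the differential onto it, is a cocycle; writing this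
  cocycle as a coboundary of \<open>g\<close> says that \<open>g\<close> extends
  \<open>f\<close>.\<close>

lemma ext1_zero_of_Ext_module:
  assumes Ext: "zero_module (Ext_module R (Suc k) X Y)" and F: "F = (SOME F. free_resolution R X F)"
    and res: "free_resolution R X F" and Y: "module R Y"
    and pZ: "presentation R (rk F k) p Z" and K: "kernel_module R (rk F k) p Z = res_syzygy R F k"
  shows "ext1_zero R Z Y"
proof -
  let ?P = "\<lambda>i. res_module R F i"
  have P: "module R (?P i)" for i by (simp add: res_module_def free_power_module)
  have d: "diff F i \<in> module_hom R (?P (Suc i)) (?P i)" for i
    using res by (simp add: free_resolution_def)
  have d': "diff F k \<in> module_hom R (?P (Suc k)) (kernel_module R (rk F k) p Z)"
    unfolding K res_syzygy_def by (intro module_hom_restrict_codomain d) auto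
  have K': "a_kernel (free_power R (rk F k)) Z p = diff F k ` carrier (?P (Suc k))"
    using arg_cong[OF K, of carrier] by (simp add: res_syzygy_def)
  have "\<exists>g \<in> module_hom R (free_power R (rk F k)) Y. \<forall>x \<in> a_kernel (free_power R (rk F k)) Z p. g x = f x"
    if f: "f \<in> module_hom R (kernel_module R (rk F k) p Z) Y" for f
  proof -
    have fd: "(\<lambda>x. f (diff F k x)) \<in> module_hom R (?P (Suc k)) Y" by (rule module_hom_comp[OF d' f])
    let ?c = "\<lambda>x \<in> carrier (?P (Suc k)). f (diff F k x)"
    have dd: "diff F k (diff F (Suc k) x) = \<zero>\<^bsub>?P k\<^esub>" if "x \<in> carrier (?P (Suc (Suc k)))" for x
    proof -
      have "diff F (Suc k) x \<in> a_kernel (?P (Suc k)) (?P k) (diff F k)"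
        using that res by (simp add: free_resolution_def)
      then show ?thesis by (simp add: a_kernel_iff)
    qed
    have "f \<zero>\<^bsub>?P k\<^esub> = \<zero>\<^bsub>Y\<^esub>"
      using module_hom_zero[OF f kernel_module_module[OF pZ] Y] by (simp add: res_module_def)
    then have "?c \<in> ext_cocycles R F (Suc k) Y"
      using restrict_module_hom[OF fd P] dd module_hom_closed[OF d]
      by (auto simp: ext_cocycles_def hom_module_def compose_def restrict_def extensional_def)
    from Ext_module_zeroD[OF Ext F res Y this] obtain g where g: "g \<in> module_hom R (?P k) Y"
      "?c = compose (carrier (?P (Suc k))) g (diff F k)"
      by (auto simp: ext_coboundaries_def hom_module_def)
    have "g (diff F k x) = f (diff F k x)" if "x \<in> carrier (?P (Suc k))" for x
      using that fun_cong[OF g(2), of x] by (simp add: compose_def)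
    then show ?thesis using g(1) K' by (auto simp: res_module_def)
  qed
  with pZ show ?thesis unfolding ext1_zero_def by blast
qed

lemma ext1_zero_of_Ext_module_1:
  assumes "zero_module (Ext_module R 1 X Y)" "free_resolution R X F" "module R X" "module R Y"
  shows "ext1_zero R X Y"
proof -
  define G where "G = (SOME F. free_resolution R X F)"
  have G: "free_resolution R X G" unfolding G_def using assms(2) by (rule someI)
  show ?thesis
    using free_resolution_presentation[OF G assms(3)] assms(1,4)
    by (intro ext1_zero_of_Ext_module[OF _ G_def G]) simp_all
qed

text \<open>The hypothesis concerns the resolution \<open>G\<close> picked by choice, the conclusion
  a given one. By induction along both resolutions the syzygies of \<open>F\<close> are stable
  retracts of those of \<open>G\<close>, and the extension property is inherited.\<close>

lemma ext1_zero_syzygy_of_Ext_module: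
  assumes Ext: "zero_module (Ext_module R (Suc (Suc k)) X Y)" and F: "free_resolution R X F"
    and X: "module R X" and Y: "module R Y"
  shows "ext1_zero R (res_syzygy R F k) Y"
proof -
  define G where "G = (SOME F. free_resolution R X F)"
  have G: "free_resolution R X G" unfolding G_def using F by (rule someI)
  have "stable_retract R (res_syzygy R F i) (res_syzygy R G i)" for i
  proof (induction i)
    case 0
    show ?case
      using stable_retract_kernel[OF stable_retract_refl[OF X]
          free_resolution_presentation(1)[OF F X] free_resolution_presentation(1)[OF G X]]
      by (simp add: free_resolution_presentation(2)[OF F X] free_resolution_presentation(2)[OF G X])
  next
    case (Suc i)
    show ?case
      using stable_retract_kernel[OF Suc free_resolution_syzygy(1)[OF F X] free_resolution_syzygy(1)[OF G X]]
      by (simp add: free_resolution_syzygy(2)[OF F X] free_resolution_syzygy(2)[OF G X])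
  qed
  moreover have "ext1_zero R (res_syzygy R G k) Y"
    by (rule ext1_zero_of_Ext_module[OF Ext G_def G Y free_resolution_syzygy[OF G X]])
  ultimately show ?thesis
    using free_resolution_syzygy(1)[OF F X] Y by (rule ext1_zero_stable_retract_left)
qed

end

section \<open>Modules over Noetherian rings\<close>

lemma submodule_of_submodule:
  assumes "submodule N R (X\<lparr>carrier := H\<rparr>)" "H \<subseteq> carrier X" "module R X"
  shows "submodule N R X"
  using submodule_subset[OF assms(1)] submodule_zero[OF assms(1)] submodule_add[OF assms(1)]
    submodule_smult[OF assms(1)] assms(2)
  by (intro submoduleI' assms(3)) auto

lemma hom_module_simps [simp]:
  "carrier (hom_module R X Y) = module_hom R X Y \<inter> extensional (carrier X)"
  "zero (hom_module R X Y) = (\<lambda>x \<in> carrier X. \<zero>\<^bsub>Y\<^esub>)"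
  "f \<oplus>\<^bsub>hom_module R X Y\<^esub> g = (\<lambda>x \<in> carrier X. f x \<oplus>\<^bsub>Y\<^esub> g x)"
  "a \<odot>\<^bsub>hom_module R X Y\<^esub> f = (\<lambda>x \<in> carrier X. a \<odot>\<^bsub>Y\<^esub> f x)"
  by (simp_all add: hom_module_def)

lemma hom_module_module:
  assumes X: "module R X" and Y: "module R Y"
  shows "module R (hom_module R X Y)"
proof -
  interpret X: module R X by (rule X)
  interpret Y: module R Y by (rule Y)
  note rh = X.restrict_module_hom[OF _ X]
  note cl = module_hom_closed[where R = R and X = X and Y = Y]
  show ?thesis
  proof (rule moduleI)
    show "cring R" by (rule X.is_cring)
    show "abelian_group (hom_module R X Y)"
    proof (rule abelian_groupI)
      fix f g assume f: "f \<in> carrier (hom_module R X Y)" and g: "g \<in> carrier (hom_module R X Y)"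
      then show "f \<oplus>\<^bsub>hom_module R X Y\<^esub> g \<in> carrier (hom_module R X Y)"
        by (auto intro!: rh module_hom_add_fun Y)
      show "f \<oplus>\<^bsub>hom_module R X Y\<^esub> g = g \<oplus>\<^bsub>hom_module R X Y\<^esub> f"
        using f g by (auto simp: restrict_def cl intro!: ext Y.M.a_comm)
      fix h assume h: "h \<in> carrier (hom_module R X Y)"
      show "f \<oplus>\<^bsub>hom_module R X Y\<^esub> g \<oplus>\<^bsub>hom_module R X Y\<^esub> h =
          f \<oplus>\<^bsub>hom_module R X Y\<^esub> (g \<oplus>\<^bsub>hom_module R X Y\<^esub> h)"
        using f g h by (auto simp: restrict_def cl intro!: ext Y.M.a_assoc)
    next
      show "\<zero>\<^bsub>hom_module R X Y\<^esub> \<in> carrier (hom_module R X Y)"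
        by (auto intro!: rh module_hom_const_zero Y)
    next
      fix f assume f: "f \<in> carrier (hom_module R X Y)"
      then show "\<zero>\<^bsub>hom_module R X Y\<^esub> \<oplus>\<^bsub>hom_module R X Y\<^esub> f = f"
        by (auto simp: restrict_def cl extensional_def intro!: ext)
      show "\<exists>g \<in> carrier (hom_module R X Y). g \<oplus>\<^bsub>hom_module R X Y\<^esub> f = \<zero>\<^bsub>hom_module R X Y\<^esub>"
        using f
        by (intro bexI[of _ "restrict (\<lambda>x. \<ominus>\<^bsub>R\<^esub> \<one>\<^bsub>R\<^esub> \<odot>\<^bsub>Y\<^esub> f x) (carrier X)"])
          (auto simp: restrict_def cl Y.smult_l_minus Y.M.l_neg fun_eq_iff extensional_def
            intro!: rh[unfolded restrict_def] module_hom_smult_fun Y)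
    qed
  next
    fix a f assume a: "a \<in> carrier R" and f: "f \<in> carrier (hom_module R X Y)"
    then show "a \<odot>\<^bsub>hom_module R X Y\<^esub> f \<in> carrier (hom_module R X Y)"
      by (auto intro!: rh module_hom_smult_fun Y)
  qed (auto simp: restrict_def cl extensional_def Y.smult_l_distr Y.smult_r_distr Y.smult_assoc1 intro!: ext)
qed

text \<open>The commutative ring structure on \<open>R\<close> is extracted from
  \<open>module R X\<close>, so the dual can be iterated without further assumptions.\<close>

lemma dual_module_module: "module R X \<Longrightarrow> module R (dual_module R X)"
  unfolding dual_module_def by (intro hom_module_module cring.ring_module_module module.axioms(1))

context cring
begin

lemma presentation_if_fin_gen:
  assumes X: "module R X" and fg: "fin_gen_module R X"
  obtains n p where "presentation R n p X"
proof -
  interpret X: module R X by (rule X)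
  obtain A where A: "finite A" "A \<subseteq> carrier X" "module_span R X A = carrier X"
    using fg by (auto simp: fin_gen_module_def)
  obtain y where y: "bij_betw y {0..<card A} A" using ex_bij_betw_nat_finite[OF A(1)] by blast
  let ?n = "card A" and ?p = "\<lambda>x. lincomb X x y (card A)"
  have yX: "y i \<in> carrier X" if "i < ?n" for i
    using y A(2) that by (auto simp: bij_betw_def)
  have p: "?p \<in> module_hom R (free_power R ?n) X" by (intro hom_from_free_power X yX)
  let ?N = "?p ` carrier (free_power R ?n)"
  have N: "submodule ?N R X"
    by (intro submodule_image[OF p] free_power_module X module.carrier_is_submodule)
  have "A \<subseteq> ?N"
  proof
    fix a assume "a \<in> A"
    then obtain i where i: "i < ?n" "a = y i" using y by (force simp: bij_betw_def)
    then have "a = ?p (unit_vec ?n i)" using lincomb_unit_vec[OF X yX i(1)] by simp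
    then show "a \<in> ?N" by simp
  qed
  then have "carrier X \<subseteq> ?N" using A(3) N by (auto simp: module_span_def)
  then have "presentation R ?n ?p X" using p X submodule_subset[OF N] by (auto simp: presentation_def)
  then show ?thesis by (rule that)
qed

lemma presentation_generators:
  assumes "presentation R n p X" "submodule N R X" "\<And>i. i < n \<Longrightarrow> p (unit_vec n i) \<in> N"
  shows "N = carrier X"
proof -
  note p = presentationD[OF assms(1)]
  have "p x \<in> N" if "x \<in> carrier (free_power R n)" for x
    using that assms(3) unfolding hom_free_power_eq[OF p(2,1) that]
    by (intro lincomb_in_submodule[OF assms(2)]) (auto simp: free_power_simps)
  then have "p ` carrier (free_power R n) \<subseteq> N" by blast
  then show ?thesis using p(3) submodule_subset[OF assms(2)] by simp
qed

end

section \<open>Maximal condition, finite generation and existence of resolutions\<close>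

text \<open>A nonempty chain of ideals contains its union, so the family satisfies the condition of
  Zorn's lemma.\<close>

lemma (in noetherian_ring) maximal_ideal_in_set:
  assumes "S \<noteq> {}" "\<And>I. I \<in> S \<Longrightarrow> ideal I R"
  obtains M where "M \<in> S" "\<And>I. I \<in> S \<Longrightarrow> M \<subseteq> I \<Longrightarrow> I = M"
proof -
  have "\<exists>M \<in> S. \<forall>I \<in> S. M \<subseteq> I \<longrightarrow> I = M"
  proof (rule subset_Zorn_nonempty)
    fix C assume C: "C \<noteq> {}" "subset.chain S C"
    then have "subset.chain {I. ideal I R} C"
      using assms(2) by (auto simp: subset.chain_def)
    from ideal_chain_is_trivial[OF C(1) this] show "\<Union>C \<in> S"
      using C(2) by (auto simp: subset.chain_def)
  qed (rule assms(1))
  then show ?thesis using that by blast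
qed

locale noetherian_cring = cring + noetherian_ring
begin

text \<open>\<open>N\<close> is filtered by the submodules \<open>K k\<close> of vectors that vanish
  from coordinate \<open>k\<close> on. The \<open>k\<close>-th coordinates of
  \<open>K (Suc k)\<close> form an ideal; vectors \<open>C\<close> lifting finitely many generators
  of this ideal, together with generators \<open>A\<close> of \<open>K k\<close>, generate
  \<open>K (Suc k)\<close>. Generation is phrased as containment in every submodule of the free
  power that contains the set.\<close>

lemma free_power_noetherian:
  assumes N: "submodule N R (free_power R n)"
  shows "fin_gen_module R ((free_power R n)\<lparr>carrier := N\<rparr>)"
proof -
  let ?F = "free_power R n"
  interpret F: module R ?F by (rule free_power_module)
  note Nsub = submodule_subset[OF N]
  define K where "K k = {x \<in> N. \<forall>i. k \<le> i \<and> i < n \<longrightarrow> x i = \<zero>}" for k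
  have K: "submodule (K k) R ?F" for k
    using submodule_zero[OF N] submodule_add[OF N] submodule_smult[OF N] Nsub
    by (intro submoduleI' free_power_module) (auto simp: K_def free_power_simps)
  have "\<exists>A. finite A \<and> A \<subseteq> K k \<and> (\<forall>N'. submodule N' R ?F \<longrightarrow> A \<subseteq> N' \<longrightarrow> K k \<subseteq> N')" if "k \<le> n" for k
    using that
  proof (induction k)
    case 0
    have "K 0 \<subseteq> {\<zero>\<^bsub>?F\<^esub>}"
      using Nsub by (auto simp: K_def free_power_simps PiE_iff extensional_def fun_eq_iff)
    then show ?case using submodule_zero by (intro exI[of _ "{}"]) blast
  next
    case (Suc k)
    then obtain A where A: "finite A" "A \<subseteq> K k"
      "\<And>N'. submodule N' R ?F \<Longrightarrow> A \<subseteq> N' \<Longrightarrow> K k \<subseteq> N'"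
      by auto
    have k: "k < n" using Suc.prems by simp
    have img: "ideal ((\<lambda>x. x k) ` N') R" if "submodule N' R ?F" for N'
      using submodule_image[OF coordinate_hom[OF k] free_power_module ring_module_module that]
      by (simp add: submodule_ring_module_iff)
    obtain B where B: "B \<subseteq> carrier R" "finite B" "(\<lambda>x. x k) ` K (Suc k) = Idl B"
      using finetely_gen[OF img[OF K[of "Suc k"]]] by blast
    have "B \<subseteq> (\<lambda>x. x k) ` K (Suc k)" using B(3) genideal_self[OF B(1)] by simp
    from finite_subset_image[OF B(2) this]
    obtain C where C: "finite C" "C \<subseteq> K (Suc k)" "B = (\<lambda>x. x k) ` C" by auto
    have "K (Suc k) \<subseteq> N'" if N': "submodule N' R ?F" and sub: "A \<union> C \<subseteq> N'" for N'
    proof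
      fix x assume x: "x \<in> K (Suc k)"
      \<comment> \<open>The intersection guarantees that the vector \<open>x'\<close> sharing its
        \<open>k\<close>-th coordinate with \<open>x\<close> lies in \<open>N'\<close> and also
        vanishes beyond \<open>k\<close>; then \<open>x - x'\<close> falls into
        \<open>K k\<close>.\<close>
      have NK: "submodule (N' \<inter> K (Suc k)) R ?F"
        using submodule_subset[OF N'] submodule_zero[OF N'] submodule_zero[OF K] submodule_add[OF N']
          submodule_add[OF K] submodule_smult[OF N'] submodule_smult[OF K]
        by (intro submoduleI' free_power_module) auto
      have "Idl B \<subseteq> (\<lambda>x. x k) ` (N' \<inter> K (Suc k))"
        using C(2,3) sub by (intro genideal_minimal img NK) blast
      moreover have "x k \<in> Idl B" unfolding B(3)[symmetric] using x by simp
      ultimately obtain x' where x': "x' \<in> N'" "x' \<in> K (Suc k)" "x' k = x k" by auto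
      have xx: "x \<in> carrier ?F" "x' \<in> carrier ?F"
        using x x' submodule_subset[OF K] by blast+
      let ?d = "x \<ominus>\<^bsub>?F\<^esub> x'"
      have d: "?d \<in> K (Suc k)" by (rule submodule_minus[OF free_power_module K x x'(2)])
      interpret RM: module R "ring_module R" by (rule ring_module_module)
      have "x k \<in> carrier R" using xx k by (auto simp: free_power_simps)
      then have "x k \<ominus>\<^bsub>ring_module R\<^esub> x k = \<zero>" using RM.M.r_neg[of "x k"] by (simp add: a_minus_def)
      then have "?d k = \<zero>"
        using module_hom_minus[OF coordinate_hom[OF k] free_power_module ring_module_module xx] x'(3)
        by simp
      with d have "?d \<in> K k" by (auto simp: K_def le_less intro: Suc_lessI)
      then have "?d \<in> N'" using A(3)[OF N'] sub by auto
      then have "?d \<oplus>\<^bsub>?F\<^esub> x' \<in> N'" using x' by (intro submodule_add[OF N'])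
      then show "x \<in> N'" using xx by (simp add: a_minus_def F.M.a_assoc F.M.l_neg)
    qed
    moreover have "K k \<subseteq> K (Suc k)" by (auto simp: K_def)
    with A(2) C(2) have "A \<union> C \<subseteq> K (Suc k)" by blast
    moreover have "finite (A \<union> C)" using A(1) C(1) by simp
    ultimately show ?case by (intro exI[of _ "A \<union> C"] conjI allI impI)
  qed
  from this[OF order.refl] obtain A where A: "finite A" "A \<subseteq> K n"
    "\<And>N'. submodule N' R ?F \<Longrightarrow> A \<subseteq> N' \<Longrightarrow> K n \<subseteq> N'"
    by blast
  have Kn: "K n = N" by (auto simp: K_def)
  have "module_span R (?F\<lparr>carrier := N\<rparr>) A = N"
  proof
    have "submodule N R (?F\<lparr>carrier := N\<rparr>)"
      using module.carrier_is_submodule[OF submodule_module[OF N free_power_module]] by simp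
    then show "module_span R (?F\<lparr>carrier := N\<rparr>) A \<subseteq> N" using A(2) Kn by (auto simp: module_span_def)
    show "N \<subseteq> module_span R (?F\<lparr>carrier := N\<rparr>) A"
      using A(3) submodule_of_submodule[OF _ Nsub free_power_module] Kn
      unfolding module_span_def by (intro Inter_greatest) auto
  qed
  then show ?thesis using A Kn by (auto simp: fin_gen_module_def)
qed

lemma submodule_free_power_presentation:
  assumes "submodule N R (free_power R n)"
  obtains m q where "presentation R m q ((free_power R n)\<lparr>carrier := N\<rparr>)"
  using presentation_if_fin_gen[OF submodule_module[OF assms free_power_module] free_power_noetherian[OF assms]]
  by blast

lemma presentation_if_embedded:
  assumes X: "module R X" and j: "j \<in> module_hom R X (free_power R n)" "inj_on j (carrier X)"
  obtains m q where "presentation R m q X"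
proof -
  let ?N = "j ` carrier X"
  have N: "submodule ?N R (free_power R n)"
    by (intro submodule_image[OF j(1)] X free_power_module module.carrier_is_submodule)
  obtain m q where q: "presentation R m q ((free_power R n)\<lparr>carrier := ?N\<rparr>)"
    using submodule_free_power_presentation[OF N] .
  have "j \<in> module_hom R X ((free_power R n)\<lparr>carrier := ?N\<rparr>)"
    by (intro module_hom_restrict_codomain j) auto
  moreover have b: "bij_betw j (carrier X) (carrier ((free_power R n)\<lparr>carrier := ?N\<rparr>))"
    using j(2) by (simp add: bij_betw_def)
  ultimately have i: "inv_into (carrier X) j \<in> module_hom R ((free_power R n)\<lparr>carrier := ?N\<rparr>) X"
    by (rule module_hom_inv[OF _ _ X])
  have "presentation R m (\<lambda>x. inv_into (carrier X) j (q x)) X"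
    using module_hom_comp[OF presentationD(2)[OF q] i] presentationD(3)[OF q]
      bij_betw_inv_into[OF b] X
    by (simp add: presentation_def bij_betw_def image_image[symmetric] del: image_image)
  then show ?thesis by (rule that)
qed

lemma ideal_presentation:
  assumes I: "ideal I R"
  obtains n p where "presentation R n p (ideal_module R I)"
proof -
  obtain A where A: "A \<subseteq> carrier R" "finite A" "I = Idl A" using finetely_gen[OF I] by blast
  have AI: "A \<subseteq> I" using A genideal_self by blast
  have "I \<subseteq> module_span R (ideal_module R I) A"
  proof (unfold module_span_def, rule Inter_greatest)
    fix N assume "N \<in> {N. submodule N R (ideal_module R I) \<and> A \<subseteq> N}"
    then have N: "submodule N R ((ring_module R)\<lparr>carrier := I\<rparr>)" "A \<subseteq> N"
      using ideal_module_eq[of I] by auto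
    have "ideal N R"
      using submodule_of_submodule[OF N(1) _ ring_module_module] additive_subgroup.a_subset[OF ideal.axioms(1)[OF I]]
      by (simp add: submodule_ring_module_iff)
    then show "I \<subseteq> N" unfolding A(3) using N(2) by (rule genideal_minimal)
  qed
  moreover have "module_span R (ideal_module R I) A \<subseteq> I"
    using module.carrier_is_submodule[OF ideal_module_module[OF I]] AI by (auto simp: module_span_def)
  ultimately have "fin_gen_module R (ideal_module R I)"
    using A AI by (auto simp: fin_gen_module_def)
  then show ?thesis using presentation_if_fin_gen[OF ideal_module_module[OF I]] that by blast
qed

text \<open>A functional is determined by its values on the finitely many generators, which embeds
  the dual into a free power; submodules of free powers are finitely generated.\<close>

lemma dual_presentation:
  assumes pX: "presentation R n p X"
  obtains m q where "presentation R m q (dual_module R X)"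
proof -
  note p = presentationD[OF pX]
  let ?j = "\<lambda>f. \<lambda>i \<in> {..<n}. f (p (unit_vec n i))"
  have cl: "p (unit_vec n i) \<in> carrier X" for i by (intro module_hom_closed[OF p(2)] unit_vec_closed)
  have j: "?j \<in> module_hom R (dual_module R X) (free_power R n)"
    using cl by (intro module_homI)
      (auto simp: dual_module_def free_power_simps fun_eq_iff
        module_hom_closed[where X = X and Y = "ring_module R", simplified])
  have "inj_on ?j (carrier (dual_module R X))"
  proof (rule inj_onI)
    fix f g assume "f \<in> carrier (dual_module R X)" "g \<in> carrier (dual_module R X)" and eq: "?j f = ?j g"
    then have fg: "f \<in> module_hom R X (ring_module R)" "g \<in> module_hom R X (ring_module R)"
      "f \<in> extensional (carrier X)" "g \<in> extensional (carrier X)"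
      by (auto simp: dual_module_def)
    have e: "f (p (unit_vec n i)) = g (p (unit_vec n i))" if "i < n" for i
      using fun_cong[OF eq, of i] that by simp
    have "f (p x) = g (p x)" if "x \<in> carrier (free_power R n)" for x
      using hom_free_power_eq[OF module_hom_comp[OF p(2) fg(1)] ring_module_module that]
        hom_free_power_eq[OF module_hom_comp[OF p(2) fg(2)] ring_module_module that] e
        lincomb_cong[of n x x "\<lambda>i. f (p (unit_vec n i))" "\<lambda>i. g (p (unit_vec n i))"]
      by metis
    then have "f y = g y" if "y \<in> carrier X" for y using that unfolding p(3)[symmetric] by blast
    then show "f = g" by (rule extensionalityI[OF fg(3,4)])
  qed
  then show ?thesis using presentation_if_embedded[OF dual_module_module[OF p(1)] j] that by blast
qed

lemma free_resolution_exists: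
  assumes pX: "presentation R n p X"
  obtains F where "free_resolution R X F"
proof -
  let ?H = "\<lambda>m n. module_hom R (free_power R m) (free_power R n)"
  have step: "\<exists>m d. d \<in> ?H m n \<and> d ` carrier (free_power R m) = N"
    if N: "submodule N R (free_power R n)" for N n
  proof -
    obtain m q where "presentation R m q ((free_power R n)\<lparr>carrier := N\<rparr>)"
      by (rule submodule_free_power_presentation[OF N])
    from presentationD[OF this] show ?thesis
      using module_hom_extend_codomain submodule_subset[OF N]
      by (intro exI[of _ m] exI[of _ q]) auto
  qed
  note p = presentationD[OF pX]
  \<comment> \<open>A state \<open>(n', m, d)\<close> of the recursion consists of a differential
    \<open>d\<close> together with the ranks of its target and source. \<open>Q\<close> forces
    consecutive ranks to match and states exactness; the clause for \<open>k = 0\<close> anchors the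
    sequence at the kernel of \<open>p\<close>.\<close>
  define P where "P k s \<longleftrightarrow> snd (snd s) \<in> ?H (fst (snd s)) (fst s) \<and> (k = 0 \<longrightarrow> fst s = n \<and>
    snd (snd s) ` carrier (free_power R (fst (snd s))) = a_kernel (free_power R n) X p)"
    for k :: nat and s
  define Q where "Q k s s' \<longleftrightarrow> fst s' = fst (snd s) \<and>
    snd (snd s') ` carrier (free_power R (fst (snd s'))) =
    a_kernel (free_power R (fst (snd s))) (free_power R (fst s)) (snd (snd s))"
    for k :: nat and s s'
  have "\<exists>f. \<forall>k. P k (f k) \<and> Q k (f k) (f (Suc k))"
  proof (rule dependent_nat_choice)
    show "\<exists>s. P 0 s"
      using step[OF submodule_kernel[OF p(2) free_power_module p(1)]] by (auto simp: P_def)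
    fix s k assume "P k s"
    then obtain n' m d where s: "s = (n', m, d)" "d \<in> ?H m n'"
      by (cases s) (simp add: P_def)
    obtain l d' where "d' \<in> ?H l m" "d' ` carrier (free_power R l) = a_kernel (free_power R m) (free_power R n') d"
      using step[OF submodule_kernel[OF s(2) free_power_module free_power_module]] by blast
    then show "\<exists>s'. P (Suc k) s' \<and> Q k s s'"
      using s by (intro exI[of _ "(m, l, d')"]) (auto simp: P_def Q_def)
  qed
  then obtain f where f: "\<And>k. P k (f k)" "\<And>k. Q k (f k) (f (Suc k))" by blast
  define F where "F = \<lparr>rk = \<lambda>k. fst (f k), aug = p, diff = \<lambda>k. snd (snd (f k))\<rparr>"
  have sel: "rk F k = fst (f k)" "diff F k = snd (snd (f k))" "aug F = p" for k
    by (simp_all add: F_def)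
  have rkS: "fst (snd (f k)) = fst (f (Suc k))" for k
    using f(2)[of k] by (simp add: Q_def)
  have d: "diff F k \<in> ?H (rk F (Suc k)) (rk F k)" for k
    using f(1)[of k] rkS[of k] by (simp add: P_def sel)
  have d0: "rk F 0 = n" "diff F 0 ` carrier (free_power R (rk F (Suc 0))) = a_kernel (free_power R n) X p"
    using f(1)[of 0] rkS[of 0] by (simp_all add: P_def sel)
  have dS: "diff F (Suc k) ` carrier (free_power R (rk F (Suc (Suc k)))) =
      a_kernel (free_power R (rk F (Suc k))) (free_power R (rk F k)) (diff F k)" for k
    using f(2)[of k] rkS[of k] rkS[of "Suc k"] by (simp add: Q_def sel)
  have "free_resolution R X F"
    using p d d0 dS by (simp add: free_resolution_def res_module_def sel(3))
  then show ?thesis by (rule that)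
qed

end

section \<open>The socle of a Noetherian local ring of depth zero\<close>

sublocale noetherian_local_ring \<subseteq> noetherian_cring ..

definition (in cring) annihilator :: "'a \<Rightarrow> 'a set" where
  "annihilator z = {x \<in> carrier R. x \<otimes> z = \<zero>}"

lemma (in cring) ideal_annihilator:
  assumes "z \<in> carrier R"
  shows "ideal (annihilator z) R"
proof -
  have "submodule (annihilator z) R (ring_module R)"
    by (rule submoduleI'[OF ring_module_module])
      (use assms in \<open>auto simp: annihilator_def l_distr m_assoc\<close>)
  then show ?thesis by (simp add: submodule_ring_module_iff)
qed

context noetherian_local_ring
begin

abbreviation maxid ("\<mm>") where "\<mm> \<equiv> max_ideal R"

lemma maximalideal_max_ideal: "maximalideal \<mm> R"
  unfolding max_ideal_def by (rule theI'[OF unique_maximal])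

lemma ideal_max_ideal: "ideal \<mm> R"
  using maximalideal_max_ideal by (rule maximalideal.axioms(1))

lemma max_ideal_closed: "x \<in> \<mm> \<Longrightarrow> x \<in> carrier R"
  using ideal.Icarr[OF ideal_max_ideal] .

lemma one_notin_max_ideal: "\<one> \<notin> \<mm>"
  using maximalideal.I_notcarr[OF maximalideal_max_ideal] ideal.one_imp_carrier[OF ideal_max_ideal]
  by auto

lemma proper_ideal_subset_max_ideal:
  assumes I: "ideal I R" "I \<noteq> carrier R"
  shows "I \<subseteq> \<mm>"
proof -
  obtain M where M: "M \<in> {J. ideal J R \<and> I \<subseteq> J \<and> J \<noteq> carrier R}"
    "\<And>J. J \<in> {J. ideal J R \<and> I \<subseteq> J \<and> J \<noteq> carrier R} \<Longrightarrow> M \<subseteq> J \<Longrightarrow> J = M"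
    by (rule maximal_ideal_in_set[of "{J. ideal J R \<and> I \<subseteq> J \<and> J \<noteq> carrier R}"]) (use I in auto)
  have "maximalideal M R"
  proof (rule maximalidealI)
    show "ideal M R" "carrier R \<noteq> M" using M(1) by auto
    show "J = M \<or> J = carrier R" if "ideal J R" "M \<subseteq> J" "J \<subseteq> carrier R" for J
      using M(1) M(2)[of J] that by auto
  qed
  then have "M = \<mm>" using unique_maximal maximalideal_max_ideal by blast
  then show ?thesis using M(1) by auto
qed

lemma inverse_if_notin_max_ideal:
  assumes "x \<in> carrier R" "x \<notin> \<mm>"
  obtains y where "y \<in> carrier R" "y \<otimes> x = \<one>"
proof -
  have "PIdl x = carrier R"
    using proper_ideal_subset_max_ideal[OF cgenideal_ideal[OF assms(1)]] cgenideal_self[OF assms(1)] assms(2)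
    by blast
  then have "\<one> \<in> PIdl x" by simp
  then show ?thesis using that by (auto simp: cgenideal_def)
qed

text \<open>Elements outside the maximal ideal are units and kill no nonzero element.\<close>

lemma smult_eq_zero_in_max_ideal:
  assumes X: "module R X" and a: "a \<in> carrier R" and x: "x \<in> carrier X" "x \<noteq> \<zero>\<^bsub>X\<^esub>" "a \<odot>\<^bsub>X\<^esub> x = \<zero>\<^bsub>X\<^esub>"
  shows "a \<in> \<mm>"
proof (rule ccontr)
  interpret X: module R X by (rule X)
  assume "a \<notin> \<mm>"
  then obtain b where b: "b \<in> carrier R" "b \<otimes> a = \<one>" using inverse_if_notin_max_ideal[OF a] by blast
  have "x = b \<odot>\<^bsub>X\<^esub> (a \<odot>\<^bsub>X\<^esub> x)" using a b x(1) by (simp flip: X.smult_assoc1)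
  then show False using b(1) x(2,3) by simp
qed

text \<open>The condition says that \<open>R z\<close> is a copy of the residue field.\<close>

definition socle_element :: "'a \<Rightarrow> bool" where
  "socle_element z \<longleftrightarrow> z \<in> carrier R \<and> z \<noteq> \<zero> \<and> (\<forall>x \<in> \<mm>. x \<otimes> z = \<zero>)"

text \<open>A product of elements outside \<open>P\<close>, one from \<open>J\<close> and one from
  each \<open>K w\<close>, is outside \<open>P\<close> and lies in all these ideals.\<close>

lemma prime_avoids_intersection:
  assumes "finite W" "primeideal P R" "ideal J R" "\<not> J \<subseteq> P"
    and "\<And>w. w \<in> W \<Longrightarrow> ideal (K w) R \<and> \<not> K w \<subseteq> P"
  shows "\<exists>y \<in> J. y \<notin> P \<and> (\<forall>w \<in> W. y \<in> K w)"
  using assms(1,5)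
proof (induction W)
  case empty
  then show ?case using assms(4) by auto
next
  case (insert w W)
  then obtain y where y: "y \<in> J" "y \<notin> P" "\<And>w. w \<in> W \<Longrightarrow> y \<in> K w" by auto
  obtain k where k: "k \<in> K w" "k \<notin> P" using insert.prems by blast
  have K: "ideal (K v) R" if "v \<in> insert w W" for v using insert.prems that by blast
  have c: "y \<in> carrier R" "k \<in> carrier R"
    using y(1) k(1) ideal.Icarr[OF assms(3)] ideal.Icarr[OF K[of w]] by auto
  have "y \<otimes> k \<notin> P" using primeideal.I_prime[OF assms(2) c] y(2) k(2) by blast
  moreover have "y \<otimes> k \<in> J" by (rule ideal.I_r_closed[OF assms(3) y(1) c(2)])
  moreover have "y \<otimes> k \<in> K w" by (rule ideal.I_l_closed[OF K k(1) c(1)]) simp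
  moreover have "y \<otimes> k \<in> K v" if "v \<in> W" for v
    by (rule ideal.I_r_closed[OF K y(3)[OF that] c(2)]) (use that in simp)
  ultimately show ?case by (intro bexI[of _ "y \<otimes> k"]) auto
qed

text \<open>The maximal members of the family of annihilators of nonzero elements are prime, finite in
  number, and cover the zero divisors; by prime avoidance one of them contains \<open>\<mm>\<close>.\<close>

lemma socle_element_if_zero_divisors:
  assumes zd: "\<And>x. x \<in> \<mm> \<Longrightarrow> \<exists>r \<in> carrier R. r \<noteq> \<zero> \<and> x \<otimes> r = \<zero>"
  obtains z where "socle_element z"
proof -
  \<comment> \<open>The elements whose annihilators are maximal among annihilators of nonzero
    elements.\<close>
  define Z where "Z = {z \<in> carrier R. z \<noteq> \<zero> \<and>
    (\<forall>w \<in> carrier R. w \<noteq> \<zero> \<longrightarrow> annihilator z \<subseteq> annihilator w \<longrightarrow> annihilator w = annihilator z)}"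
  have Zc: "z \<in> carrier R" "z \<noteq> \<zero>" if "z \<in> Z" for z using that by (auto simp: Z_def)
  have Zmax: "annihilator w = annihilator z"
    if "z \<in> Z" "w \<in> carrier R" "w \<noteq> \<zero>" "annihilator z \<subseteq> annihilator w" for z w
    using that by (auto simp: Z_def)
  have prime: "primeideal (annihilator z) R" if z: "z \<in> Z" for z
  proof (rule primeidealI[OF ideal_annihilator[OF Zc(1)[OF z]] is_cring])
    have "\<one> \<notin> annihilator z" using Zc[OF z] by (simp add: annihilator_def)
    then show "carrier R \<noteq> annihilator z" by blast
    fix a b assume a: "a \<in> carrier R" and b: "b \<in> carrier R" and ab: "a \<otimes> b \<in> annihilator z"
    show "a \<in> annihilator z \<or> b \<in> annihilator z"
    proof (rule disjCI)
      assume nb: "b \<notin> annihilator z"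
      have "annihilator z \<subseteq> annihilator (b \<otimes> z)"
        using b Zc[OF z] by (auto simp: annihilator_def m_lcomm[of _ b z])
      then have "annihilator (b \<otimes> z) = annihilator z"
        using nb b Zc[OF z] by (intro Zmax z) (auto simp: annihilator_def)
      moreover have "a \<in> annihilator (b \<otimes> z)"
        using ab a b Zc[OF z] by (auto simp: annihilator_def m_assoc)
      ultimately show "a \<in> annihilator z" by simp
    qed
  qed
  \<comment> \<open>The maximal condition is applied to the ideals generated by finite subsets of
    \<open>Z\<close>, so that the finitely many generators are themselves members of
    \<open>Z\<close>.\<close>
  obtain Z0 where Z0: "finite Z0" "Z0 \<subseteq> Z" "Z \<subseteq> Idl Z0"
  proof -
    have gi: "ideal (Idl W) R" if "W \<subseteq> Z" for W
      using that Zc by (intro genideal_ideal) auto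
    obtain M where M: "M \<in> {Idl W | W. finite W \<and> W \<subseteq> Z}"
      "\<And>I. I \<in> {Idl W | W. finite W \<and> W \<subseteq> Z} \<Longrightarrow> M \<subseteq> I \<Longrightarrow> I = M"
      by (rule maximal_ideal_in_set[of "{Idl W | W. finite W \<and> W \<subseteq> Z}"]) (use gi in blast)+
    then obtain W where W: "finite W" "W \<subseteq> Z" "M = Idl W" by blast
    have "z \<in> Idl W" if "z \<in> Z" for z
    proof -
      have c: "insert z W \<subseteq> carrier R" using that W(2) Zc by auto
      have "Idl W \<subseteq> Idl (insert z W)" by (rule subset_Idl_subset[OF c]) auto
      moreover have "Idl (insert z W) \<in> {Idl W | W. finite W \<and> W \<subseteq> Z}" using that W by blast
      ultimately have "Idl (insert z W) = Idl W" using M(2) W(3) by blast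
      then show ?thesis using genideal_self[OF c] by auto
    qed
    then show ?thesis using that W by blast
  qed
  have Z0i: "ideal (annihilator w) R" if "w \<in> Z0" for w using that Z0 Zc by (intro ideal_annihilator) auto
  have cover: "\<exists>w \<in> Z0. x \<in> annihilator w" if x: "x \<in> \<mm>" for x
  proof -
    obtain r where r: "r \<in> carrier R" "r \<noteq> \<zero>" "x \<otimes> r = \<zero>" using zd[OF x] by blast
    let ?S = "{annihilator w | w. w \<in> carrier R \<and> w \<noteq> \<zero> \<and> annihilator r \<subseteq> annihilator w}"
    obtain P where P: "P \<in> ?S" "\<And>I. I \<in> ?S \<Longrightarrow> P \<subseteq> I \<Longrightarrow> I = P"
      by (rule maximal_ideal_in_set[of ?S]) (use r ideal_annihilator in blast)+
    then obtain z where z: "z \<in> carrier R" "z \<noteq> \<zero>" "annihilator r \<subseteq> annihilator z" "P = annihilator z"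
      by blast
    have zZ: "z \<in> Z" using z P(2) unfolding Z_def by blast
    \<comment> \<open>Otherwise some \<open>y\<close> outside the prime \<open>annihilator z\<close>
      kills every member of \<open>Z0\<close>, hence the ideal they generate, and with it
      \<open>z\<close>.\<close>
    have "\<exists>w \<in> Z0. annihilator w \<subseteq> annihilator z"
    proof (rule ccontr)
      assume neg: "\<not> ?thesis"
      have "\<exists>y \<in> carrier R. y \<notin> annihilator z \<and> (\<forall>w \<in> Z0. y \<in> annihilator w)"
        by (rule prime_avoids_intersection[OF Z0(1) prime[OF zZ] oneideal])
          (use neg Z0i Zc[OF zZ] in \<open>auto simp: annihilator_def\<close>)
      then obtain y where y: "y \<in> carrier R" "y \<notin> annihilator z" "\<And>w. w \<in> Z0 \<Longrightarrow> y \<in> annihilator w"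
        by blast
      have "w \<in> annihilator y" if "w \<in> Z0" for w
        using y(1) y(3)[OF that] Z0(2) Zc that by (auto simp: annihilator_def m_comm[of w])
      then have "Z0 \<subseteq> annihilator y" by blast
      then have "Idl Z0 \<subseteq> annihilator y" by (intro genideal_minimal ideal_annihilator y(1))
      then have "z \<in> annihilator y" using Z0(3) zZ by blast
      then show False using y z(1) by (auto simp: annihilator_def m_comm)
    qed
    then obtain w where w: "w \<in> Z0" "annihilator w \<subseteq> annihilator z" by blast
    then have "annihilator z = annihilator w" using Zmax[of w z] Z0(2) z by blast
    moreover have "x \<in> annihilator r" using r max_ideal_closed[OF x] by (simp add: annihilator_def)
    ultimately show ?thesis using w z by blast
  qed
  \<comment> \<open>\<open>T x\<close> collects the members of \<open>Z0\<close> killed by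
    \<open>x\<close>. An element of the maximal ideal that kills as few of them as possible still
    kills some \<open>w\<close>, and minimality forces the whole maximal ideal to kill this
    \<open>w\<close>.\<close>
  define T where "T x = {w \<in> Z0. x \<in> annihilator w}" for x
  define x where "x = (ARG_MIN (\<lambda>x. card (T x)) x. x \<in> \<mm>)"
  have x: "x \<in> \<mm>" "\<And>y. y \<in> \<mm> \<Longrightarrow> card (T x) \<le> card (T y)"
    using arg_min_nat_lemma[of "\<lambda>x. x \<in> \<mm>" \<zero> "\<lambda>x. card (T x)"]
      ideal_zero[OF ideal_max_ideal] unfolding x_def by blast+
  obtain w where w: "w \<in> Z0" "x \<in> annihilator w" using cover[OF x(1)] by blast
  have "\<mm> \<subseteq> annihilator w"
  proof (rule ccontr)
    assume neg: "\<not> ?thesis"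
    have "\<not> annihilator v \<subseteq> annihilator w" if "v \<in> Z0 - T x" for v
    proof
      assume "annihilator v \<subseteq> annihilator w"
      then have "annihilator w = annihilator v" using Zmax[of v w] Z0(2) w Zc that by blast
      then show False using that w by (auto simp: T_def)
    qed
    then have "\<exists>y \<in> \<mm>. y \<notin> annihilator w \<and> (\<forall>v \<in> Z0 - T x. y \<in> annihilator v)"
      using neg Z0 Z0i w by (intro prime_avoids_intersection prime ideal_max_ideal) auto
    then obtain y where y: "y \<in> \<mm>" "y \<notin> annihilator w" "\<And>v. v \<in> Z0 - T x \<Longrightarrow> y \<in> annihilator v"
      by blast
    have c: "x \<in> carrier R" "y \<in> carrier R" using x y max_ideal_closed by auto
    have sum: "v \<in> carrier R \<Longrightarrow> x \<oplus> y \<in> annihilator v \<longleftrightarrow> x \<otimes> v \<oplus> y \<otimes> v = \<zero>" for v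
      using c by (simp add: annihilator_def l_distr)
    \<comment> \<open>Each member of \<open>Z0\<close> outside \<open>T x\<close> is killed by
      \<open>y\<close> but not by \<open>x\<close>, and \<open>w\<close> is killed by
      \<open>x\<close> but not by \<open>y\<close>; so \<open>x + y\<close> kills neither
      kind.\<close>
    have "T (x \<oplus> y) \<subseteq> T x - {w}"
    proof
      fix v assume v: "v \<in> T (x \<oplus> y)"
      then have v': "v \<in> Z0" "v \<in> carrier R" "x \<otimes> v \<oplus> y \<otimes> v = \<zero>"
        using Z0(2) Zc sum by (auto simp: T_def)
      have "v \<in> T x"
      proof (rule ccontr)
        assume "v \<notin> T x"
        then have "y \<otimes> v = \<zero>" "x \<otimes> v \<noteq> \<zero>" using y(3) v' c by (auto simp: T_def annihilator_def)
        then show False using v' c by simp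
      qed
      moreover have "v \<noteq> w"
      proof
        assume "v = w"
        then have "x \<otimes> v = \<zero>" "y \<otimes> v \<noteq> \<zero>" using w y(2) c by (auto simp: annihilator_def)
        then show False using v' c by simp
      qed
      ultimately show "v \<in> T x - {w}" by simp
    qed
    moreover have "w \<in> T x" using w by (simp add: T_def)
    moreover have "finite (T x)" using Z0(1) by (simp add: T_def)
    ultimately have "card (T (x \<oplus> y)) < card (T x)" by (intro psubset_card_mono) auto
    moreover have "x \<oplus> y \<in> \<mm>"
      using x y ideal_add[OF ideal_max_ideal] by blast
    ultimately show False using x(2) by (meson not_le)
  qed
  then have "socle_element w" using w(1) Z0(2) Zc by (auto simp: socle_element_def annihilator_def)
  then show ?thesis by (rule that)
qed

text \<open>A non-zero-divisor in the maximal ideal would be a regular sequence of length one, its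
  quotient being nonzero because the ideal it generates stays inside the maximal ideal.\<close>

lemma socle_element_if_depth_zero:
  assumes "ring_depth R = 0"
  obtains z where "socle_element z"
proof (rule socle_element_if_zero_divisors)
  fix x assume x: "x \<in> \<mm>"
  have xc: "x \<in> carrier R" using x by (rule max_ideal_closed)
  have "\<not> regular_sequence R [x]"
  proof
    assume "regular_sequence R [x]"
    then have "enat (length [x]) \<le> ring_depth R"
      unfolding ring_depth_def using x by (intro Sup_upper) force
    then show False using assms by (simp add: zero_enat_def)
  qed
  moreover have "genideal R {x} \<noteq> carrier R"
    using genideal_minimal[OF ideal_max_ideal, of "{x}"] x one_notin_max_ideal by auto
  moreover have "genideal R {} = {\<zero>}"
    using genideal_minimal[OF zeroideal, of "{}"] genideal_ideal[of "{}"]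
      ideal_zero by blast
  ultimately show "\<exists>r \<in> carrier R. r \<noteq> \<zero> \<and> x \<otimes> r = \<zero>"
    using xc by (auto simp: regular_sequence_def)
qed (rule that)

text \<open>Elements of the maximal ideal are nilpotent: once the ideals of the powers of
  \<open>x\<close> are stationary, a power is killed by the unit \<open>1 - r x\<close>. The last
  nonzero power then witnesses that \<open>x\<close> is a zero divisor.\<close>

lemma socle_element_if_artinian:
  assumes "artinian_ring R"
  obtains z where "socle_element z"
proof (rule socle_element_if_zero_divisors)
  fix x assume x: "x \<in> \<mm>"
  have xc: "x \<in> carrier R" using x by (rule max_ideal_closed)
  let ?I = "\<lambda>n. PIdl (x [^] (n::nat))"
  have "?I (Suc n) \<subseteq> ?I n" for n
    using xc by (intro cgenideal_minimal cgenideal_ideal) (auto simp: cgenideal_def m_comm)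
  then obtain N where N: "\<And>n. n \<ge> N \<Longrightarrow> ?I n = ?I N"
    using assms[unfolded artinian_ring_def, THEN conjunct2, rule_format, of ?I] xc
    by (auto intro: cgenideal_ideal)
  have "x [^] N \<in> ?I (Suc N)" using N[of "Suc N"] cgenideal_self[of "x [^] N"] xc by simp
  then obtain r where r: "r \<in> carrier R" "x [^] N = r \<otimes> x [^] Suc N" by (auto simp: cgenideal_def)
  have rx: "\<one> \<ominus> r \<otimes> x \<notin> \<mm>"
  proof
    assume a: "\<one> \<ominus> r \<otimes> x \<in> \<mm>"
    have "r \<otimes> x \<in> \<mm>" using ideal.I_l_closed[OF ideal_max_ideal x r(1)] .
    with a have "(\<one> \<ominus> r \<otimes> x) \<oplus> r \<otimes> x \<in> \<mm>"
      using ideal_add[OF ideal_max_ideal] by blast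
    then show False using one_notin_max_ideal r xc by (simp add: a_minus_def a_assoc l_neg)
  qed
  have "r \<otimes> x \<otimes> x [^] N = r \<otimes> x [^] Suc N"
    using r(1) xc by (simp add: m_assoc m_comm[of x "x [^] N"])
  then have "(\<one> \<ominus> r \<otimes> x) \<otimes> x [^] N = x [^] N \<ominus> r \<otimes> x [^] Suc N"
    using r(1) xc by (simp add: a_minus_def l_distr l_minus)
  then have "(\<one> \<ominus> r \<otimes> x) \<otimes> x [^] N = \<zero>"
    unfolding r(2)[symmetric] using xc by (simp add: a_minus_def r_neg)
  then have "x [^] N = \<zero>"
    using smult_eq_zero_in_max_ideal[OF ring_module_module, of "\<one> \<ominus> r \<otimes> x" "x [^] N"] rx r(1) xc
    by (auto simp: a_minus_def)
  then have ex: "\<exists>n::nat. x [^] n = \<zero>" by blast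
  define n where "n = (LEAST n::nat. x [^] n = \<zero>)"
  have n: "x [^] n = \<zero>" "\<And>k. k < n \<Longrightarrow> x [^] k \<noteq> \<zero>"
    unfolding n_def using LeastI_ex[OF ex] not_less_Least by blast+
  have "\<zero> \<in> \<mm>" using ideal_zero[OF ideal_max_ideal] .
  then have "n \<noteq> 0" using n(1) one_notin_max_ideal by (auto intro: ccontr)
  then obtain k where "n = Suc k" by (cases n) auto
  then show "\<exists>r \<in> carrier R. r \<noteq> \<zero> \<and> x \<otimes> r = \<zero>"
    using n xc by (intro bexI[of _ "x [^] k"]) (auto simp: m_comm)
qed (rule that)

section \<open>Functionals into the socle and Nakayama's lemma\<close>

lemma submodule_sum:
  assumes X: "module R X" and N: "submodule N R X" and J: "ideal J R" and y: "y \<in> carrier X"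
  shows "submodule {w \<oplus>\<^bsub>X\<^esub> a \<odot>\<^bsub>X\<^esub> y | w a. w \<in> N \<and> a \<in> J} R X" (is "submodule ?S R X")
proof -
  interpret X: module R X by (rule X)
  note Nc = subsetD[OF submodule_subset[OF N]] and Jc = ideal.Icarr[OF J]
  show ?thesis
  proof (rule submoduleI'[OF X])
    show "?S \<subseteq> carrier X" using Nc Jc y by auto
    show "\<zero>\<^bsub>X\<^esub> \<in> ?S"
      using submodule_zero[OF N] ideal_zero[OF J] y
      by (intro CollectI exI[of _ "\<zero>\<^bsub>X\<^esub>"] exI[of _ \<zero>]) auto
    fix u assume "u \<in> ?S"
    then obtain w a where u: "u = w \<oplus>\<^bsub>X\<^esub> a \<odot>\<^bsub>X\<^esub> y" "w \<in> N" "a \<in> J" by blast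
    show "c \<odot>\<^bsub>X\<^esub> u \<in> ?S" if c: "c \<in> carrier R" for c
      using u submodule_smult[OF N c] ideal.I_l_closed[OF J _ c] Nc Jc y c
      by (intro CollectI exI[of _ "c \<odot>\<^bsub>X\<^esub> w"] exI[of _ "c \<otimes> a"]) (auto simp: X.smult_r_distr X.smult_assoc1)
    fix v assume "v \<in> ?S"
    then obtain w' b where v: "v = w' \<oplus>\<^bsub>X\<^esub> b \<odot>\<^bsub>X\<^esub> y" "w' \<in> N" "b \<in> J" by blast
    show "u \<oplus>\<^bsub>X\<^esub> v \<in> ?S"
      using u v submodule_add[OF N] ideal_add[OF J] Nc Jc y
      by (intro CollectI exI[of _ "w \<oplus>\<^bsub>X\<^esub> w'"] exI[of _ "a \<oplus> b"])
        (auto simp: X.smult_l_distr X.M.a_ac)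
  qed
qed

text \<open>The generators in \<open>A\<close> are adjoined to \<open>N\<close> one at a time.
  \<open>N1\<close> is the last stage that is still proper, and \<open>y\<close> is the generator
  that completes it to \<open>X\<close>.\<close>

lemma cyclic_top:
  assumes X: "module R X" and A: "finite A" "A \<subseteq> carrier X"
    and N: "submodule N R X" "N \<noteq> carrier X"
    and gen: "\<And>N'. submodule N' R X \<Longrightarrow> N \<subseteq> N' \<Longrightarrow> A \<subseteq> N' \<Longrightarrow> N' = carrier X"
  obtains N1 y where "submodule N1 R X" "N \<subseteq> N1" "y \<in> carrier X" "y \<notin> N1"
    "carrier X = {w \<oplus>\<^bsub>X\<^esub> a \<odot>\<^bsub>X\<^esub> y | w a. w \<in> N1 \<and> a \<in> carrier R}"
proof -
  interpret X: module R X by (rule X)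
  have "\<exists>N1 y. submodule N1 R X \<and> N \<subseteq> N1 \<and> y \<in> carrier X \<and> y \<notin> N1 \<and>
    carrier X = {w \<oplus>\<^bsub>X\<^esub> a \<odot>\<^bsub>X\<^esub> y | w a. w \<in> N1 \<and> a \<in> carrier R}"
    using A N gen
  proof (induction A arbitrary: N)
    case empty
    then show ?case by blast
  next
    case (insert y A)
    let ?N = "{w \<oplus>\<^bsub>X\<^esub> a \<odot>\<^bsub>X\<^esub> y | w a. w \<in> N \<and> a \<in> carrier R}"
    have y: "y \<in> carrier X" using insert.prems(1) by simp
    have S: "submodule ?N R X" by (intro submodule_sum X insert.prems(2) oneideal y)
    have Nc: "w \<in> carrier X" if "w \<in> N" for w using that submodule_subset[OF insert.prems(2)] by blast
    have sub: "N \<subseteq> ?N"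
    proof
      fix w assume "w \<in> N"
      then show "w \<in> ?N" using y Nc by (intro CollectI exI[of _ w] exI[of _ \<zero>]) auto
    qed
    have yN: "y \<in> ?N"
      using y submodule_zero[OF insert.prems(2)] by (intro CollectI exI[of _ "\<zero>\<^bsub>X\<^esub>"] exI[of _ \<one>]) auto
    show ?case
    proof (cases "?N = carrier X")
      case True
      have "y \<notin> N"
      proof
        assume "y \<in> N"
        then have "?N \<subseteq> N" using submodule_add[OF insert.prems(2)] submodule_smult[OF insert.prems(2)] by blast
        then show False using True insert.prems(3) sub by blast
      qed
      then show ?thesis using True y insert.prems(2) by (intro exI[of _ N] exI[of _ y]) auto
    next
      case False
      have "\<exists>N1 y'. submodule N1 R X \<and> ?N \<subseteq> N1 \<and> y' \<in> carrier X \<and> y' \<notin> N1 \<and>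
        carrier X = {w \<oplus>\<^bsub>X\<^esub> a \<odot>\<^bsub>X\<^esub> y' | w a. w \<in> N1 \<and> a \<in> carrier R}"
      proof (rule insert.IH[OF _ S False])
        show "A \<subseteq> carrier X" using insert.prems(1) by simp
        show "N' = carrier X" if "submodule N' R X" "?N \<subseteq> N'" "A \<subseteq> N'" for N'
        proof (rule insert.prems(4)[OF that(1)])
          show "N \<subseteq> N'" using sub that(2) by (rule subset_trans)
          show "insert y A \<subseteq> N'" using yN that by (intro insert_subsetI) (rule subsetD)
        qed
      qed
      then obtain N1 y' where *: "submodule N1 R X" "?N \<subseteq> N1" "y' \<in> carrier X" "y' \<notin> N1"
        "carrier X = {w \<oplus>\<^bsub>X\<^esub> a \<odot>\<^bsub>X\<^esub> y' | w a. w \<in> N1 \<and> a \<in> carrier R}"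
        by (elim exE conjE)
      show ?thesis
        by (intro exI[of _ N1] exI[of _ y'] conjI * subset_trans[OF sub *(2)])
    qed
  qed
  then show ?thesis using that by (elim exE conjE)
qed

text \<open>The functional is the composition \<open>X \<rightarrow> X/N\<^sub>2 \<cong> R/\<mm> \<cong> R z \<subseteq> R\<close> for a maximal
  submodule \<open>N\<^sub>2\<close> containing \<open>N\<close>. Its existence also plays the part of Nakayama's lemma.\<close>

lemma socle_functional:
  assumes z: "socle_element z" and pX: "presentation R n p X" and N: "submodule N R X" "N \<noteq> carrier X"
  obtains g where "g \<in> module_hom R X (ring_module R)" "\<And>x. x \<in> N \<Longrightarrow> g x = \<zero>"
    "\<exists>x \<in> carrier X. g x \<noteq> \<zero>" "\<And>x. x \<in> carrier X \<Longrightarrow> \<exists>r \<in> carrier R. g x = r \<otimes> z"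
proof -
  note p = presentationD[OF pX]
  interpret X: module R X by (rule p(1))
  have zc: "z \<in> carrier R" "z \<noteq> \<zero>" and zm: "\<And>a. a \<in> \<mm> \<Longrightarrow> a \<otimes> z = \<zero>"
    using z by (auto simp: socle_element_def)
  have cl: "p (unit_vec n i) \<in> carrier X" for i by (intro module_hom_closed[OF p(2)] unit_vec_closed)
  obtain N1 y where N1: "submodule N1 R X" "N \<subseteq> N1" and y: "y \<in> carrier X" "y \<notin> N1"
    and X1: "carrier X = {w \<oplus>\<^bsub>X\<^esub> a \<odot>\<^bsub>X\<^esub> y | w a. w \<in> N1 \<and> a \<in> carrier R}"
  proof (rule cyclic_top[OF p(1) _ _ N, of "(\<lambda>i. p (unit_vec n i)) ` {..<n}"])
    show "N' = carrier X" if "submodule N' R X" "(\<lambda>i. p (unit_vec n i)) ` {..<n} \<subseteq> N'" for N'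
      using that by (intro presentation_generators[OF pX]) auto
  qed (use cl in auto)
  define N2 where "N2 = {w \<oplus>\<^bsub>X\<^esub> a \<odot>\<^bsub>X\<^esub> y | w a. w \<in> N1 \<and> a \<in> \<mm>}"
  have N2: "submodule N2 R X" unfolding N2_def by (intro submodule_sum p(1) N1 ideal_max_ideal y)
  note N1c = subsetD[OF submodule_subset[OF N1(1)]] and N2c = subsetD[OF submodule_subset[OF N2]]
  \<comment> \<open>If \<open>a\<close> were a unit, then so would be \<open>a - b\<close> for
    \<open>b\<close> in the maximal ideal, and \<open>(a - b) y\<close>, which lies in
    \<open>N1\<close>, would put \<open>y\<close> into \<open>N1\<close>.\<close>
  have y2: "a \<in> \<mm>" if a: "a \<in> carrier R" "a \<odot>\<^bsub>X\<^esub> y \<in> N2" for a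
  proof (rule ccontr)
    assume am: "a \<notin> \<mm>"
    obtain w b where w: "a \<odot>\<^bsub>X\<^esub> y = w \<oplus>\<^bsub>X\<^esub> b \<odot>\<^bsub>X\<^esub> y" "w \<in> N1" "b \<in> \<mm>" using a by (auto simp: N2_def)
    have b: "b \<in> carrier R" using w by (intro max_ideal_closed)
    have "a \<ominus> b \<notin> \<mm>"
    proof
      assume "a \<ominus> b \<in> \<mm>"
      then have "(a \<ominus> b) \<oplus> b \<in> \<mm>"
        using ideal_add[OF ideal_max_ideal] w(3) by blast
      then show False using am a b by (simp add: a_minus_def a_assoc l_neg)
    qed
    then obtain c where c: "c \<in> carrier R" "c \<otimes> (a \<ominus> b) = \<one>"
      using inverse_if_notin_max_ideal[of "a \<ominus> b"] a b by (metis minus_closed)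
    have "(a \<ominus> b) \<odot>\<^bsub>X\<^esub> y = a \<odot>\<^bsub>X\<^esub> y \<oplus>\<^bsub>X\<^esub> \<ominus>\<^bsub>X\<^esub> (b \<odot>\<^bsub>X\<^esub> y)"
      using a b y by (simp add: a_minus_def X.smult_l_distr X.smult_l_minus)
    also have "\<dots> = w" unfolding w(1) using b y N1c[OF w(2)] by (simp add: X.M.a_assoc X.M.r_neg)
    finally have "c \<odot>\<^bsub>X\<^esub> w = c \<odot>\<^bsub>X\<^esub> ((a \<ominus> b) \<odot>\<^bsub>X\<^esub> y)" by simp
    also have "\<dots> = (c \<otimes> (a \<ominus> b)) \<odot>\<^bsub>X\<^esub> y"
      using c(1) a b y(1) by (intro X.smult_assoc1[symmetric]) simp_all
    finally have "c \<odot>\<^bsub>X\<^esub> w = y" using c y by simp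
    then show False using submodule_smult[OF N1(1) c(1) w(2)] y by simp
  qed
  have N12: "N1 \<subseteq> N2"
  proof
    fix w assume "w \<in> N1"
    then show "w \<in> N2"
      unfolding N2_def using y N1c ideal_zero[OF ideal_max_ideal]
      by (intro CollectI exI[of _ w] exI[of _ \<zero>]) auto
  qed
  \<comment> \<open>\<open>r\<close> is a coordinate of \<open>x\<close> along \<open>y\<close>
    modulo \<open>N2\<close>. It is determined only modulo the maximal ideal, which multiplication
    by \<open>z\<close> does not see; hence \<open>g x = r z\<close> is well defined.\<close>
  define G where "G x r \<longleftrightarrow> r \<in> carrier R \<and> (\<exists>w \<in> N2. x = w \<oplus>\<^bsub>X\<^esub> r \<odot>\<^bsub>X\<^esub> y)" for x r
  have G_uniq: "r \<otimes> z = r' \<otimes> z" if G: "G x r" "G x r'" for x r r'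
  proof -
    obtain w w' where r: "r \<in> carrier R" "r' \<in> carrier R" and w: "w \<in> N2" "w' \<in> N2"
      and eq: "w \<oplus>\<^bsub>X\<^esub> r \<odot>\<^bsub>X\<^esub> y = w' \<oplus>\<^bsub>X\<^esub> r' \<odot>\<^bsub>X\<^esub> y"
      using G unfolding G_def by blast
    have "r \<odot>\<^bsub>X\<^esub> y = \<ominus>\<^bsub>X\<^esub> w \<oplus>\<^bsub>X\<^esub> (w \<oplus>\<^bsub>X\<^esub> r \<odot>\<^bsub>X\<^esub> y)"
      using N2c w r y by (simp add: X.M.a_assoc[symmetric] X.M.l_neg)
    also have "\<dots> = (\<ominus>\<^bsub>X\<^esub> w \<oplus>\<^bsub>X\<^esub> w') \<oplus>\<^bsub>X\<^esub> r' \<odot>\<^bsub>X\<^esub> y"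
      unfolding eq using N2c w r y by (simp add: X.M.a_assoc)
    finally have "(r \<ominus> r') \<odot>\<^bsub>X\<^esub> y = \<ominus>\<^bsub>X\<^esub> w \<oplus>\<^bsub>X\<^esub> w'"
      using N2c w r y by (simp add: a_minus_def X.smult_l_distr X.smult_l_minus X.M.a_assoc X.M.r_neg)
    then have "(r \<ominus> r') \<odot>\<^bsub>X\<^esub> y \<in> N2"
      using submodule_add[OF N2 submodule_uminus[OF p(1) N2 w(1)] w(2)] by simp
    then have d: "(r \<ominus> r') \<otimes> z = \<zero>" by (rule zm[OF y2[OF minus_closed[OF r]]])
    have e: "(r \<ominus> r') \<otimes> z = r \<otimes> z \<ominus> r' \<otimes> z"
      using r zc(1) unfolding a_minus_def by (simp only: l_distr a_inv_closed l_minus)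
    show ?thesis
      by (rule eq_if_minus_eq_zero[OF trans[OF e[symmetric] d]]) (intro m_closed r zc(1))+
  qed
  have G_ex: "\<exists>r. G x r" if "x \<in> carrier X" for x
    using that N12 unfolding G_def by (subst (asm) X1) blast
  define g where "g x = (SOME r. G x r) \<otimes> z" for x
  have g: "g x = r \<otimes> z" if "G x r" for x r
    unfolding g_def using that by (intro G_uniq[of x]) (rule someI)
  have G_add: "G (x \<oplus>\<^bsub>X\<^esub> x') (r \<oplus> r')" if G: "G x r" "G x' r'" for x x' r r'
  proof -
    obtain w w' where r: "r \<in> carrier R" "r' \<in> carrier R" and w: "w \<in> N2" "w' \<in> N2"
      and eq: "x = w \<oplus>\<^bsub>X\<^esub> r \<odot>\<^bsub>X\<^esub> y" "x' = w' \<oplus>\<^bsub>X\<^esub> r' \<odot>\<^bsub>X\<^esub> y"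
      using G unfolding G_def by blast
    then show ?thesis
      unfolding G_def using N2c y submodule_add[OF N2]
      by (intro conjI bexI[of _ "w \<oplus>\<^bsub>X\<^esub> w'"]) (auto simp: X.smult_l_distr X.M.a_ac)
  qed
  have G_smult: "G (c \<odot>\<^bsub>X\<^esub> x) (c \<otimes> r)" if G: "G x r" and c: "c \<in> carrier R" for x c r
  proof -
    obtain w where r: "r \<in> carrier R" and w: "w \<in> N2" and eq: "x = w \<oplus>\<^bsub>X\<^esub> r \<odot>\<^bsub>X\<^esub> y"
      using G unfolding G_def by blast
    then show ?thesis
      unfolding G_def using N2c y c submodule_smult[OF N2 c]
      by (intro conjI bexI[of _ "c \<odot>\<^bsub>X\<^esub> w"]) (auto simp: X.smult_r_distr X.smult_assoc1)
  qed
  have Gc: "r \<in> carrier R" if "G x r" for x r using that by (simp add: G_def)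
  have hom: "g \<in> module_hom R X (ring_module R)"
  proof (rule module_homI)
    fix x assume "x \<in> carrier X"
    then obtain r where r: "G x r" using G_ex by blast
    show "g x \<in> carrier (ring_module R)" using g[OF r] Gc[OF r] zc by simp
    show "g (c \<odot>\<^bsub>X\<^esub> x) = c \<odot>\<^bsub>ring_module R\<^esub> g x" if "c \<in> carrier R" for c
      using g[OF G_smult[OF r that]] g[OF r] Gc[OF r] that zc by (simp add: m_assoc)
    fix x' assume "x' \<in> carrier X"
    then obtain r' where r': "G x' r'" using G_ex by blast
    show "g (x \<oplus>\<^bsub>X\<^esub> x') = g x \<oplus>\<^bsub>ring_module R\<^esub> g x'"
      using g[OF G_add[OF r r']] g[OF r] g[OF r'] Gc[OF r] Gc[OF r'] zc by (simp add: l_distr)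
  qed
  have Gy: "G y \<one>" unfolding G_def using y submodule_zero[OF N2] by (intro conjI bexI[of _ "\<zero>\<^bsub>X\<^esub>"]) auto
  show ?thesis
  proof (rule that[OF hom])
    show "g x = \<zero>" if "x \<in> N" for x
    proof -
      have "x \<in> N2" using that N1(2) N12 by blast
      then have "G x \<zero>" unfolding G_def using y N2c by (intro conjI bexI[of _ x]) auto
      from g[OF this] show ?thesis using zc by simp
    qed
    show "\<exists>x \<in> carrier X. g x \<noteq> \<zero>" using g[OF Gy] y zc by (intro bexI[of _ y]) auto
    show "\<exists>r \<in> carrier R. g x = r \<otimes> z" if x: "x \<in> carrier X" for x
    proof -
      obtain r where r: "G x r" using G_ex[OF x] by blast
      show ?thesis using g[OF r] Gc[OF r] by blast
    qed
  qed
qed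

text \<open>Nakayama's lemma in dual form. The condition \<open>gen\<close> expresses
  \<open>X = \<mm> X\<close> through functionals: those annihilated by the maximal ideal vanish. A
  nonzero \<open>X\<close> would carry a nonzero functional into \<open>R z\<close>, which is
  annihilated in this sense.\<close>

lemma zero_if_generated_by_max_ideal:
  assumes z: "socle_element z" and pX: "presentation R n p X"
    and gen: "\<And>g x. g \<in> module_hom R X (ring_module R) \<Longrightarrow> x \<in> carrier X \<Longrightarrow>
      (\<And>a y. a \<in> \<mm> \<Longrightarrow> y \<in> carrier X \<Longrightarrow> a \<otimes> g y = \<zero>) \<Longrightarrow> g x = \<zero>"
  shows "carrier X = {\<zero>\<^bsub>X\<^esub>}"
proof (rule ccontr)
  note p = presentationD[OF pX]
  interpret X: module R X by (rule p(1))
  assume neg: "\<not> ?thesis"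
  have "submodule {\<zero>\<^bsub>X\<^esub>} R X" by (rule submoduleI'[OF p(1)]) auto
  then obtain g where g: "g \<in> module_hom R X (ring_module R)" "\<exists>x \<in> carrier X. g x \<noteq> \<zero>"
    "\<And>x. x \<in> carrier X \<Longrightarrow> \<exists>r \<in> carrier R. g x = r \<otimes> z"
    using socle_functional[OF z pX, of "{\<zero>\<^bsub>X\<^esub>}"] neg by metis
  have "a \<otimes> g y = \<zero>" if a: "a \<in> \<mm>" and y: "y \<in> carrier X" for a y
  proof -
    obtain r where r: "r \<in> carrier R" "g y = r \<otimes> z" using g(3)[OF y] by blast
    then show ?thesis
      using z a max_ideal_closed[OF a] by (simp add: socle_element_def m_lcomm[of a r])
  qed
  then show False using g(2) gen[OF g(1)] by blast
qed

section \<open>Minimal presentations\<close>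

lemma lincomb_split:
  assumes X: "module R X" and N: "submodule N R X" and a: "\<And>j. j < n \<Longrightarrow> a j \<in> carrier R"
    and y: "\<And>j. j < n \<Longrightarrow> j \<noteq> i \<Longrightarrow> y j \<in> N" "y i \<in> carrier X"
  shows "if i < n then \<exists>w \<in> N. lincomb X a y n = w \<oplus>\<^bsub>X\<^esub> a i \<odot>\<^bsub>X\<^esub> y i else lincomb X a y n \<in> N"
proof -
  interpret X: module R X by (rule X)
  note Nc = subsetD[OF submodule_subset[OF N]]
  show ?thesis
    using a y(1)
  proof (induction n)
    case 0
    then show ?case using submodule_zero[OF N] by simp
  next
    case (Suc n)
    have IH: "if i < n then \<exists>w \<in> N. lincomb X a y n = w \<oplus>\<^bsub>X\<^esub> a i \<odot>\<^bsub>X\<^esub> y i else lincomb X a y n \<in> N"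
      using Suc by simp
    have an: "a n \<in> carrier R" using Suc.prems by simp
    consider "i < n" | "i = n" | "n < i" by linarith
    then show ?case
    proof cases
      case 1
      then obtain w where w: "w \<in> N" "lincomb X a y n = w \<oplus>\<^bsub>X\<^esub> a i \<odot>\<^bsub>X\<^esub> y i" using IH by auto
      have yn: "y n \<in> N" "a i \<in> carrier R" using Suc.prems 1 by simp_all
      have "lincomb X a y (Suc n) = (w \<oplus>\<^bsub>X\<^esub> a n \<odot>\<^bsub>X\<^esub> y n) \<oplus>\<^bsub>X\<^esub> a i \<odot>\<^bsub>X\<^esub> y i"
        using w an yn y(2) Nc by (simp add: X.M.a_ac)
      moreover have "w \<oplus>\<^bsub>X\<^esub> a n \<odot>\<^bsub>X\<^esub> y n \<in> N"
        by (intro submodule_add[OF N] submodule_smult[OF N] w an yn)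
      ultimately show ?thesis using 1 by auto
    next
      case 2
      then show ?thesis using IH by auto
    next
      case 3
      then have "y n \<in> N" using Suc.prems by simp
      then show ?thesis using 3 IH an by (simp add: submodule_add[OF N] submodule_smult[OF N])
    qed
  qed
qed

text \<open>A relation with a unit as \<open>i\<close>-th coefficient expresses the
  \<open>i\<close>-th generator through the others, so that \<open>n - 1\<close> generators would
  suffice.\<close>

lemma minimal_presentation_kernel:
  assumes pX: "presentation R n p X" and min: "\<And>q k. k < n \<Longrightarrow> \<not> presentation R k q X"
    and x: "x \<in> a_kernel (free_power R n) X p" and i: "i < n"
  shows "x i \<in> \<mm>"
proof (rule ccontr)
  assume xi: "x i \<notin> \<mm>"
  note p = presentationD[OF pX]
  interpret X: module R X by (rule p(1))
  have x': "x \<in> carrier (free_power R n)" "p x = \<zero>\<^bsub>X\<^esub>" using x by (auto simp: a_kernel_iff)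
  have xc: "x j \<in> carrier R" if "j < n" for j using x'(1) that by (auto simp: free_power_simps)
  obtain b where b: "b \<in> carrier R" "b \<otimes> x i = \<one>" using inverse_if_notin_max_ideal[OF xc[OF i] xi] by blast
  define y where "y j = p (unit_vec n j)" for j
  have y: "y j \<in> carrier X" for j unfolding y_def by (intro module_hom_closed[OF p(2)] unit_vec_closed)
  \<comment> \<open>The last generator moves into slot \<open>i\<close>, so that the first
    \<open>n - 1\<close> entries of \<open>y'\<close> list all generators except the
    \<open>i\<close>-th; for \<open>i = n - 1\<close> nothing changes.\<close>
  define y' where "y' = y(i := y (n - 1))"
  have y': "y' j \<in> carrier X" for j using y by (simp add: y'_def)
  define q where "q = (\<lambda>c. lincomb X c y' (n - 1))"
  have q: "q \<in> module_hom R (free_power R (n - 1)) X"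
    unfolding q_def by (intro hom_from_free_power p(1) y')
  let ?N = "q ` carrier (free_power R (n - 1))"
  have N: "submodule ?N R X"
    by (intro submodule_image[OF q] p(1) free_power_module module.carrier_is_submodule)
  have y'N: "y' j \<in> ?N" if "j < n - 1" for j
  proof (rule image_eqI)
    show "y' j = q (unit_vec (n - 1) j)"
      unfolding q_def using lincomb_unit_vec[OF p(1) y' that] by simp
  qed (rule unit_vec_closed)
  have yN: "y j \<in> ?N" if "j < n" "j \<noteq> i" for j
  proof (cases "j = n - 1")
    case True
    then show ?thesis using y'N[of i] that i by (simp add: y'_def)
  next
    case False
    then show ?thesis using y'N[of j] that by (simp add: y'_def)
  qed
  obtain w where w0: "w \<in> ?N" "lincomb X x y n = w \<oplus>\<^bsub>X\<^esub> x i \<odot>\<^bsub>X\<^esub> y i"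
    using lincomb_split[where i = i and a = x and y = y and n = n, OF p(1) N xc yN y] i by auto
  moreover have "lincomb X x y n = \<zero>\<^bsub>X\<^esub>"
    using hom_free_power_eq[OF p(2,1) x'(1)] x'(2) by (simp add: y_def[abs_def])
  ultimately have w: "w \<in> ?N" "w \<oplus>\<^bsub>X\<^esub> x i \<odot>\<^bsub>X\<^esub> y i = \<zero>\<^bsub>X\<^esub>" by simp_all
  have "w \<in> carrier X" using w(1) submodule_subset[OF N] by blast
  then have "x i \<odot>\<^bsub>X\<^esub> y i = \<ominus>\<^bsub>X\<^esub> w"
    using w(2) xc[OF i] y[of i] by (metis X.M.a_comm X.M.minus_equality X.smult_closed)
  then have "x i \<odot>\<^bsub>X\<^esub> y i \<in> ?N" using submodule_uminus[OF p(1) N w(1)] by simp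
  then have "b \<odot>\<^bsub>X\<^esub> (x i \<odot>\<^bsub>X\<^esub> y i) \<in> ?N" by (rule submodule_smult[OF N b(1)])
  moreover have "b \<odot>\<^bsub>X\<^esub> (x i \<odot>\<^bsub>X\<^esub> y i) = y i" using b xc[OF i] y[of i] by (simp flip: X.smult_assoc1)
  ultimately have "y i \<in> ?N" by simp
  then have "?N = carrier X" using yN by (intro presentation_generators[OF pX N]) (auto simp: y_def)
  then have "presentation R (n - 1) q X" using q p(1) by (simp add: presentation_def)
  then show False using min[of "n - 1"] i by simp
qed

lemma lincomb_eq_zero:
  assumes "module R X" "\<And>i. i < n \<Longrightarrow> a i \<odot>\<^bsub>X\<^esub> y i = \<zero>\<^bsub>X\<^esub>"
  shows "lincomb X a y n = \<zero>\<^bsub>X\<^esub>"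
proof -
  interpret X: module R X by fact
  show ?thesis using assms(2) by (induction n) auto
qed

text \<open>The kernel \<open>K\<close> of a minimal presentation by \<open>F\<close> lies in \<open>\<mm>F\<close> and is a direct summand
  of \<open>F\<close>, whence \<open>K = \<mm>K\<close>.\<close>

lemma free_module_if_free_retract:
  assumes z: "socle_element z" and pX: "presentation R n p X" and F: "free_retract R X"
  shows "free_module R X"
proof -
  define k where "k = (LEAST k. \<exists>p. presentation R k p X)"
  obtain q where qX: "presentation R k q X"
    unfolding k_def using LeastI[of "\<lambda>k. \<exists>p. presentation R k p X" n] pX by blast
  have min: "\<not> presentation R l q X" if "l < k" for l q
    using not_less_Least[OF that[unfolded k_def]] by blast
  note q = presentationD[OF qX]
  interpret X: module R X by (rule q(1))
  interpret P: module R "free_power R k" by (rule free_power_module)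
  let ?K = "kernel_module R k q X"
  note K = kernel_module_module[OF qX]
  obtain r where r: "r \<in> module_hom R (free_power R k) ?K"
    "\<And>x. x \<in> a_kernel (free_power R k) X q \<Longrightarrow> r x = x"
    using free_retract_kernel[OF F qX] by blast
  have "r ` carrier (free_power R k) = carrier ?K"
  proof
    show "r ` carrier (free_power R k) \<subseteq> carrier ?K" using module_hom_closed[OF r(1)] by blast
    show "carrier ?K \<subseteq> r ` carrier (free_power R k)"
    proof
      fix x assume "x \<in> carrier ?K"
      then show "x \<in> r ` carrier (free_power R k)"
        using r(2)[of x] by (intro image_eqI[of _ _ x]) (simp_all add: a_kernel_iff)
    qed
  qed
  then have rK: "presentation R k r ?K" using r(1) K by (simp add: presentation_def)
  have "carrier ?K = {\<zero>\<^bsub>?K\<^esub>}"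
  proof (rule zero_if_generated_by_max_ideal[OF z rK])
    fix g x assume g: "g \<in> module_hom R ?K (ring_module R)" and x: "x \<in> carrier ?K"
      and ann: "\<And>a y. a \<in> \<mm> \<Longrightarrow> y \<in> carrier ?K \<Longrightarrow> a \<otimes> g y = \<zero>"
    have xK: "x \<in> a_kernel (free_power R k) X q" using x by simp
    \<comment> \<open>Here \<open>x = r x\<close> is a combination of the elements
      \<open>r (unit_vec k i)\<close> of the kernel, with the coordinates of \<open>x\<close> as
      coefficients; minimality puts these into the maximal ideal.\<close>
    have "g (r x) = lincomb (ring_module R) x (\<lambda>i. g (r (unit_vec k i))) k"
      using xK by (intro hom_free_power_eq[OF module_hom_comp[OF r(1) g] ring_module_module]) (simp add: a_kernel_iff)
    also have "\<dots> = \<zero>\<^bsub>ring_module R\<^esub>"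
    proof (rule lincomb_eq_zero[OF ring_module_module])
      fix i assume "i < k"
      then have "x i \<in> \<mm>" by (intro minimal_presentation_kernel[OF qX min xK])
      then show "x i \<odot>\<^bsub>ring_module R\<^esub> g (r (unit_vec k i)) = \<zero>\<^bsub>ring_module R\<^esub>"
        using ann[of "x i" "r (unit_vec k i)"] module_hom_closed[OF r(1) unit_vec_closed] by simp
    qed
    finally show "g x = \<zero>" using r(2)[OF xK] by simp
  qed
  then have K0: "a_kernel (free_power R k) X q = {\<zero>\<^bsub>free_power R k\<^esub>}" by simp
  have ker: "x = \<zero>\<^bsub>free_power R k\<^esub>" if "x \<in> carrier (free_power R k)" "q x = \<zero>\<^bsub>X\<^esub>" for x
  proof -
    have "x \<in> a_kernel (free_power R k) X q" using that by (simp add: a_kernel_iff)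
    then show ?thesis unfolding K0 by simp
  qed
  have "inj_on q (carrier (free_power R k))"
  proof (rule inj_onI)
    fix x y assume x: "x \<in> carrier (free_power R k)" and y: "y \<in> carrier (free_power R k)" and eq: "q x = q y"
    have "q (x \<ominus>\<^bsub>free_power R k\<^esub> y) = q y \<ominus>\<^bsub>X\<^esub> q y"
      using module_hom_minus[OF q(2) free_power_module q(1) x y] eq by simp
    also have "\<dots> = \<zero>\<^bsub>X\<^esub>" using module_hom_closed[OF q(2) y] by (simp add: a_minus_def X.M.r_neg)
    finally have "x \<ominus>\<^bsub>free_power R k\<^esub> y = \<zero>\<^bsub>free_power R k\<^esub>" using x y by (intro ker) auto
    then show "x = y" using x y by (rule P.M.eq_if_minus_eq_zero)
  qed
  then have b: "bij_betw q (carrier (free_power R k)) (carrier X)" using q(3) by (simp add: bij_betw_def)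
  have "inv_into (carrier (free_power R k)) q \<in> module_iso R X (free_power R k)"
    using module_hom_inv[OF q(2) b free_power_module] bij_betw_inv_into[OF b] by (simp add: module_iso_def)
  then show ?thesis unfolding free_module_def isomorphic_modules_def by blast
qed

end

section \<open>Stable isomorphism\<close>

lemma direct_sum_module_simps [simp]:
  "carrier (direct_sum_module X Y) = carrier X \<times> carrier Y"
  "zero (direct_sum_module X Y) = (\<zero>\<^bsub>X\<^esub>, \<zero>\<^bsub>Y\<^esub>)"
  "(x, y) \<oplus>\<^bsub>direct_sum_module X Y\<^esub> (x', y') = (x \<oplus>\<^bsub>X\<^esub> x', y \<oplus>\<^bsub>Y\<^esub> y')"
  "a \<odot>\<^bsub>direct_sum_module X Y\<^esub> (x, y) = (a \<odot>\<^bsub>X\<^esub> x, a \<odot>\<^bsub>Y\<^esub> y)"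
  by (simp_all add: direct_sum_module_def)

lemma direct_sum_module_module:
  assumes "module R X" "module R Y"
  shows "module R (direct_sum_module X Y)"
proof -
  interpret X: module R X by fact
  interpret Y: module R Y by fact
  show ?thesis
  proof (rule moduleI)
    show "cring R" by (rule X.is_cring)
    show "abelian_group (direct_sum_module X Y)"
    proof (rule abelian_groupI)
      fix u assume "u \<in> carrier (direct_sum_module X Y)"
      then obtain x y where u: "u = (x, y)" "x \<in> carrier X" "y \<in> carrier Y" by auto
      then show "\<exists>v \<in> carrier (direct_sum_module X Y). v \<oplus>\<^bsub>direct_sum_module X Y\<^esub> u = \<zero>\<^bsub>direct_sum_module X Y\<^esub>"
        by (intro bexI[of _ "(\<ominus>\<^bsub>X\<^esub> x, \<ominus>\<^bsub>Y\<^esub> y)"]) (simp_all add: X.M.l_neg Y.M.l_neg)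
    qed (auto simp: X.M.a_assoc Y.M.a_assoc intro: X.M.a_comm Y.M.a_comm)
  qed (auto simp: X.smult_l_distr Y.smult_l_distr X.smult_r_distr Y.smult_r_distr
      X.smult_assoc1 Y.smult_assoc1)
qed

lemma fst_module_hom: "fst \<in> module_hom R (direct_sum_module X Y) X"
  by (rule module_homI) auto

lemma snd_module_hom: "snd \<in> module_hom R (direct_sum_module X Y) Y"
  by (rule module_homI) auto

lemma left_inclusion_module_hom:
  assumes "module R Y"
  shows "(\<lambda>x. (x, \<zero>\<^bsub>Y\<^esub>)) \<in> module_hom R X (direct_sum_module X Y)"
proof -
  interpret Y: module R Y by fact
  show ?thesis by (rule module_homI) auto
qed

lemma right_inclusion_module_hom:
  assumes "module R X"
  shows "(\<lambda>y. (\<zero>\<^bsub>X\<^esub>, y)) \<in> module_hom R Y (direct_sum_module X Y)"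
proof -
  interpret X: module R X by fact
  show ?thesis by (rule module_homI) auto
qed

text \<open>The pair \<open>f (x, 0)\<close> is the sum of its component in \<open>Y\<close> and its
  component in the free power. Applying \<open>g\<close> and projecting to \<open>X\<close>, the
  former gives a map through \<open>Y\<close>, the latter one through a free module, and together
  they return \<open>x\<close>.\<close>

lemma stable_retract_if_mutually_inverse:
  assumes f: "f \<in> module_hom R (direct_sum_module X (free_power R p)) (direct_sum_module Y (free_power R q))"
    and g: "g \<in> module_hom R (direct_sum_module Y (free_power R q)) (direct_sum_module X (free_power R p))"
    and inv: "\<And>x. x \<in> carrier (direct_sum_module X (free_power R p)) \<Longrightarrow> g (f x) = x"
    and X: "module R X" and Y: "module R Y"
  shows "stable_retract R X Y"
proof -
  interpret X: module R X by (rule X)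
  interpret Y: module R Y by (rule Y)
  let ?P = "free_power R p" and ?Q = "free_power R q"
  note P = X.R.free_power_module[of p] and Q = X.R.free_power_module[of q]
  interpret Q: module R ?Q by (rule Q)
  have P0: "\<zero>\<^bsub>?P\<^esub> \<in> carrier ?P" using submodule_zero[OF module.carrier_is_submodule[OF P]] .
  have id: "x = fst (g (fst (f (x, \<zero>\<^bsub>?P\<^esub>)), \<zero>\<^bsub>?Q\<^esub>)) \<oplus>\<^bsub>X\<^esub> fst (g (\<zero>\<^bsub>Y\<^esub>, snd (f (x, \<zero>\<^bsub>?P\<^esub>))))"
    if x: "x \<in> carrier X" for x
  proof -
    obtain y w where yw: "f (x, \<zero>\<^bsub>?P\<^esub>) = (y, w)" "y \<in> carrier Y" "w \<in> carrier ?Q"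
      using module_hom_closed[OF f, of "(x, \<zero>\<^bsub>?P\<^esub>)"] x P0 by auto
    have "(x, \<zero>\<^bsub>?P\<^esub>) = g (y, w)" using inv[of "(x, \<zero>\<^bsub>?P\<^esub>)"] x P0 yw by simp
    also have "(y, w) = (y, \<zero>\<^bsub>?Q\<^esub>) \<oplus>\<^bsub>direct_sum_module Y ?Q\<^esub> (\<zero>\<^bsub>Y\<^esub>, w)" using yw by simp
    also have "g \<dots> = g (y, \<zero>\<^bsub>?Q\<^esub>) \<oplus>\<^bsub>direct_sum_module X ?P\<^esub> g (\<zero>\<^bsub>Y\<^esub>, w)"
      using yw by (intro module_hom_add[OF g]) simp_all
    finally have "fst (x, \<zero>\<^bsub>?P\<^esub>) = fst (g (y, \<zero>\<^bsub>?Q\<^esub>) \<oplus>\<^bsub>direct_sum_module X ?P\<^esub> g (\<zero>\<^bsub>Y\<^esub>, w))"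
      by (rule arg_cong)
    then show ?thesis
      unfolding yw(1) by (cases "g (y, \<zero>\<^bsub>?Q\<^esub>)"; cases "g (\<zero>\<^bsub>Y\<^esub>, w)") simp
  qed
  note fx = module_hom_comp[OF left_inclusion_module_hom[OF P] f]
  show ?thesis
    unfolding stable_retract_def
    by (rule exI[of _ "\<lambda>x. fst (f (x, \<zero>\<^bsub>?P\<^esub>))"], rule exI[of _ "\<lambda>y. fst (g (y, \<zero>\<^bsub>?Q\<^esub>))"],
        rule exI[of _ q], rule exI[of _ "\<lambda>x. snd (f (x, \<zero>\<^bsub>?P\<^esub>))"],
        rule exI[of _ "\<lambda>w. fst (g (\<zero>\<^bsub>Y\<^esub>, w))"])
      (intro conjI ballI id module_hom_comp[OF fx fst_module_hom] module_hom_comp[OF fx snd_module_hom]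
        module_hom_comp[OF module_hom_comp[OF left_inclusion_module_hom[OF Q] g] fst_module_hom]
        module_hom_comp[OF module_hom_comp[OF right_inclusion_module_hom[OF Y] g] fst_module_hom])
qed

lemma stably_isomorphic_stable_retract:
  assumes S: "stably_isomorphic R X Y" and X: "module R X" and Y: "module R Y"
  shows "stable_retract R X Y" "stable_retract R Y X"
proof -
  obtain p q where iso:
    "isomorphic_modules R (direct_sum_module X (free_power R p)) (direct_sum_module Y (free_power R q))"
    using S by (auto simp: stably_isomorphic_def)
  have D: "module R (direct_sum_module X (free_power R p))"
    by (intro direct_sum_module_module X cring.free_power_module module.axioms(1)[OF X])
  obtain f g where "f \<in> module_hom R (direct_sum_module X (free_power R p)) (direct_sum_module Y (free_power R q))"
    "g \<in> module_hom R (direct_sum_module Y (free_power R q)) (direct_sum_module X (free_power R p))"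
    "\<And>x. x \<in> carrier (direct_sum_module X (free_power R p)) \<Longrightarrow> g (f x) = x"
    "\<And>y. y \<in> carrier (direct_sum_module Y (free_power R q)) \<Longrightarrow> f (g y) = y"
    by (rule isomorphic_modulesE[OF iso D]) (rule that)
  then show "stable_retract R X Y" "stable_retract R Y X"
    using stable_retract_if_mutually_inverse X Y by blast+
qed

section \<open>Reflexive ideals\<close>

context noetherian_local_ring
begin

lemma reflexive_dual_functional:
  assumes refl: "reflexive_module R X" and X: "module R X"
    and g: "g \<in> module_hom R (dual_module R X) (ring_module R)"
  obtains x where "x \<in> carrier X" "\<And>f. f \<in> carrier (dual_module R X) \<Longrightarrow> g f = f x"
proof -
  have "restrict g (carrier (dual_module R X)) \<in> carrier (dual_module R (dual_module R X))"
    using restrict_module_hom[OF g dual_module_module[OF X]] by (simp add: dual_module_def)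
  then have "restrict g (carrier (dual_module R X)) \<in> bidual_map R X ` carrier X"
    using refl by (auto simp: reflexive_module_def module_iso_def bij_betw_def)
  then obtain x where x: "x \<in> carrier X" "restrict g (carrier (dual_module R X)) = bidual_map R X x"
    by blast
  have "g f = f x" if "f \<in> carrier (dual_module R X)" for f
    using fun_cong[OF x(2), of f] that by (simp add: bidual_map_def)
  with x(1) show ?thesis by (rule that)
qed

lemma dual_ideal_scalar:
  assumes I: "ideal I R"
  shows "(\<lambda>r. \<lambda>x \<in> I. r \<otimes> x) \<in> module_hom R (ring_module R) (dual_module R (ideal_module R I))"
    (is "?\<pi> \<in> _")
proof -
  note Ic = ideal.Icarr[OF I]
  have "?\<pi> r \<in> module_hom R (ideal_module R I) (ring_module R)" if r: "r \<in> carrier R" for r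
  proof (rule module_homI)
    fix x assume x: "x \<in> carrier (ideal_module R I)"
    then show "?\<pi> r x \<in> carrier (ring_module R)" using r Ic by simp
    show "?\<pi> r (a \<odot>\<^bsub>ideal_module R I\<^esub> x) = a \<odot>\<^bsub>ring_module R\<^esub> ?\<pi> r x" if a: "a \<in> carrier R" for a
      using x r a Ic ideal.I_l_closed[OF I _ a] by (simp add: m_lcomm)
    fix y assume "y \<in> carrier (ideal_module R I)"
    then show "?\<pi> r (x \<oplus>\<^bsub>ideal_module R I\<^esub> y) = ?\<pi> r x \<oplus>\<^bsub>ring_module R\<^esub> ?\<pi> r y"
      using x r Ic ideal_add[OF I] by (simp add: r_distr)
  qed
  then show ?thesis
    using Ic by (intro module_homI) (auto simp: dual_module_def l_distr m_assoc intro!: ext)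
qed

text \<open>By reflexivity every functional on \<open>I\<^sup>*\<close> is evaluation at a point of \<open>I\<close>, so one that kills
  the inclusion \<open>I \<rightarrow> R\<close> is zero; hence the inclusion generates \<open>I\<^sup>*\<close>.\<close>

lemma dual_reflexive_ideal:
  assumes z: "socle_element z" and I: "ideal I R" and refl: "reflexive_module R (ideal_module R I)"
  shows "(\<lambda>r. \<lambda>x \<in> I. r \<otimes> x) ` carrier R = carrier (dual_module R (ideal_module R I))"
    (is "?\<pi> ` _ = carrier ?D")
proof (rule ccontr)
  assume neg: "\<not> ?thesis"
  note Ic = ideal.Icarr[OF I] and Im = ideal_module_module[OF I]
  note D = dual_module_module[OF Im]
  obtain n p where "presentation R n p (ideal_module R I)" using ideal_presentation[OF I] by blast
  then obtain m q where q: "presentation R m q ?D" using dual_presentation by blast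
  have N: "submodule (?\<pi> ` carrier R) R ?D"
    using submodule_image[OF dual_ideal_scalar[OF I] ring_module_module D]
      module.carrier_is_submodule[OF ring_module_module] by simp
  obtain g where g: "g \<in> module_hom R ?D (ring_module R)" "\<And>f. f \<in> ?\<pi> ` carrier R \<Longrightarrow> g f = \<zero>"
    "\<exists>f \<in> carrier ?D. g f \<noteq> \<zero>"
    by (rule socle_functional[OF z q N neg]) (rule that)
  obtain x where x: "x \<in> carrier (ideal_module R I)" "\<And>f. f \<in> carrier ?D \<Longrightarrow> g f = f x"
    using reflexive_dual_functional[OF refl Im g(1)] by blast
  \<comment> \<open>\<open>?\<pi> \<one>\<close> is the inclusion of \<open>I\<close> into
    \<open>R\<close>. As \<open>g\<close> kills it and is evaluation at \<open>x\<close>, the point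
    \<open>x\<close> itself is zero.\<close>
  have "?\<pi> \<one> \<in> carrier ?D" using module_hom_closed[OF dual_ideal_scalar[OF I], of \<one>] by simp
  then have "?\<pi> \<one> x = \<zero>" using g(2)[of "?\<pi> \<one>"] x(2)[of "?\<pi> \<one>"] by auto
  then have x0: "x = \<zero>" using x(1) Ic by simp
  have "g f = \<zero>" if f: "f \<in> carrier ?D" for f
  proof -
    have f': "f \<in> module_hom R (ideal_module R I) (ring_module R)" using f by (simp add: dual_module_def)
    have "f \<zero>\<^bsub>ideal_module R I\<^esub> = \<zero>\<^bsub>ring_module R\<^esub>"
      by (rule module_hom_zero[OF f' Im ring_module_module])
    then show ?thesis using x(2)[OF f] x0 by simp
  qed
  then show False using g(3) by blast
qed

lemma socle_functional_ideal:
  assumes z: "socle_element z" and I: "ideal I R" "I \<noteq> {\<zero>}"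
  obtains g where "g \<in> module_hom R (ideal_module R I) (ring_module R)"
    "\<exists>x \<in> I. g x \<noteq> \<zero>" "\<And>x. x \<in> I \<Longrightarrow> \<exists>r \<in> carrier R. g x = r \<otimes> z"
proof -
  obtain n p where p: "presentation R n p (ideal_module R I)" using ideal_presentation[OF I(1)] by blast
  have s: "submodule {\<zero>} R (ideal_module R I)"
    by (rule submoduleI'[OF ideal_module_module[OF I(1)]])
      (use ideal_zero[OF I(1)] in auto)
  have ne: "{\<zero>} \<noteq> carrier (ideal_module R I)" using I(2) by simp
  show ?thesis
    by (rule socle_functional[OF z p s ne]) (rule that, simp_all)
qed

text \<open>With \<open>A = ann I\<close>, a proper \<open>I = ann A\<close> forces \<open>A\<close>
  to be nonzero, so there is a nonzero map \<open>g\<close> from \<open>A\<close> to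
  \<open>R z\<close>. As the dual of \<open>I\<close> is \<open>R\<close> modulo \<open>A\<close>,
  vanishing of its Ext into \<open>R\<close> extends \<open>g\<close> to \<open>R\<close>, that is,
  to multiplication by some \<open>y\<close>. Since \<open>g\<close> is nonzero, \<open>y\<close>
  does not annihilate \<open>A\<close>; since the maximal ideal kills \<open>z\<close>, its
  multiples of \<open>y\<close> do.\<close>

lemma colon_max_ideal:
  assumes z: "socle_element z" and I: "ideal I R" "I \<noteq> carrier R"
    and refl: "reflexive_module R (ideal_module R I)"
    and ext: "ext1_zero R (dual_module R (ideal_module R I)) (ring_module R)"
  obtains y where "y \<in> carrier R" "y \<notin> I" "\<And>b. b \<in> \<mm> \<Longrightarrow> b \<otimes> y \<in> I"
proof -
  let ?D = "dual_module R (ideal_module R I)" and ?\<pi> = "\<lambda>r. \<lambda>x \<in> I. r \<otimes> x"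
  note Ic = ideal.Icarr[OF I(1)] and Im = ideal_module_module[OF I(1)]
  note D = dual_module_module[OF Im] and \<pi> = dual_ideal_scalar[OF I(1)]
  have \<pi>s: "?\<pi> ` carrier (ring_module R) = carrier ?D"
    using dual_reflexive_ideal[OF z I(1) refl] by simp
  define A where "A = {a \<in> carrier R. \<forall>x \<in> I. a \<otimes> x = \<zero>}"
  have "submodule A R (ring_module R)"
    by (rule submoduleI'[OF ring_module_module]) (use Ic in \<open>auto simp: A_def l_distr m_assoc\<close>)
  then have A: "ideal A R" by (simp add: submodule_ring_module_iff)
  have \<pi>0: "?\<pi> r = \<zero>\<^bsub>?D\<^esub> \<longleftrightarrow> r \<in> A" if "r \<in> carrier R" for r
    using that by (auto simp: A_def dual_module_def fun_eq_iff)
  \<comment> \<open>If \<open>A\<close> kills \<open>w\<close>, then multiplication by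
    \<open>w\<close> descends to a functional on the dual of \<open>I\<close>. By reflexivity it is
    evaluation at some point of \<open>I\<close>, and evaluating on the inclusion identifies this
    point as \<open>w\<close>.\<close>
  have annA: "w \<in> I" if w: "w \<in> carrier R" "\<And>a. a \<in> A \<Longrightarrow> a \<otimes> w = \<zero>" for w
  proof -
    have h: "(\<lambda>r. r \<otimes> w) \<in> module_hom R (ring_module R) (ring_module R)"
      using w(1) by (intro module_homI) (auto simp: l_distr m_assoc)
    obtain g where g: "g \<in> module_hom R ?D (ring_module R)"
      "\<And>r. r \<in> carrier (ring_module R) \<Longrightarrow> g (?\<pi> r) = r \<otimes> w"
      by (rule module_hom_factor[OF \<pi> \<pi>s h ring_module_module D ring_module_module])
        (use \<pi>0 w(2) in auto)
    obtain x where x: "x \<in> carrier (ideal_module R I)" "\<And>f. f \<in> carrier ?D \<Longrightarrow> g f = f x"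
      using reflexive_dual_functional[OF refl Im g(1)] by blast
    have "?\<pi> \<one> \<in> carrier ?D" using module_hom_closed[OF \<pi>, of \<one>] by simp
    then have "?\<pi> \<one> x = \<one> \<otimes> w" using g(2)[of \<one>] x(2)[of "?\<pi> \<one>"] by simp
    then show ?thesis using x(1) w(1) Ic by simp
  qed
  have A0: "A \<noteq> {\<zero>}"
  proof
    assume "A = {\<zero>}"
    then have "carrier R \<subseteq> I" using annA by auto
    then show False using I(2) Ic by blast
  qed
  obtain g where g: "g \<in> module_hom R (ideal_module R A) (ring_module R)"
    "\<exists>x \<in> A. g x \<noteq> \<zero>" "\<And>x. x \<in> A \<Longrightarrow> \<exists>r \<in> carrier R. g x = r \<otimes> z"
    by (rule socle_functional_ideal[OF z A A0]) (rule that)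
  \<comment> \<open>\<open>presentation\<close> asks for a free power, so \<open>R\<close> is
    replaced by vectors of length one, read through coordinate \<open>0\<close>.\<close>
  let ?F = "free_power R 1"
  have c0: "(\<lambda>v. v 0) \<in> module_hom R ?F (ring_module R)" by (rule coordinate_hom) simp
  have vec: "(\<lambda>i \<in> {..<1::nat}. a) \<in> carrier ?F" if "a \<in> carrier R" for a
    using that by (auto simp: free_power_simps)
  have c0s: "(\<lambda>v. v 0) ` carrier ?F = carrier (ring_module R)"
  proof
    show "(\<lambda>v. v 0) ` carrier ?F \<subseteq> carrier (ring_module R)" using module_hom_closed[OF c0] by blast
    show "carrier (ring_module R) \<subseteq> (\<lambda>v. v 0) ` carrier ?F"
    proof
      fix a assume "a \<in> carrier (ring_module R)"
      then show "a \<in> (\<lambda>v. v 0) ` carrier ?F"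
        using vec[of a] by (intro image_eqI[of _ _ "\<lambda>i \<in> {..<1::nat}. a"]) auto
    qed
  qed
  let ?q = "\<lambda>v. ?\<pi> (v 0)"
  have "?q ` carrier ?F = ?\<pi> ` ((\<lambda>v. v 0) ` carrier ?F)" by (rule image_image[symmetric])
  then have q: "presentation R 1 ?q ?D"
    using module_hom_comp[OF c0 \<pi>] D \<pi>s c0s by (simp add: presentation_def)
  have qK: "v 0 \<in> A" if "v \<in> a_kernel ?F ?D ?q" for v
    using that module_hom_closed[OF c0] \<pi>0 by (auto simp: a_kernel_iff)
  have gq: "(\<lambda>v. g (v 0)) \<in> module_hom R (kernel_module R 1 ?q ?D) (ring_module R)"
  proof (rule module_hom_comp[OF _ g(1)])
    have "(\<lambda>v. v 0) \<in> module_hom R (kernel_module R 1 ?q ?D) ((ring_module R)\<lparr>carrier := A\<rparr>)"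
      unfolding kernel_module_def using qK
      by (intro module_hom_restrict_codomain module_hom_restrict_domain c0 a_kernel_subset) auto
    then show "(\<lambda>v. v 0) \<in> module_hom R (kernel_module R 1 ?q ?D) (ideal_module R A)"
      by (subst ideal_module_eq)
  qed
  obtain h where h: "h \<in> module_hom R ?F (ring_module R)"
    "\<And>v. v \<in> a_kernel ?F ?D ?q \<Longrightarrow> h v = g (v 0)"
    using ext1_zeroE[OF ext q ring_module_module gq] by blast
  define y where "y = h (unit_vec 1 0)"
  have y: "y \<in> carrier R" unfolding y_def using module_hom_closed[OF h(1) unit_vec_closed] by simp
  have gy: "g a = a \<otimes> y" if a: "a \<in> A" for a
  proof -
    let ?v = "\<lambda>i \<in> {..<1::nat}. a"
    have ac: "a \<in> carrier R" using a by (simp add: A_def)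
    have "?v \<in> a_kernel ?F ?D ?q" using vec[OF ac] \<pi>0[OF ac] a by (simp add: a_kernel_iff)
    then have "g a = h ?v" using h(2) by simp
    also have "\<dots> = a \<otimes> y"
      using hom_free_power_eq[OF h(1) ring_module_module vec[OF ac]] ac y by (simp add: y_def)
    finally show ?thesis .
  qed
  have "y \<notin> I" using g(2) gy by (auto simp: A_def)
  moreover have "b \<otimes> y \<in> I" if b: "b \<in> \<mm>" for b
  proof (rule annA)
    have bc: "b \<in> carrier R" using b by (rule max_ideal_closed)
    then show "b \<otimes> y \<in> carrier R" using y by simp
    fix a assume a: "a \<in> A"
    then have ac: "a \<in> carrier R" by (simp add: A_def)
    obtain r where r: "r \<in> carrier R" "g a = r \<otimes> z" using g(3)[OF a] by blast
    have "a \<otimes> (b \<otimes> y) = b \<otimes> (r \<otimes> z)" using gy[OF a] r(2) ac bc y by (simp add: m_lcomm[of a b])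
    also have "\<dots> = r \<otimes> (b \<otimes> z)" using r(1) bc z by (simp add: m_lcomm socle_element_def)
    also have "\<dots> = \<zero>" using z b r(1) by (simp add: socle_element_def)
    finally show "a \<otimes> (b \<otimes> y) = \<zero>" .
  qed
  ultimately show ?thesis using y by (intro that)
qed

text \<open>The map from \<open>I\<close> to \<open>R/I\<close> induced by \<open>g\<close> and
  \<open>y\<close> is handled on the free cover of \<open>I\<close>. If
  \<open>g (p w) = s w z\<close>, it is represented by \<open>\<tau> w = s w y\<close>. Rigidity
  corrects \<open>\<tau>\<close> by a map \<open>\<sigma>\<close> into \<open>I\<close> so that the
  difference descends to a map from \<open>I\<close> to \<open>R\<close>. That map is multiplication
  by an element and so preserves \<open>I\<close>; therefore \<open>\<tau>\<close> has all its
  values in \<open>I\<close>, which is incompatible with \<open>g\<close> being nonzero.\<close>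

lemma trivial_ideal_if_rigid:
  assumes z: "socle_element z" and I: "ideal I R" and refl: "reflexive_module R (ideal_module R I)"
    and ext: "ext1_zero R (dual_module R (ideal_module R I)) (ring_module R)"
    and rigid: "ext1_zero R (ideal_module R I) (ideal_module R I)"
  shows "I = {\<zero>} \<or> I = carrier R"
proof (rule ccontr)
  assume "\<not> ?thesis"
  then have I0: "I \<noteq> {\<zero>}" "I \<noteq> carrier R" by auto
  note Ic = ideal.Icarr[OF I] and Im = ideal_module_module[OF I]
  have za: "z \<in> carrier R" "z \<noteq> \<zero>" using z by (auto simp: socle_element_def)
  obtain y where y: "y \<in> carrier R" "y \<notin> I" "\<And>b. b \<in> \<mm> \<Longrightarrow> b \<otimes> y \<in> I"
    using colon_max_ideal[OF z I I0(2) refl ext] by blast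
  obtain n p where pI: "presentation R n p (ideal_module R I)" using ideal_presentation[OF I] by blast
  note p = presentationD[OF pI]
  let ?F = "free_power R n" and ?I = "ideal_module R I"
  obtain g where g: "g \<in> module_hom R (ideal_module R I) (ring_module R)"
    "\<exists>x \<in> I. g x \<noteq> \<zero>" "\<And>x. x \<in> I \<Longrightarrow> \<exists>r \<in> carrier R. g x = r \<otimes> z"
    by (rule socle_functional_ideal[OF z I I0(1)]) (rule that)
  have "\<exists>r \<in> carrier R. g (p (unit_vec n i)) = r \<otimes> z" for i
    using g(3) module_hom_closed[OF p(2) unit_vec_closed] by simp
  then obtain r where r: "\<And>i. r i \<in> carrier R" "\<And>i. g (p (unit_vec n i)) = r i \<otimes> z" by metis
  \<comment> \<open>The coefficients \<open>r i\<close> of \<open>g\<close> on the generators are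
    chosen, so \<open>s\<close> is a homomorphism on the cover but need not descend to
    \<open>I\<close>.\<close>
  define s where "s = (\<lambda>w. lincomb (ring_module R) w r n)"
  have s: "s \<in> module_hom R ?F (ring_module R)"
    unfolding s_def using r(1) by (intro hom_from_free_power ring_module_module) simp
  have sc: "s w \<in> carrier R" if "w \<in> carrier ?F" for w using module_hom_closed[OF s that] by simp
  have scale: "(\<lambda>w. w \<otimes> c) \<in> module_hom R (ring_module R) (ring_module R)" if "c \<in> carrier R" for c
    using that by (intro module_homI) (auto simp: l_distr m_assoc)
  have sz: "g (p w) = s w \<otimes> z" if w: "w \<in> carrier ?F" for w
  proof -
    have "s w \<otimes> z = lincomb (ring_module R) w (\<lambda>i. r i \<otimes> z) n"
      unfolding s_def using r(1) w
      by (intro lincomb_hom[OF scale[OF za(1)] ring_module_module ring_module_module]) (auto simp: free_power_simps)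
    then show ?thesis
      using hom_free_power_eq[OF module_hom_comp[OF p(2) g(1)] ring_module_module w] by (simp add: r(2))
  qed
  define \<tau> where "\<tau> w = s w \<otimes> y" for w
  have \<tau>: "\<tau> \<in> module_hom R ?F (ring_module R)"
    unfolding \<tau>_def by (rule module_hom_comp[OF s scale[OF y(1)]])
  \<comment> \<open>On a relation \<open>s w\<close> kills \<open>z\<close>, so it lies in the
    maximal ideal, which multiplies \<open>y\<close> into \<open>I\<close>.\<close>
  have \<tau>K: "\<tau> w \<in> I" if w: "w \<in> a_kernel ?F ?I p" for w
  proof -
    have wF: "w \<in> carrier ?F" "p w = \<zero>" using w by (auto simp: a_kernel_iff)
    have "s w \<otimes> z = \<zero>"
      using sz[OF wF(1)] wF(2) module_hom_zero[OF g(1) Im ring_module_module] by simp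
    then have "s w \<in> \<mm>"
      using za by (intro smult_eq_zero_in_max_ideal[OF ring_module_module sc[OF wF(1)], of z]) simp_all
    then show ?thesis unfolding \<tau>_def by (rule y(3))
  qed
  have "\<tau> \<in> module_hom R (kernel_module R n p ?I) ((ring_module R)\<lparr>carrier := I\<rparr>)"
    unfolding kernel_module_def using \<tau>K
    by (intro module_hom_restrict_codomain module_hom_restrict_domain \<tau> a_kernel_subset) auto
  then have "\<tau> \<in> module_hom R (kernel_module R n p ?I) ?I" by (subst ideal_module_eq)
  then obtain \<sigma> where \<sigma>: "\<sigma> \<in> module_hom R ?F ?I" "\<And>w. w \<in> a_kernel ?F ?I p \<Longrightarrow> \<sigma> w = \<tau> w"
    using ext1_zeroE[OF rigid pI Im] by blast
  have \<sigma>I: "\<sigma> w \<in> I" if "w \<in> carrier ?F" for w using module_hom_closed[OF \<sigma>(1) that] by simp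
  interpret RM: module R "ring_module R" by (rule ring_module_module)
  have \<sigma>': "\<sigma> \<in> module_hom R ?F (ring_module R)"
    using \<sigma>(1) Ic by (subst (asm) ideal_module_eq, elim module_hom_extend_codomain) auto
  obtain f where f: "f \<in> module_hom R ?I (ring_module R)"
    "\<And>w. w \<in> carrier ?F \<Longrightarrow> f (p w) = \<tau> w \<ominus>\<^bsub>ring_module R\<^esub> \<sigma> w"
  proof (rule module_hom_factor[OF p(2,3) module_hom_minus_fun[OF \<tau> \<sigma>' ring_module_module]
          free_power_module p(1) ring_module_module])
    fix w assume w: "w \<in> carrier ?F" "p w = \<zero>\<^bsub>?I\<^esub>"
    then have "\<sigma> w = \<tau> w" by (intro \<sigma>(2)) (simp add: a_kernel_iff)
    then show "\<tau> w \<ominus>\<^bsub>ring_module R\<^esub> \<sigma> w = \<zero>\<^bsub>ring_module R\<^esub>"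
      using RM.M.r_neg[of "\<tau> w"] module_hom_closed[OF \<tau> w(1)] by (simp only: a_minus_def)
  qed (rule that)
  have "restrict f I \<in> carrier (dual_module R ?I)"
    using restrict_module_hom[OF f(1) Im] by (simp add: dual_module_def)
  then have "restrict f I \<in> (\<lambda>r. \<lambda>x \<in> I. r \<otimes> x) ` carrier R"
    unfolding dual_reflexive_ideal[OF z I refl] .
  then obtain c where c: "c \<in> carrier R" "restrict f I = (\<lambda>x \<in> I. c \<otimes> x)" by blast
  have fc: "f x = c \<otimes> x" if "x \<in> I" for x using fun_cong[OF c(2), of x] that by simp
  have \<tau>I: "\<tau> w \<in> I" if w: "w \<in> carrier ?F" for w
  proof -
    have pw: "p w \<in> I" using module_hom_closed[OF p(2) w] by simp
    have "\<tau> w = (\<tau> w \<ominus>\<^bsub>ring_module R\<^esub> \<sigma> w) \<oplus>\<^bsub>ring_module R\<^esub> \<sigma> w"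
      using module_hom_closed[OF \<tau> w] module_hom_closed[OF \<sigma>' w]
      unfolding a_minus_def by (metis RM.M.a_assoc RM.M.a_inv_closed RM.M.l_neg RM.M.r_zero)
    also have "\<dots> = c \<otimes> p w \<oplus> \<sigma> w" using f(2)[OF w] fc[OF pw] by simp
    also have "\<dots> \<in> I"
      using ideal.I_l_closed[OF I pw c(1)] \<sigma>I[OF w] ideal_add[OF I] by blast
    finally show ?thesis .
  qed
  have "g (p w) = \<zero>" if w: "w \<in> carrier ?F" for w
  proof -
    \<comment> \<open>Were \<open>s w\<close> a unit, \<open>\<tau> w = s w y\<close> in
      \<open>I\<close> would give \<open>y\<close> in \<open>I\<close>.\<close>
    have "s w \<in> \<mm>"
    proof (rule ccontr)
      assume "s w \<notin> \<mm>"
      then obtain b where b: "b \<in> carrier R" "b \<otimes> s w = \<one>" using inverse_if_notin_max_ideal[OF sc[OF w]] by blast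
      have "b \<otimes> \<tau> w = y" unfolding \<tau>_def using b sc[OF w] y(1) by (simp flip: m_assoc)
      then show False using ideal.I_l_closed[OF I \<tau>I[OF w] b(1)] y(2) by simp
    qed
    then show ?thesis using sz[OF w] z by (simp add: socle_element_def)
  qed
  then have "g x = \<zero>" if "x \<in> I" for x using that p(3) by (metis ideal_module_simps(1) imageE)
  then show False using g(2) by blast
qed

lemma free_retract_trivial_ideal:
  assumes "I = {\<zero>} \<or> I = carrier R"
  shows "free_retract R (ideal_module R I)"
  using assms
proof
  assume I: "I = {\<zero>}"
  have Im: "module R (ideal_module R I)" unfolding I by (intro ideal_module_module zeroideal)
  show ?thesis
    unfolding free_retract_def
    by (rule exI[of _ 0], rule exI[of _ "\<lambda>_. \<zero>\<^bsub>free_power R 0\<^esub>"], rule exI[of _ "\<lambda>_. \<zero>\<^bsub>ideal_module R I\<^esub>"])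
      (use module_hom_const_zero[OF free_power_module] module_hom_const_zero[OF Im] in \<open>auto simp: I\<close>)
next
  assume I: "I = carrier R"
  have "(\<lambda>x. \<lambda>i \<in> {..<1::nat}. x) \<in> module_hom R (ring_module R) (free_power R 1)"
    by (rule tuple_hom) (rule module_hom_id)
  moreover have "(\<lambda>x. x 0) \<in> module_hom R (free_power R 1) (ring_module R)"
    by (rule coordinate_hom) simp
  ultimately show ?thesis
    unfolding free_retract_def I
    by (intro exI[of _ 1] exI[of _ "\<lambda>x. \<lambda>i \<in> {..<1::nat}. x"] exI[of _ "\<lambda>x. x 0"]) simp
qed

end

section \<open>Modules of finite length\<close>

text \<open>A chain is recorded by its top member and its number of strict inclusions; the bottom
  member is arbitrary.\<close>

inductive submodule_chain :: "('a, 'r) ring_scheme \<Rightarrow> ('a, 'b, 'm) module_scheme \<Rightarrow> 'b set \<Rightarrow> nat \<Rightarrow> bool"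
  for R X where
  base: "submodule N R X \<Longrightarrow> submodule_chain R X N 0"
| step: "submodule_chain R X N k \<Longrightarrow> N \<subset> N' \<Longrightarrow> submodule N' R X \<Longrightarrow> submodule_chain R X N' (Suc k)"

definition finite_length :: "('a, 'r) ring_scheme \<Rightarrow> ('a, 'b, 'm) module_scheme \<Rightarrow> bool" where
  "finite_length R X \<longleftrightarrow> (\<exists>n. \<forall>N k. submodule_chain R X N k \<longrightarrow> k \<le> n)"

text \<open>The \<open>Max\<close> is meaningful only under \<open>finite_length\<close>, where the
  set of chain lengths is finite.\<close>

definition module_length :: "('a, 'r) ring_scheme \<Rightarrow> ('a, 'b, 'm) module_scheme \<Rightarrow> nat" where
  "module_length R X = Max {k. \<exists>N. submodule_chain R X N k}"

lemma submodule_chain_submodule: "submodule_chain R X N k \<Longrightarrow> submodule N R X"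
  by (induction rule: submodule_chain.induct)

lemma submodule_chain_mono:
  assumes "submodule_chain R X N k" "N \<subseteq> N'" "submodule N' R X"
  shows "submodule_chain R X N' k"
  using assms
proof (cases rule: submodule_chain.cases)
  case base
  then show ?thesis using assms(3) by (simp add: submodule_chain.base)
next
  case (step N'' k')
  have "N'' \<subset> N'" using step(3) assms(2) by (rule psubset_subset_trans)
  from submodule_chain.step[OF step(2) this assms(3)] show ?thesis by (simp add: step(1))
qed

lemma submodule_chain_of_submodule:
  assumes X: "module R X" and H: "submodule H R X" and c: "submodule_chain R (X\<lparr>carrier := H\<rparr>) N k"
  shows "submodule_chain R X N k"
  using c
proof (induction rule: submodule_chain.induct)
  case (base N)
  then show ?case by (intro submodule_chain.base submodule_of_submodule[OF _ submodule_subset[OF H] X])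
next
  case (step N k N')
  then show ?case
    by (intro submodule_chain.step[of R X N k N'] submodule_of_submodule[OF _ submodule_subset[OF H] X])
qed

lemma submodule_restrict_carrier:
  assumes "module R X" "submodule H R X" "submodule N R X" "N \<subseteq> H"
  shows "submodule N R (X\<lparr>carrier := H\<rparr>)"
  using assms(4) submodule_zero[OF assms(3)] submodule_add[OF assms(3)] submodule_smult[OF assms(3)]
  by (intro submoduleI' submodule_module assms(1,2)) auto

lemma submodule_Int:
  assumes "module R X" "submodule H R X" "submodule N R X"
  shows "submodule (N \<inter> H) R X"
  using submodule_subset[OF assms(3)] submodule_zero[OF assms(3)] submodule_add[OF assms(3)]
    submodule_smult[OF assms(3)] submodule_zero[OF assms(2)] submodule_add[OF assms(2)]
    submodule_smult[OF assms(2)]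
  by (intro submoduleI' assms(1)) auto

lemma finite_length_finite:
  assumes "finite_length R X"
  shows "finite {k. \<exists>N. submodule_chain R X N k}"
proof -
  obtain n where "\<forall>N k. submodule_chain R X N k \<longrightarrow> k \<le> n"
    using assms unfolding finite_length_def by (rule exE)
  then have "{k. \<exists>N. submodule_chain R X N k} \<subseteq> {..n}" by auto
  then show ?thesis by (rule finite_subset) simp
qed

lemma chain_le_module_length:
  assumes "finite_length R X" "submodule_chain R X N k"
  shows "k \<le> module_length R X"
  unfolding module_length_def using finite_length_finite[OF assms(1)] assms(2) by (intro Max_ge) auto

lemma module_length_chain:
  assumes "finite_length R X" "module R X"
  obtains N where "submodule_chain R X N (module_length R X)"
proof -
  have "submodule_chain R X (carrier X) 0"
    by (intro submodule_chain.base module.carrier_is_submodule assms(2))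
  then have "module_length R X \<in> {k. \<exists>N. submodule_chain R X N k}"
    unfolding module_length_def using finite_length_finite[OF assms(1)] by (intro Max_in) auto
  then show ?thesis using that by auto
qed

text \<open>For the equality case: a longest chain inside a proper submodule could be prolonged by
  the whole module.\<close>

lemma submodule_length:
  assumes X: "module R X" and N: "submodule N R X" and fin: "finite_length R X"
  shows "finite_length R (X\<lparr>carrier := N\<rparr>)"
    and "module_length R (X\<lparr>carrier := N\<rparr>) = module_length R X \<Longrightarrow> N = carrier X"
proof -
  show fN: "finite_length R (X\<lparr>carrier := N\<rparr>)"
    using fin submodule_chain_of_submodule[OF X N] unfolding finite_length_def by metis
  assume eq: "module_length R (X\<lparr>carrier := N\<rparr>) = module_length R X"
  obtain H where H: "submodule_chain R (X\<lparr>carrier := N\<rparr>) H (module_length R X)"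
    using module_length_chain[OF fN submodule_module[OF N X]] eq by auto
  have "H \<subseteq> N" using submodule_subset[OF submodule_chain_submodule[OF H]] by simp
  then have c: "submodule_chain R X N (module_length R X)"
    by (rule submodule_chain_mono[OF submodule_chain_of_submodule[OF X N H] _ N])
  show "N = carrier X"
  proof (rule ccontr)
    assume "N \<noteq> carrier X"
    then have "N \<subset> carrier X" using submodule_subset[OF N] by blast
    from submodule_chain.step[OF c this module.carrier_is_submodule[OF X]]
    show False using chain_le_module_length[OF fin] by force
  qed
qed

section \<open>Additivity of length\<close>

text \<open>At every strict step from \<open>N\<close> to \<open>N'\<close> the trace on the kernel
  or the image grows. If neither did, each \<open>x\<close> in \<open>N'\<close> would share its
  image with some \<open>y\<close> in \<open>N\<close>, and \<open>x - y\<close>, lying in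
  \<open>N'\<close> and in the kernel, would lie in \<open>N\<close>.\<close>

lemma submodule_chain_split:
  assumes f: "f \<in> module_hom R X Y" and X: "module R X" and Y: "module R Y" and c: "submodule_chain R X N k"
  shows "\<exists>k1 k2. submodule_chain R (X\<lparr>carrier := a_kernel X Y f\<rparr>) (N \<inter> a_kernel X Y f) k1 \<and>
    submodule_chain R (Y\<lparr>carrier := f ` carrier X\<rparr>) (f ` N) k2 \<and> k \<le> k1 + k2"
  using c
proof (induction rule: submodule_chain.induct)
  case (base N)
  have K: "submodule (a_kernel X Y f) R X" by (rule submodule_kernel[OF f X Y])
  have I: "submodule (f ` carrier X) R Y"
    by (intro submodule_image[OF f X Y] module.carrier_is_submodule X)
  have "submodule (N \<inter> a_kernel X Y f) R (X\<lparr>carrier := a_kernel X Y f\<rparr>)"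
    by (intro submodule_restrict_carrier X K submodule_Int base) simp
  moreover have "submodule (f ` N) R (Y\<lparr>carrier := f ` carrier X\<rparr>)"
    using submodule_subset[OF base] by (intro submodule_restrict_carrier Y I submodule_image[OF f X Y] base) auto
  ultimately show ?case by (intro exI[of _ 0]) (simp add: submodule_chain.base)
next
  case (step N k N')
  let ?K = "a_kernel X Y f"
  interpret X: module R X by (rule X)
  interpret Y: module R Y by (rule Y)
  obtain k1 k2 where IH: "submodule_chain R (X\<lparr>carrier := ?K\<rparr>) (N \<inter> ?K) k1"
    "submodule_chain R (Y\<lparr>carrier := f ` carrier X\<rparr>) (f ` N) k2" "k \<le> k1 + k2"
    using step.IH by blast
  have N: "submodule N R X" by (rule submodule_chain_submodule[OF step.hyps(1)])
  have K: "submodule ?K R X" by (rule submodule_kernel[OF f X Y])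
  have I: "submodule (f ` carrier X) R Y"
    by (intro submodule_image[OF f X Y] module.carrier_is_submodule X)
  have K': "submodule (N' \<inter> ?K) R (X\<lparr>carrier := ?K\<rparr>)"
    by (intro submodule_restrict_carrier X K submodule_Int step.hyps) simp
  have I': "submodule (f ` N') R (Y\<lparr>carrier := f ` carrier X\<rparr>)"
    using submodule_subset[OF step.hyps(3)]
    by (intro submodule_restrict_carrier Y I submodule_image[OF f X Y] step.hyps) auto
  have sub: "N \<inter> ?K \<subseteq> N' \<inter> ?K" "f ` N \<subseteq> f ` N'" using step.hyps(2) by auto
  have "N \<inter> ?K \<noteq> N' \<inter> ?K \<or> f ` N \<noteq> f ` N'"
  proof (rule ccontr)
    assume "\<not> ?thesis"
    then have eq: "N \<inter> ?K = N' \<inter> ?K" "f ` N = f ` N'" by auto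
    have "N' \<subseteq> N"
    proof
      fix x assume x: "x \<in> N'"
      then have "f x \<in> f ` N" using eq(2) by simp
      then obtain y where y: "y \<in> N" "f x = f y" by auto
      have xy: "x \<in> carrier X" "y \<in> carrier X"
        using x y(1) submodule_subset[OF N] submodule_subset[OF step.hyps(3)] by auto
      have yN': "y \<in> N'" using y(1) step.hyps(2) by auto
      have "f (x \<ominus>\<^bsub>X\<^esub> y) = f y \<ominus>\<^bsub>Y\<^esub> f y" using module_hom_minus[OF f X Y xy] y(2) by simp
      also have "\<dots> = \<zero>\<^bsub>Y\<^esub>" using module_hom_closed[OF f xy(2)] by (simp add: a_minus_def Y.M.r_neg)
      finally have "x \<ominus>\<^bsub>X\<^esub> y \<in> ?K" using xy by (simp add: a_kernel_iff)
      moreover have "x \<ominus>\<^bsub>X\<^esub> y \<in> N'" by (rule submodule_minus[OF X step.hyps(3) x yN'])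
      ultimately have "x \<ominus>\<^bsub>X\<^esub> y \<in> N" using eq(1) by blast
      then have "(x \<ominus>\<^bsub>X\<^esub> y) \<oplus>\<^bsub>X\<^esub> y \<in> N" using y(1) by (rule submodule_add[OF N])
      then show "x \<in> N" using xy by (simp add: a_minus_def X.M.a_assoc X.M.l_neg)
    qed
    then show False using step.hyps(2) by auto
  qed
  then show ?case
  proof
    assume "N \<inter> ?K \<noteq> N' \<inter> ?K"
    then have "submodule_chain R (X\<lparr>carrier := ?K\<rparr>) (N' \<inter> ?K) (Suc k1)"
      using sub by (intro submodule_chain.step[OF IH(1) _ K']) auto
    moreover have "submodule_chain R (Y\<lparr>carrier := f ` carrier X\<rparr>) (f ` N') k2"
      by (rule submodule_chain_mono[OF IH(2) sub(2) I'])
    ultimately show ?thesis using IH(3) by (intro exI[of _ "Suc k1"] exI[of _ k2]) simp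
  next
    assume "f ` N \<noteq> f ` N'"
    then have "submodule_chain R (Y\<lparr>carrier := f ` carrier X\<rparr>) (f ` N') (Suc k2)"
      using sub by (intro submodule_chain.step[OF IH(2) _ I']) auto
    moreover have "submodule_chain R (X\<lparr>carrier := ?K\<rparr>) (N' \<inter> ?K) k1"
      by (rule submodule_chain_mono[OF IH(1) sub(1) K'])
    ultimately show ?thesis using IH(3) by (intro exI[of _ k1] exI[of _ "Suc k2"]) simp
  qed
qed

text \<open>The chain in the kernel is continued by the preimages of the chain in the image, all of
  which contain the kernel.\<close>

lemma submodule_chain_concat:
  assumes f: "f \<in> module_hom R X Y" and X: "module R X" and Y: "module R Y"
    and cK: "submodule_chain R (X\<lparr>carrier := a_kernel X Y f\<rparr>) K k1"
    and cI: "submodule_chain R (Y\<lparr>carrier := f ` carrier X\<rparr>) S k2"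
  shows "submodule_chain R X {x \<in> carrier X. f x \<in> S} (k1 + k2)"
proof -
  interpret X: module R X by (rule X)
  have Ker: "submodule (a_kernel X Y f) R X" by (rule submodule_kernel[OF f X Y])
  have I: "submodule (f ` carrier X) R Y"
    by (intro submodule_image[OF f X Y] module.carrier_is_submodule X)
  have pre: "submodule {x \<in> carrier X. f x \<in> S} R X"
    if S: "submodule S R (Y\<lparr>carrier := f ` carrier X\<rparr>)" for S
    using submodule_zero[OF S] submodule_add[OF S] submodule_smult[OF S] module_hom_zero[OF f X Y]
    by (intro submoduleI' X) (auto simp: module_hom_add[OF f] module_hom_smult[OF f])
  from cI show ?thesis
  proof (induction rule: submodule_chain.induct)
    case (base S)
    have "K \<subseteq> a_kernel X Y f" using submodule_subset[OF submodule_chain_submodule[OF cK]] by simp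
    then have "K \<subseteq> {x \<in> carrier X. f x \<in> S}"
      using submodule_zero[OF base] by (auto simp: a_kernel_iff)
    then show ?case
      using submodule_chain_mono[OF submodule_chain_of_submodule[OF X Ker cK] _ pre[OF base]] by simp
  next
    case (step S k S')
    have "{x \<in> carrier X. f x \<in> S} \<subset> {x \<in> carrier X. f x \<in> S'}"
    proof
      show "{x \<in> carrier X. f x \<in> S} \<subseteq> {x \<in> carrier X. f x \<in> S'}" using step.hyps(2) by auto
      obtain y where y: "y \<in> S'" "y \<notin> S" using step.hyps(2) by auto
      then obtain x where "x \<in> carrier X" "y = f x" using submodule_subset[OF step.hyps(3)] by auto
      then show "{x \<in> carrier X. f x \<in> S} \<noteq> {x \<in> carrier X. f x \<in> S'}" using y by blast
    qed
    from submodule_chain.step[OF step.IH this pre[OF step.hyps(3)]] show ?case by simp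
  qed
qed

lemma length_kernel_image:
  assumes f: "f \<in> module_hom R X Y" and X: "module R X" and Y: "module R Y"
  defines "K \<equiv> X\<lparr>carrier := a_kernel X Y f\<rparr>" and "I \<equiv> Y\<lparr>carrier := f ` carrier X\<rparr>"
  shows "finite_length R X \<longleftrightarrow> finite_length R K \<and> finite_length R I"
    and "finite_length R X \<Longrightarrow> module_length R X = module_length R K + module_length R I"
proof -
  have Km: "module R K" unfolding K_def by (intro submodule_module submodule_kernel[OF f X Y] X)
  have Im: "module R I"
    unfolding I_def by (intro submodule_module submodule_image[OF f X Y] module.carrier_is_submodule X Y)
  note split = submodule_chain_split[OF f X Y, folded K_def I_def]
  note concat = submodule_chain_concat[OF f X Y, folded K_def I_def]
  have triv: "submodule_chain R K (carrier K) 0" "submodule_chain R I (carrier I) 0"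
    by (intro submodule_chain.base module.carrier_is_submodule Km Im)+
  show iff: "finite_length R X \<longleftrightarrow> finite_length R K \<and> finite_length R I"
  proof
    assume "finite_length R X"
    then obtain n where n: "\<And>N k. submodule_chain R X N k \<Longrightarrow> k \<le> n" unfolding finite_length_def by blast
    have "k \<le> n" if "submodule_chain R K N k" for N k using n[OF concat[OF that triv(2)]] by simp
    moreover have "k \<le> n" if "submodule_chain R I N k" for N k using n[OF concat[OF triv(1) that]] by simp
    ultimately show "finite_length R K \<and> finite_length R I" unfolding finite_length_def by blast
  next
    assume "finite_length R K \<and> finite_length R I"
    then obtain n m where n: "\<And>N k. submodule_chain R K N k \<Longrightarrow> k \<le> n"
      and m: "\<And>N k. submodule_chain R I N k \<Longrightarrow> k \<le> m" unfolding finite_length_def by blast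
    have "k \<le> n + m" if c: "submodule_chain R X N k" for N k
    proof -
      obtain k1 k2 where k: "submodule_chain R K (N \<inter> a_kernel X Y f) k1"
        "submodule_chain R I (f ` N) k2" "k \<le> k1 + k2" using split[OF c] by blast
      then show ?thesis using n[OF k(1)] m[OF k(2)] by simp
    qed
    then show "finite_length R X" unfolding finite_length_def by blast
  qed
  assume fin: "finite_length R X"
  then have fK: "finite_length R K" and fI: "finite_length R I" using iff by auto
  obtain N where N: "submodule_chain R X N (module_length R X)" using module_length_chain[OF fin X] .
  obtain N1 where N1: "submodule_chain R K N1 (module_length R K)" using module_length_chain[OF fK Km] .
  obtain N2 where N2: "submodule_chain R I N2 (module_length R I)" using module_length_chain[OF fI Im] .
  have "module_length R K + module_length R I \<le> module_length R X"
    by (rule chain_le_module_length[OF fin concat[OF N1 N2]])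
  moreover obtain k1 k2 where k: "submodule_chain R K (N \<inter> a_kernel X Y f) k1"
    "submodule_chain R I (f ` N) k2" "module_length R X \<le> k1 + k2" using split[OF N] by blast
  ultimately show "module_length R X = module_length R K + module_length R I"
    using chain_le_module_length[OF fK k(1)] chain_le_module_length[OF fI k(2)] by simp
qed

lemma zero_module_length:
  assumes "carrier X = {\<zero>\<^bsub>X\<^esub>}" "module R X"
  shows "finite_length R X" "module_length R X = 0"
proof -
  have N0: "N = {\<zero>\<^bsub>X\<^esub>}" if "submodule N R X" for N
    using submodule_zero[OF that] submodule_subset[OF that] assms(1) by auto
  have k0: "k = 0" if "submodule_chain R X N k" for N k
    using that
  proof (cases rule: submodule_chain.cases)
    case (step N' k')
    then show ?thesis using N0[OF submodule_chain_submodule[OF step(2)]] N0[OF step(4)] by simp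
  qed simp
  show fin: "finite_length R X" unfolding finite_length_def using k0 by auto
  obtain N where "submodule_chain R X N (module_length R X)" using module_length_chain[OF fin assms(2)] .
  then show "module_length R X = 0" by (rule k0)
qed

lemma length_injective:
  assumes f: "f \<in> module_hom R X Y" and X: "module R X" and Y: "module R Y"
    and inj: "\<And>x. x \<in> carrier X \<Longrightarrow> f x = \<zero>\<^bsub>Y\<^esub> \<Longrightarrow> x = \<zero>\<^bsub>X\<^esub>"
  shows "finite_length R X \<longleftrightarrow> finite_length R (Y\<lparr>carrier := f ` carrier X\<rparr>)"
    and "finite_length R X \<Longrightarrow> module_length R X = module_length R (Y\<lparr>carrier := f ` carrier X\<rparr>)"
proof -
  let ?K = "X\<lparr>carrier := a_kernel X Y f\<rparr>"
  have "\<zero>\<^bsub>X\<^esub> \<in> a_kernel X Y f" by (rule submodule_zero[OF submodule_kernel[OF f X Y]])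
  then have K: "carrier ?K = {\<zero>\<^bsub>?K\<^esub>}" by (auto simp: a_kernel_iff dest: inj)
  have Km: "module R ?K" by (intro submodule_module submodule_kernel[OF f X Y] X)
  note z = zero_module_length[OF K Km]
  show "finite_length R X \<longleftrightarrow> finite_length R (Y\<lparr>carrier := f ` carrier X\<rparr>)"
    using length_kernel_image(1)[OF f X Y] z(1) by simp
  show "finite_length R X \<Longrightarrow> module_length R X = module_length R (Y\<lparr>carrier := f ` carrier X\<rparr>)"
    using length_kernel_image(2)[OF f X Y] z(2) by simp
qed

lemma finite_length_embedded:
  assumes "f \<in> module_hom R X Y" "module R X" "module R Y" "finite_length R Y"
    and "\<And>x. x \<in> carrier X \<Longrightarrow> f x = \<zero>\<^bsub>Y\<^esub> \<Longrightarrow> x = \<zero>\<^bsub>X\<^esub>"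
  shows "finite_length R X"
  using length_injective(1)[OF assms(1-3,5)]
    submodule_length(1)[OF assms(3) submodule_image[OF assms(1-3) module.carrier_is_submodule[OF assms(2)]] assms(4)]
  by blast

lemma length_surjective:
  assumes f: "f \<in> module_hom R X Y" "f ` carrier X = carrier Y" and X: "module R X" and Y: "module R Y"
    and fin: "finite_length R X"
  shows "finite_length R (X\<lparr>carrier := a_kernel X Y f\<rparr>)" "finite_length R Y"
    "module_length R X = module_length R (X\<lparr>carrier := a_kernel X Y f\<rparr>) + module_length R Y"
  using length_kernel_image[OF f(1) X Y] fin by (simp_all add: f(2))

lemma length_bijective:
  assumes f: "f \<in> module_hom R X Y" "f ` carrier X = carrier Y" and X: "module R X" and Y: "module R Y"
    and inj: "\<And>x. x \<in> carrier X \<Longrightarrow> f x = \<zero>\<^bsub>Y\<^esub> \<Longrightarrow> x = \<zero>\<^bsub>X\<^esub>"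
  shows "finite_length R X \<longleftrightarrow> finite_length R Y"
    and "finite_length R X \<Longrightarrow> module_length R X = module_length R Y"
  using length_injective[OF f(1) X Y inj] by (simp_all add: f(2))

lemma length_isomorphic:
  assumes "isomorphic_modules R X Y" and X: "module R X" and Y: "module R Y"
  shows "finite_length R X \<longleftrightarrow> finite_length R Y"
    and "finite_length R X \<Longrightarrow> module_length R X = module_length R Y"
proof -
  obtain f where f: "f \<in> module_hom R X Y" "bij_betw f (carrier X) (carrier Y)"
    using assms(1) by (auto simp: isomorphic_modules_def module_iso_def)
  have im: "f ` carrier X = carrier Y" using f(2) by (simp add: bij_betw_def)
  have z: "\<zero>\<^bsub>X\<^esub> \<in> carrier X" by (rule submodule_zero[OF module.carrier_is_submodule[OF X]])
  have inj: "x = \<zero>\<^bsub>X\<^esub>" if "x \<in> carrier X" "f x = \<zero>\<^bsub>Y\<^esub>" for x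
    using bij_betw_imp_inj_on[OF f(2)] that z module_hom_zero[OF f(1) X Y] by (simp add: inj_on_def)
  show "finite_length R X \<longleftrightarrow> finite_length R Y"
    and "finite_length R X \<Longrightarrow> module_length R X = module_length R Y"
    using length_bijective[OF f(1) im X Y inj] by simp_all
qed

lemma length_direct_sum:
  assumes X: "module R X" and Y: "module R Y"
  shows "finite_length R (direct_sum_module X Y) \<longleftrightarrow> finite_length R X \<and> finite_length R Y"
    and "finite_length R X \<Longrightarrow> finite_length R Y \<Longrightarrow>
      module_length R (direct_sum_module X Y) = module_length R X + module_length R Y"
proof -
  let ?D = "direct_sum_module X Y"
  note D = direct_sum_module_module[OF X Y]
  let ?K = "?D\<lparr>carrier := a_kernel ?D Y snd\<rparr>"
  have zX: "\<zero>\<^bsub>X\<^esub> \<in> carrier X" by (rule submodule_zero[OF module.carrier_is_submodule[OF X]])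
  have zY: "\<zero>\<^bsub>Y\<^esub> \<in> carrier Y" by (rule submodule_zero[OF module.carrier_is_submodule[OF Y]])
  have s: "snd ` carrier ?D = carrier Y" using zX by force
  have Km: "module R ?K" by (intro submodule_module submodule_kernel[OF snd_module_hom] D Y)
  have "fst \<in> module_hom R ?K X"
    by (intro module_hom_restrict_domain fst_module_hom a_kernel_subset)
  moreover have "fst ` carrier ?K = carrier X" using zY by (force simp: a_kernel_iff)
  moreover have "p = \<zero>\<^bsub>?K\<^esub>" if "p \<in> carrier ?K" "fst p = \<zero>\<^bsub>X\<^esub>" for p
    using that by (cases p) (simp add: a_kernel_iff)
  ultimately have K: "finite_length R ?K \<longleftrightarrow> finite_length R X"
    "finite_length R ?K \<Longrightarrow> module_length R ?K = module_length R X"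
    using length_bijective[OF _ _ Km X] by blast+
  show fin: "finite_length R ?D \<longleftrightarrow> finite_length R X \<and> finite_length R Y"
    using length_kernel_image(1)[OF snd_module_hom[of R X Y] D Y] K(1) s by simp
  show "module_length R ?D = module_length R X + module_length R Y"
    if "finite_length R X" "finite_length R Y"
    using length_kernel_image(2)[OF snd_module_hom[of R X Y] D Y] K fin s that by simp
qed

text \<open>The hypothesis \<open>max\<close> says that every submodule not inside \<open>H\<close>
  together with \<open>H\<close> spans \<open>X\<close>. Intersecting a chain with \<open>H\<close>
  then loses at most one step: for \<open>N\<close> not inside \<open>H\<close>, equal traces of
  \<open>N\<close> and \<open>N'\<close> on \<open>H\<close> force \<open>N = N'\<close>, by the
  modular law.\<close>

lemma finite_length_maximal_submodule:
  assumes X: "module R X" and H: "submodule H R X" and fin: "finite_length R (X\<lparr>carrier := H\<rparr>)"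
    and max: "\<And>N x. submodule N R X \<Longrightarrow> \<not> N \<subseteq> H \<Longrightarrow> x \<in> carrier X \<Longrightarrow> \<exists>n \<in> N. \<exists>h \<in> H. x = n \<oplus>\<^bsub>X\<^esub> h"
  shows "finite_length R X"
proof -
  interpret X: module R X by (rule X)
  let ?H = "X\<lparr>carrier := H\<rparr>"
  have HI: "submodule (N \<inter> H) R ?H" if "submodule N R X" for N
    by (intro submodule_restrict_carrier X H submodule_Int that) simp
  have "\<exists>k1. submodule_chain R ?H (N \<inter> H) k1 \<and> k \<le> k1 + (if N \<subseteq> H then 0 else 1)"
    if "submodule_chain R X N k" for N k
    using that
  proof (induction rule: submodule_chain.induct)
    case (base N)
    then show ?case using HI by (intro exI[of _ 0]) (simp add: submodule_chain.base)
  next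
    case (step N k N')
    obtain k1 where k1: "submodule_chain R ?H (N \<inter> H) k1" "k \<le> k1 + (if N \<subseteq> H then 0 else 1)"
      using step.IH by blast
    have N: "submodule N R X" by (rule submodule_chain_submodule[OF step.hyps(1)])
    have mono: "N \<inter> H \<subseteq> N' \<inter> H" using step.hyps(2) by auto
    show ?case
    proof (cases "N \<inter> H = N' \<inter> H")
      case False
      then have "submodule_chain R ?H (N' \<inter> H) (Suc k1)"
        using mono by (intro submodule_chain.step[OF k1(1) _ HI[OF step.hyps(3)]]) auto
      moreover have "N' \<subseteq> H \<Longrightarrow> N \<subseteq> H" using step.hyps(2) by auto
      ultimately show ?thesis using k1(2) by (intro exI[of _ "Suc k1"]) (auto split: if_splits)
    next
      case True
      have c: "submodule_chain R ?H (N' \<inter> H) k1" using k1(1) True by simp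
      have "\<not> N' \<subseteq> H" using True step.hyps(2) by auto
      moreover have "N \<subseteq> H"
      proof (rule ccontr)
        assume NH: "\<not> N \<subseteq> H"
        have "N' \<subseteq> N"
        proof
          fix x assume x: "x \<in> N'"
          then have xc: "x \<in> carrier X" using submodule_subset[OF step.hyps(3)] by auto
          obtain n h where nh: "n \<in> N" "h \<in> H" "x = n \<oplus>\<^bsub>X\<^esub> h" using max[OF N NH xc] by blast
          have nc: "n \<in> carrier X" "h \<in> carrier X"
            using nh submodule_subset[OF N] submodule_subset[OF H] by auto
          have "\<ominus>\<^bsub>X\<^esub> n \<oplus>\<^bsub>X\<^esub> x \<in> N'"
            using submodule_uminus[OF X N nh(1)] step.hyps(2) x by (intro submodule_add[OF step.hyps(3)]) auto
          moreover have "\<ominus>\<^bsub>X\<^esub> n \<oplus>\<^bsub>X\<^esub> x = h" unfolding nh(3) using nc by (simp add: X.M.a_assoc[symmetric] X.M.l_neg)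
          ultimately have "h \<in> N" using True nh(2) by auto
          then show "x \<in> N" unfolding nh(3) by (rule submodule_add[OF N nh(1)])
        qed
        then show False using step.hyps(2) by auto
      qed
      ultimately show ?thesis using c k1(2) by (intro exI[of _ k1]) simp
    qed
  qed
  note * = this
  obtain n where n: "\<And>N k. submodule_chain R ?H N k \<Longrightarrow> k \<le> n" using fin unfolding finite_length_def by blast
  have "k \<le> Suc n" if c: "submodule_chain R X N k" for N k
  proof -
    obtain k1 where k1: "submodule_chain R ?H (N \<inter> H) k1" "k \<le> k1 + (if N \<subseteq> H then 0 else 1)"
      using *[OF c] by blast
    show ?thesis using n[OF k1(1)] k1(2) by (auto split: if_splits)
  qed
  then show ?thesis unfolding finite_length_def by blast
qed

section \<open>Finite length of Artinian rings\<close>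

context noetherian_cring
begin

text \<open>Let \<open>J\<close> be maximal among the ideals of finite length. If \<open>J\<close>
  is proper, the descending chain condition gives an ideal \<open>I\<close> minimal among those
  strictly above \<open>J\<close>; nothing lies between them, so \<open>I\<close> has finite length
  too, against the choice of \<open>J\<close>.\<close>

lemma finite_length_ring_module:
  assumes art: "artinian_ring R"
  shows "finite_length R (ring_module R)"
proof -
  let ?S = "{I. ideal I R \<and> finite_length R (ideal_module R I)}"
  have "{\<zero>} \<in> ?S" using zeroideal zero_module_length(1)[of "ideal_module R {\<zero>}" R] ideal_module_module by simp
  then have ne: "?S \<noteq> {}" by blast
  obtain J where J: "J \<in> ?S" "\<And>I. I \<in> ?S \<Longrightarrow> J \<subseteq> I \<Longrightarrow> I = J"
    by (rule maximal_ideal_in_set[OF ne]) (use that in auto)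
  then have Ji: "ideal J R" and Jf: "finite_length R (ideal_module R J)" by auto
  have "J = carrier R"
  proof (rule ccontr)
    assume JR: "J \<noteq> carrier R"
    define T where "T = {I. ideal I R \<and> J \<subset> I}"
    have R: "carrier R \<in> T" using JR oneideal ideal.Icarr[OF Ji] by (auto simp: T_def)
    have "\<exists>I \<in> T. \<forall>I' \<in> T. \<not> I' \<subset> I"
    proof (rule ccontr)
      assume neg: "\<not> ?thesis"
      have "\<exists>f. \<forall>n::nat. f n \<in> T \<and> f (Suc n) \<subset> f n"
      proof (rule dependent_nat_choice)
        show "\<exists>I. I \<in> T" using R by (rule exI)
        show "\<exists>I'. I' \<in> T \<and> I' \<subset> I" if "I \<in> T" for I and n :: nat using neg that by blast
      qed
      then obtain f where f: "\<forall>n::nat. f n \<in> T \<and> f (Suc n) \<subset> f n" by (rule exE)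
      have "ideal (f n) R" "f (Suc n) \<subseteq> f n" for n using f[rule_format, of n] by (auto simp: T_def)
      then have p: "(\<forall>n. ideal (f n) R) \<and> (\<forall>n. f (Suc n) \<subseteq> f n)" by (intro conjI allI)
      have "(\<forall>n. ideal (f n) R) \<and> (\<forall>n. f (Suc n) \<subseteq> f n) \<longrightarrow> (\<exists>N. \<forall>n\<ge>N. f n = f N)"
        using art unfolding artinian_ring_def by (elim conjE) (erule spec[where x = f])
      from mp[OF this p] obtain N where N: "\<forall>n\<ge>N. f n = f N" by (rule exE)
      have "f (Suc N) = f N" by (rule N[rule_format]) simp
      then show False using f[rule_format, of N] by simp
    qed
    then obtain I where IT: "I \<in> T" "\<forall>I' \<in> T. \<not> I' \<subset> I" by (rule bexE)
    have I: "ideal I R" "J \<subset> I" "\<And>I'. ideal I' R \<Longrightarrow> J \<subset> I' \<Longrightarrow> \<not> I' \<subset> I"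
      using IT unfolding T_def by blast+
    let ?I = "ideal_module R I"
    have Im: "module R ?I" by (rule ideal_module_module[OF I(1)])
    have sub: "ideal N R" if "submodule N R ?I" for N
      using submodule_of_submodule[OF that[unfolded ideal_module_eq[of I]] _ ring_module_module]
        ideal.Icarr[OF I(1)] by (auto simp: submodule_ring_module_iff)
    have JI: "submodule J R ?I"
      by (subst ideal_module_eq, rule submodule_restrict_carrier[OF ring_module_module])
        (use I Ji in \<open>auto simp: submodule_ring_module_iff\<close>)
    have "?I\<lparr>carrier := J\<rparr> = ideal_module R J" by (simp add: ideal_module_def)
    then have fin: "finite_length R (?I\<lparr>carrier := J\<rparr>)" using Jf by simp
    have "\<exists>n \<in> N. \<exists>h \<in> J. x = n \<oplus>\<^bsub>?I\<^esub> h"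
      if N: "submodule N R ?I" "\<not> N \<subseteq> J" and x: "x \<in> carrier ?I" for N x
    proof -
      have NI: "N \<subseteq> I" using submodule_subset[OF N(1)] by simp
      have Nc: "n \<in> carrier R" if "n \<in> N" for n using that ideal.Icarr[OF sub[OF N(1)]] by blast
      have s: "ideal (N <+>\<^bsub>R\<^esub> J) R" by (rule add_ideals[OF sub[OF N(1)] Ji])
      have "J \<subset> N <+>\<^bsub>R\<^esub> J"
      proof
        show "J \<subseteq> N <+>\<^bsub>R\<^esub> J"
        proof
          fix h assume "h \<in> J"
          then show "h \<in> N <+>\<^bsub>R\<^esub> J"
            unfolding set_add_def' using submodule_zero[OF N(1)] ideal.Icarr[OF Ji]
            by (intro UN_I[of \<zero>] UN_I[of h]) auto
        qed
        obtain n where n: "n \<in> N" "n \<notin> J" using N(2) by auto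
        have "n \<in> N <+>\<^bsub>R\<^esub> J"
          unfolding set_add_def' using n(1) Nc ideal_zero[OF Ji]
          by (intro UN_I[of n] UN_I[of \<zero>]) auto
        then show "J \<noteq> N <+>\<^bsub>R\<^esub> J" using n(2) by auto
      qed
      then have "\<not> N <+>\<^bsub>R\<^esub> J \<subset> I" by (rule I(3)[OF s])
      moreover have "N <+>\<^bsub>R\<^esub> J \<subseteq> I"
        using NI I(2) ideal_add[OF I(1)] by (auto simp: set_add_def')
      ultimately have "x \<in> N <+>\<^bsub>R\<^esub> J" using x by auto
      then show ?thesis by (auto simp: set_add_def')
    qed
    then have "finite_length R ?I" by (rule finite_length_maximal_submodule[OF Im JI fin])
    then have "I = J" using J(2)[of I] I by auto
    then show False using I(2) by simp
  qed
  then show ?thesis using Jf by simp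
qed

end

section \<open>Lengths of free powers and of modules of homomorphisms\<close>

context cring
begin

lemma precompose_hom:
  assumes a: "a \<in> module_hom R X Y" and X: "module R X" and M: "module R M"
  shows "(\<lambda>f. \<lambda>x \<in> carrier X. f (a x)) \<in> module_hom R (hom_module R Y M) (hom_module R X M)"
proof (rule module_homI)
  interpret X: module R X by (rule X)
  note ac = module_hom_closed[OF a]
  fix f assume f: "f \<in> carrier (hom_module R Y M)"
  then have f': "f \<in> module_hom R Y M" by simp
  show "(\<lambda>x \<in> carrier X. f (a x)) \<in> carrier (hom_module R X M)"
    using restrict_module_hom[OF module_hom_comp[OF a f'] X] by simp
  show "(\<lambda>x \<in> carrier X. (c \<odot>\<^bsub>hom_module R Y M\<^esub> f) (a x)) =
      c \<odot>\<^bsub>hom_module R X M\<^esub> (\<lambda>x \<in> carrier X. f (a x))" for c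
    using ac by (auto simp: restrict_def intro!: ext)
  fix g assume g: "g \<in> carrier (hom_module R Y M)"
  show "(\<lambda>x \<in> carrier X. (f \<oplus>\<^bsub>hom_module R Y M\<^esub> g) (a x)) =
      (\<lambda>x \<in> carrier X. f (a x)) \<oplus>\<^bsub>hom_module R X M\<^esub> (\<lambda>x \<in> carrier X. g (a x))"
    using ac by (auto simp: restrict_def intro!: ext)
qed

lemma pair_hom:
  assumes "f \<in> module_hom R X Y" "g \<in> module_hom R X Z"
  shows "(\<lambda>x. (f x, g x)) \<in> module_hom R X (direct_sum_module Y Z)"
  using module_hom_closed[OF assms(1)] module_hom_closed[OF assms(2)]
  by (intro module_homI)
    (auto simp: module_hom_add[OF assms(1)] module_hom_add[OF assms(2)]
      module_hom_smult[OF assms(1)] module_hom_smult[OF assms(2)])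

lemma free_power_Suc_isomorphic:
  "isomorphic_modules R (free_power R (Suc n)) (direct_sum_module (free_power R n) (free_power R 1))"
proof -
  let ?f = "\<lambda>x. (\<lambda>i \<in> {..<n}. x i, \<lambda>i \<in> {..<1::nat}. x n)"
  have f: "?f \<in> module_hom R (free_power R (Suc n)) (direct_sum_module (free_power R n) (free_power R 1))"
    by (intro pair_hom tuple_hom coordinate_hom) simp_all
  let ?g = "\<lambda>p. \<lambda>i \<in> {..<Suc n}. if i < n then fst p i else snd p (0::nat)"
  let ?D = "direct_sum_module (free_power R n) (free_power R 1)"
  have c: "x i = undefined" if "x \<in> carrier (free_power R m)" "\<not> i < m" for x i m
    using that by (simp add: free_power_simps PiE_iff extensional_def)
  have gf: "?g (?f x) = x" if x: "x \<in> carrier (free_power R (Suc n))" for x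
  proof
    fix i
    consider "i < n" | "i = n" | "\<not> i < Suc n" by linarith
    then show "?g (?f x) i = x i" by cases (use c[OF x, of i] in auto)
  qed
  have fg: "?f (?g p) = p" if p: "p \<in> carrier ?D" for p
  proof (rule prod_eqI)
    have p': "fst p \<in> carrier (free_power R n)" "snd p \<in> carrier (free_power R 1)"
      using p by (simp_all add: mem_Times_iff)
    show "fst (?f (?g p)) = fst p"
    proof
      fix i show "fst (?f (?g p)) i = fst p i" using c[OF p'(1), of i] by (cases "i < n") simp_all
    qed
    show "snd (?f (?g p)) = snd p"
    proof
      fix i :: nat show "snd (?f (?g p)) i = snd p i" using c[OF p'(2), of i] by (cases "i < 1") simp_all
    qed
  qed
  have gc: "?g p \<in> carrier (free_power R (Suc n))" if p: "p \<in> carrier ?D" for p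
  proof -
    have p': "fst p \<in> carrier (free_power R n)" "snd p \<in> carrier (free_power R 1)"
      using p by (simp_all add: mem_Times_iff)
    have "fst p i \<in> carrier R" if "i < n" for i
      using module_hom_closed[OF coordinate_hom[OF that] p'(1)] by simp
    moreover have "snd p 0 \<in> carrier R"
      using module_hom_closed[OF coordinate_hom[of 0 1] p'(2)] by simp
    ultimately show ?thesis by (simp add: free_power_simps)
  qed
  have "bij_betw ?f (carrier (free_power R (Suc n))) (carrier ?D)"
  proof (rule bij_betw_byWitness[where f' = ?g])
    show "\<forall>x \<in> carrier (free_power R (Suc n)). ?g (?f x) = x" using gf by (rule ballI)
    show "\<forall>p \<in> carrier ?D. ?f (?g p) = p" using fg by (rule ballI)
    show "?f ` carrier (free_power R (Suc n)) \<subseteq> carrier ?D"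
      by (rule image_subsetI) (rule module_hom_closed[OF f])
    show "?g ` carrier ?D \<subseteq> carrier (free_power R (Suc n))"
      by (rule image_subsetI) (rule gc)
  qed
  then show ?thesis using f by (auto simp: isomorphic_modules_def module_iso_def)
qed

lemma free_power_0_carrier: "carrier (free_power R 0) = {\<zero>\<^bsub>free_power R 0\<^esub>}"
  by (auto simp: free_power_simps)

lemma length_free_power:
  assumes fin: "finite_length R (free_power R 1)"
  shows "finite_length R (free_power R n) \<and> module_length R (free_power R n) = n * module_length R (free_power R 1)"
proof (induction n)
  case 0
  then show ?case using zero_module_length[OF free_power_0_carrier free_power_module] by simp
next
  case (Suc n)
  note D = direct_sum_module_module[OF free_power_module free_power_module]
  note iso = length_isomorphic[OF free_power_Suc_isomorphic free_power_module D, of n]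
  note sum = length_direct_sum[OF free_power_module free_power_module, of n 1]
  have "finite_length R (direct_sum_module (free_power R n) (free_power R 1))"
    using sum(1) Suc fin by simp
  then have f: "finite_length R (free_power R (Suc n))" using iso(1) by simp
  have "module_length R (free_power R (Suc n)) = module_length R (free_power R n) + module_length R (free_power R 1)"
    using iso(2)[OF f] sum(2) Suc fin by simp
  then show ?case using f Suc by simp
qed

lemma length_hom_isomorphic:
  assumes iso: "isomorphic_modules R X Y" and X: "module R X" and Y: "module R Y" and M: "module R M"
  shows "finite_length R (hom_module R X M) \<longleftrightarrow> finite_length R (hom_module R Y M)"
    and "finite_length R (hom_module R X M) \<Longrightarrow>
      module_length R (hom_module R X M) = module_length R (hom_module R Y M)"
proof -
  obtain a b where ab: "a \<in> module_hom R X Y" "b \<in> module_hom R Y X"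
    "\<And>x. x \<in> carrier X \<Longrightarrow> b (a x) = x" "\<And>y. y \<in> carrier Y \<Longrightarrow> a (b y) = y"
    by (rule isomorphic_modulesE[OF iso X]) (rule that)
  let ?f = "\<lambda>f. \<lambda>y \<in> carrier Y. f (b y)" and ?g = "\<lambda>f. \<lambda>x \<in> carrier X. f (a x)"
  have f: "?f \<in> module_hom R (hom_module R X M) (hom_module R Y M)" by (rule precompose_hom[OF ab(2) Y M])
  have g: "?g \<in> module_hom R (hom_module R Y M) (hom_module R X M)" by (rule precompose_hom[OF ab(1) X M])
  have gf: "?g (?f h) = h" if "h \<in> carrier (hom_module R X M)" for h
    using that module_hom_closed[OF ab(1)] ab(3) by (auto simp: fun_eq_iff extensional_def)
  have fg: "?f (?g h) = h" if "h \<in> carrier (hom_module R Y M)" for h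
    using that module_hom_closed[OF ab(2)] ab(4) by (auto simp: fun_eq_iff extensional_def)
  have "bij_betw ?f (carrier (hom_module R X M)) (carrier (hom_module R Y M))"
  proof (rule bij_betw_byWitness[where f' = ?g])
    show "\<forall>h \<in> carrier (hom_module R X M). ?g (?f h) = h" using gf by (rule ballI)
    show "\<forall>h \<in> carrier (hom_module R Y M). ?f (?g h) = h" using fg by (rule ballI)
    show "?f ` carrier (hom_module R X M) \<subseteq> carrier (hom_module R Y M)"
      by (rule image_subsetI) (rule module_hom_closed[OF f])
    show "?g ` carrier (hom_module R Y M) \<subseteq> carrier (hom_module R X M)"
      by (rule image_subsetI) (rule module_hom_closed[OF g])
  qed
  then have "isomorphic_modules R (hom_module R X M) (hom_module R Y M)"
    using f by (auto simp: isomorphic_modules_def module_iso_def)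
  from length_isomorphic[OF this hom_module_module[OF X M] hom_module_module[OF Y M]]
  show "finite_length R (hom_module R X M) \<longleftrightarrow> finite_length R (hom_module R Y M)"
    and "finite_length R (hom_module R X M) \<Longrightarrow>
      module_length R (hom_module R X M) = module_length R (hom_module R Y M)" .
qed

lemma length_hom_direct_sum:
  assumes X: "module R X" and Y: "module R Y" and M: "module R M"
  shows "finite_length R (hom_module R (direct_sum_module X Y) M) \<longleftrightarrow>
      finite_length R (hom_module R X M) \<and> finite_length R (hom_module R Y M)"
    and "finite_length R (hom_module R X M) \<Longrightarrow> finite_length R (hom_module R Y M) \<Longrightarrow>
      module_length R (hom_module R (direct_sum_module X Y) M) =
      module_length R (hom_module R X M) + module_length R (hom_module R Y M)"
proof -
  interpret X: module R X by (rule X)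
  interpret Y: module R Y by (rule Y)
  interpret M: module R M by (rule M)
  let ?D = "direct_sum_module X Y"
  note D = direct_sum_module_module[OF X Y]
  let ?f = "\<lambda>h. (\<lambda>x \<in> carrier X. h (x, \<zero>\<^bsub>Y\<^esub>), \<lambda>y \<in> carrier Y. h (\<zero>\<^bsub>X\<^esub>, y))"
  let ?g = "\<lambda>(u, v). \<lambda>p \<in> carrier ?D. u (fst p) \<oplus>\<^bsub>M\<^esub> v (snd p)"
  let ?H = "direct_sum_module (hom_module R X M) (hom_module R Y M)"
  have f: "?f \<in> module_hom R (hom_module R ?D M) ?H"
    by (intro pair_hom precompose_hom left_inclusion_module_hom right_inclusion_module_hom X Y M)
  have g: "?g p \<in> carrier (hom_module R ?D M)" if "p \<in> carrier ?H" for p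
  proof -
    obtain u v where uv: "p = (u, v)" by (cases p)
    with that have p: "p = (u, v)" "u \<in> module_hom R X M" "v \<in> module_hom R Y M" by simp_all
    have "(\<lambda>p. u (fst p) \<oplus>\<^bsub>M\<^esub> v (snd p)) \<in> module_hom R ?D M"
      by (intro module_hom_add_fun M module_hom_comp[OF fst_module_hom p(2)] module_hom_comp[OF snd_module_hom p(3)])
    then show ?thesis using restrict_module_hom[OF _ D] p(1) by simp
  qed
  have gf: "?g (?f h) = h" if h: "h \<in> carrier (hom_module R ?D M)" for h
  proof -
    have h': "h \<in> module_hom R ?D M" "h \<in> extensional (carrier X \<times> carrier Y)" using h by simp_all
    have "h (x, \<zero>\<^bsub>Y\<^esub>) \<oplus>\<^bsub>M\<^esub> h (\<zero>\<^bsub>X\<^esub>, y) = h (x, y)" if "x \<in> carrier X" "y \<in> carrier Y" for x y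
      using module_hom_add[OF h'(1), of "(x, \<zero>\<^bsub>Y\<^esub>)" "(\<zero>\<^bsub>X\<^esub>, y)"] that by simp
    then show ?thesis using h'(2) by (auto simp: fun_eq_iff extensional_def)
  qed
  have fg: "?f (?g p) = p" if p: "p \<in> carrier ?H" for p
  proof -
    obtain u v where "p = (u, v)" by (cases p)
    with p have uv: "p = (u, v)" "u \<in> module_hom R X M" "v \<in> module_hom R Y M"
      "u \<in> extensional (carrier X)" "v \<in> extensional (carrier Y)" by simp_all
    show ?thesis
      using uv module_hom_closed[OF uv(2)] module_hom_closed[OF uv(3)]
        module_hom_zero[OF uv(2) X M] module_hom_zero[OF uv(3) Y M]
      by (auto simp: fun_eq_iff extensional_def)
  qed
  have "bij_betw ?f (carrier (hom_module R ?D M)) (carrier ?H)"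
  proof (rule bij_betw_byWitness[where f' = ?g])
    show "\<forall>h \<in> carrier (hom_module R ?D M). ?g (?f h) = h" using gf by (rule ballI)
    show "\<forall>p \<in> carrier ?H. ?f (?g p) = p" using fg by (rule ballI)
    show "?f ` carrier (hom_module R ?D M) \<subseteq> carrier ?H"
      by (rule image_subsetI) (rule module_hom_closed[OF f])
    show "?g ` carrier ?H \<subseteq> carrier (hom_module R ?D M)"
      by (rule image_subsetI) (rule g)
  qed
  then have iso: "isomorphic_modules R (hom_module R ?D M) ?H"
    using f unfolding isomorphic_modules_def module_iso_def by blast
  note HX = hom_module_module[OF X M] and HY = hom_module_module[OF Y M]
  note i = length_isomorphic[OF iso hom_module_module[OF D M] direct_sum_module_module[OF HX HY]]
  note s = length_direct_sum[OF HX HY]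
  show "finite_length R (hom_module R ?D M) \<longleftrightarrow>
      finite_length R (hom_module R X M) \<and> finite_length R (hom_module R Y M)"
    using i(1) s(1) by simp
  show "module_length R (hom_module R ?D M) =
      module_length R (hom_module R X M) + module_length R (hom_module R Y M)"
    if "finite_length R (hom_module R X M)" "finite_length R (hom_module R Y M)"
    using i s that by simp
qed

lemma length_hom_free_power:
  assumes M: "module R M" and fin: "finite_length R (hom_module R (free_power R 1) M)"
  shows "finite_length R (hom_module R (free_power R n) M) \<and>
    module_length R (hom_module R (free_power R n) M) = n * module_length R (hom_module R (free_power R 1) M)"
proof (induction n)
  case 0
  have "f = (\<lambda>x \<in> carrier (free_power R 0). \<zero>\<^bsub>M\<^esub>)" if "f \<in> carrier (hom_module R (free_power R 0) M)" for f
  proof (rule extensionalityI[of _ "carrier (free_power R 0)"])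
    fix x assume "x \<in> carrier (free_power R 0)"
    then have "x = \<zero>\<^bsub>free_power R 0\<^esub>" using free_power_0_carrier by blast
    then show "f x = (\<lambda>x \<in> carrier (free_power R 0). \<zero>\<^bsub>M\<^esub>) x"
      using module_hom_zero[OF _ free_power_module M, of f 0] that \<open>x \<in> _\<close> by simp
  qed (use that in auto)
  then have "carrier (hom_module R (free_power R 0) M) = {\<zero>\<^bsub>hom_module R (free_power R 0) M\<^esub>}"
    using submodule_zero[OF module.carrier_is_submodule[OF hom_module_module[OF free_power_module M]], of 0]
    by (intro equalityI subsetI) simp_all
  from zero_module_length[OF this hom_module_module[OF free_power_module M]] show ?case by simp
next
  case (Suc n)
  note D = direct_sum_module_module[OF free_power_module free_power_module]
  note iso = length_hom_isomorphic[OF free_power_Suc_isomorphic free_power_module D M, of n]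
  note sum = length_hom_direct_sum[OF free_power_module free_power_module M, of n 1]
  have f: "finite_length R (hom_module R (free_power R (Suc n)) M)"
    using iso(1) sum(1) Suc fin by simp
  show ?case using f iso(2)[OF f] sum(2) Suc fin by simp
qed

lemma length_presentation:
  assumes pX: "presentation R n p X" and fin: "finite_length R (free_power R n)"
  shows "finite_length R (kernel_module R n p X)" "finite_length R X"
    "module_length R (free_power R n) = module_length R (kernel_module R n p X) + module_length R X"
  using length_surjective[OF presentationD(2,3)[OF pX] free_power_module presentationD(1)[OF pX] fin]
  by (simp_all add: kernel_module_def)

text \<open>Left exactness of Hom into \<open>M\<close>: the maps on the cover that vanish on
  \<open>K\<close> are those coming from \<open>X\<close>. The image \<open>I\<close> of restriction
  to \<open>K\<close> may be smaller than all of Hom from \<open>K\<close>; the gap is the first Ext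
  of \<open>X\<close> into \<open>M\<close>.\<close>

lemma length_hom_presentation:
  assumes pX: "presentation R n p X" and M: "module R M"
    and fin: "finite_length R (hom_module R (free_power R n) M)"
  defines "K \<equiv> kernel_module R n p X"
  defines "I \<equiv> (\<lambda>f. \<lambda>x \<in> carrier K. f x) ` carrier (hom_module R (free_power R n) M)"
  shows "finite_length R (hom_module R X M)" "submodule I R (hom_module R K M)"
    "module_length R (hom_module R (free_power R n) M) =
      module_length R (hom_module R X M) + module_length R ((hom_module R K M)\<lparr>carrier := I\<rparr>)"
proof -
  note p = presentationD[OF pX]
  let ?F = "free_power R n"
  have Km: "module R K" unfolding K_def by (rule kernel_module_module[OF pX])
  let ?HF = "hom_module R ?F M" and ?HX = "hom_module R X M" and ?HK = "hom_module R K M"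
  note HF = hom_module_module[OF free_power_module[of n] M] and HX = hom_module_module[OF p(1) M]
    and HK = hom_module_module[OF Km M]
  have inc: "(\<lambda>x. x) \<in> module_hom R K ?F"
    unfolding K_def kernel_module_def by (intro module_hom_restrict_domain module_hom_id a_kernel_subset)
  let ?r = "\<lambda>f. \<lambda>x \<in> carrier K. f x" and ?p = "\<lambda>f. \<lambda>x \<in> carrier ?F. f (p x)"
  have r: "?r \<in> module_hom R ?HF ?HK" by (rule precompose_hom[OF inc Km M])
  have ps: "?p \<in> module_hom R ?HX ?HF" by (rule precompose_hom[OF p(2) free_power_module M])
  show "submodule I R ?HK"
    unfolding I_def by (intro submodule_image[OF r HF HK] module.carrier_is_submodule HF)
  have inj: "f = \<zero>\<^bsub>?HX\<^esub>" if f: "f \<in> carrier ?HX" and z: "?p f = \<zero>\<^bsub>?HF\<^esub>" for f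
  proof -
    have "f y = \<zero>\<^bsub>M\<^esub>" if y: "y \<in> carrier X" for y
    proof -
      obtain x where x: "x \<in> carrier ?F" "y = p x" using y unfolding p(3)[symmetric] by blast
      then show ?thesis using fun_cong[OF z, of x] by simp
    qed
    then show ?thesis using f by (auto simp: fun_eq_iff extensional_def)
  qed
  have im: "?p ` carrier ?HX = a_kernel ?HF ?HK ?r"
  proof (intro equalityI subsetI)
    fix h assume "h \<in> ?p ` carrier ?HX"
    then obtain f where f: "f \<in> carrier ?HX" "h = ?p f" by blast
    have "f \<zero>\<^bsub>X\<^esub> = \<zero>\<^bsub>M\<^esub>" using f(1) by (intro module_hom_zero[OF _ p(1) M]) simp
    then have "?r h = \<zero>\<^bsub>?HK\<^esub>"
      unfolding f(2) by (auto simp: K_def a_kernel_iff fun_eq_iff)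
    moreover have "h \<in> carrier ?HF" unfolding f(2) by (rule module_hom_closed[OF ps f(1)])
    ultimately show "h \<in> a_kernel ?HF ?HK ?r" by (simp add: a_kernel_iff)
  next
    fix h assume "h \<in> a_kernel ?HF ?HK ?r"
    then have h: "h \<in> module_hom R ?F M" "h \<in> extensional (carrier ?F)" "?r h = \<zero>\<^bsub>?HK\<^esub>"
      by (simp_all add: a_kernel_iff)
    have hz: "h x = \<zero>\<^bsub>M\<^esub>" if "x \<in> carrier ?F" "p x = \<zero>\<^bsub>X\<^esub>" for x
      using fun_cong[OF h(3), of x] that by (simp add: K_def a_kernel_iff)
    obtain g where g: "g \<in> module_hom R X M" "\<And>x. x \<in> carrier ?F \<Longrightarrow> g (p x) = h x"
      by (rule module_hom_factor[OF p(2,3) h(1) free_power_module p(1) M hz]) (assumption+, rule that)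
    have rg: "restrict g (carrier X) \<in> carrier ?HX"
      using restrict_module_hom[OF g(1) p(1)] by simp
    have "h x = ?p (restrict g (carrier X)) x" for x
      using g(2)[of x] h(2) module_hom_closed[OF p(2), of x] by (auto simp: extensional_def)
    then have "h = ?p (restrict g (carrier X))" by (rule ext)
    then show "h \<in> ?p ` carrier ?HX" using rg by (rule image_eqI)
  qed
  note k = length_kernel_image[OF r HF HK]
  have i: "finite_length R ?HX \<longleftrightarrow> finite_length R (?HF\<lparr>carrier := ?p ` carrier ?HX\<rparr>)"
    by (rule length_injective(1)[OF ps HX HF]) (rule inj)
  have i': "module_length R ?HX = module_length R (?HF\<lparr>carrier := ?p ` carrier ?HX\<rparr>)"
    if "finite_length R ?HX"
    by (rule length_injective(2)[OF ps HX HF _ that]) (rule inj)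
  have "finite_length R (?HF\<lparr>carrier := a_kernel ?HF ?HK ?r\<rparr>)" using k(1) fin by blast
  then show fX: "finite_length R ?HX" using i im by simp
  show "module_length R ?HF = module_length R ?HX + module_length R (?HK\<lparr>carrier := I\<rparr>)"
    using k(2)[OF fin] i'[OF fX] im unfolding I_def by simp
qed

end

section \<open>Rigid periodic modules and rigid syzygies of ideals\<close>

context noetherian_local_ring
begin

text \<open>The vectors with all coordinates in the maximal ideal form a submodule containing the
  generators of \<open>\<mm> F\<close>; minimality is used in this coordinate form only.\<close>

lemma res_syzygy_carrier_max_ideal:
  assumes F: "minimal_free_resolution R X F" and x: "x \<in> carrier (res_syzygy R F k)" and i: "i < rk F k"
  shows "x i \<in> \<mm>"
proof -
  let ?F = "free_power R (rk F k)"
  let ?N = "{x \<in> carrier ?F. \<forall>i < rk F k. x i \<in> \<mm>}"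
  have m0: "\<zero> \<in> \<mm>" and ma: "a \<in> \<mm> \<Longrightarrow> b \<in> \<mm> \<Longrightarrow> a \<oplus> b \<in> \<mm>" for a b
    using ideal_zero[OF ideal_max_ideal]
      ideal_add[OF ideal_max_ideal] by blast+
  interpret P: module R ?F by (rule free_power_module)
  have N: "submodule ?N R ?F"
  proof (rule submoduleI'[OF free_power_module])
    show "\<zero>\<^bsub>?F\<^esub> \<in> ?N" using m0 P.M.zero_closed by (auto simp: free_power_simps)
    show "a \<oplus>\<^bsub>?F\<^esub> b \<in> ?N" if "a \<in> ?N" "b \<in> ?N" for a b
      using that ma P.M.add.m_closed[of a b] by (simp add: free_power_simps(3))
    show "c \<odot>\<^bsub>?F\<^esub> a \<in> ?N" if "c \<in> carrier R" "a \<in> ?N" for c a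
      using that ideal.I_l_closed[OF ideal_max_ideal] P.smult_closed[of c a] by (simp add: free_power_simps(4))
  qed blast
  have "{a \<odot>\<^bsub>?F\<^esub> y | a y. a \<in> \<mm> \<and> y \<in> carrier ?F} \<subseteq> ?N"
  proof
    fix v assume "v \<in> {a \<odot>\<^bsub>?F\<^esub> y | a y. a \<in> \<mm> \<and> y \<in> carrier ?F}"
    then obtain a y where v: "v = a \<odot>\<^bsub>?F\<^esub> y" "a \<in> \<mm>" "y \<in> carrier ?F" by blast
    have "y i \<in> carrier R" if "i < rk F k" for i
      using module_hom_closed[OF coordinate_hom[OF that] v(3)] by simp
    then have "a \<otimes> y i \<in> \<mm>" if "i < rk F k" for i
      using ideal.I_r_closed[OF ideal_max_ideal v(2)] that by simp
    then show "v \<in> ?N" using v P.smult_closed[OF max_ideal_closed[OF v(2)] v(3)] by (simp add: free_power_simps(4))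
  qed
  then have "ideal_mult_module R \<mm> ?F \<subseteq> ?N"
    unfolding ideal_mult_module_def module_span_def using N by blast
  moreover have "x \<in> ideal_mult_module R \<mm> ?F"
    using F x by (auto simp: minimal_free_resolution_def res_syzygy_def res_module_def)
  ultimately show ?thesis using i by blast
qed

text \<open>If \<open>Ext\<^sup>2(M, M)\<close> vanishes, then a stable isomorphism \<open>X \<rightarrow> M\<close> on the second syzygy
  \<open>X \<subseteq> \<mm>F\<^sub>1\<close> extends to \<open>F\<^sub>1\<close>. So the identity of \<open>X\<close> is the sum of a map that extends to
  \<open>F\<^sub>1\<close> and one that factors through a free module; as the socle kills \<open>X\<close>, both
  have image in \<open>\<mm>X\<close>, and \<open>X = 0\<close> by Nakayama.\<close>

lemma second_syzygy_zero:
  assumes z: "socle_element z" and F: "minimal_free_resolution R M F" and M: "module R M"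
    and SR: "stable_retract R (res_syzygy R F 1) M"
    and ext: "ext1_zero R (res_syzygy R F 0) M"
  shows "carrier (res_syzygy R F 1) = {\<zero>\<^bsub>res_syzygy R F 1\<^esub>}"
proof -
  let ?X = "res_syzygy R F 1" and ?F = "free_power R (rk F 1)"
  have res: "free_resolution R M F" using F by (simp add: minimal_free_resolution_def)
  note p1 = free_resolution_syzygy[OF res M, of 0] and p2 = free_resolution_syzygy[OF res M, of 1]
  have p1': "presentation R (rk F 1) (diff F 0) (res_syzygy R F 0)" using p1(1) by simp
  have K: "kernel_module R (rk F 1) (diff F 0) (res_syzygy R F 0) = ?X" using p1(2) by simp
  have X: "module R ?X" by (rule presentationD(1)[OF p2(1)])
  have Xsub: "x \<in> a_kernel ?F (res_syzygy R F 0) (diff F 0)" if "x \<in> carrier ?X" for x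
    using that K[symmetric] by simp
  have XF: "x \<in> carrier ?F" if "x \<in> carrier ?X" for x
    using Xsub[OF that] by (simp add: a_kernel_iff)
  obtain a b k u v where ab: "a \<in> module_hom R ?X M" "b \<in> module_hom R M ?X"
    and u: "u \<in> module_hom R ?X (free_power R k)" and v: "v \<in> module_hom R (free_power R k) ?X"
    and id: "\<And>x. x \<in> carrier ?X \<Longrightarrow> x = b (a x) \<oplus>\<^bsub>?X\<^esub> v (u x)"
    using SR unfolding stable_retract_def by blast
  have a': "a \<in> module_hom R (kernel_module R (rk F 1) (diff F 0) (res_syzygy R F 0)) M"
    unfolding K by (rule ab(1))
  obtain g where g: "g \<in> module_hom R ?F M"
    "\<And>x. x \<in> a_kernel ?F (res_syzygy R F 0) (diff F 0) \<Longrightarrow> g x = a x"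
    using ext1_zeroE[OF ext p1' M a'] by blast
  note h = module_hom_comp[OF g(1) ab(2)]
  have z': "z \<in> carrier R" "z \<noteq> \<zero>" "\<And>a. a \<in> \<mm> \<Longrightarrow> a \<otimes> z = \<zero>"
    using z by (auto simp: socle_element_def)
  \<comment> \<open>The coordinates of \<open>x\<close> lie in the maximal ideal, so
    \<open>z\<close> kills \<open>x\<close> and hence \<open>u x\<close>; a coordinate killing
    \<open>z\<close> is no unit.\<close>
  have um: "u x i \<in> \<mm>" if x: "x \<in> carrier ?X" and i: "i < k" for x i
  proof -
    have zx: "z \<odot>\<^bsub>?X\<^esub> x = \<zero>\<^bsub>?X\<^esub>"
    proof -
      have "z \<otimes> x j = \<zero>" if "j < rk F 1" for j
      proof -
        have xj: "x j \<in> \<mm>" using res_syzygy_carrier_max_ideal[OF F x] that by simp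
        have "z \<otimes> x j = x j \<otimes> z" using z'(1) max_ideal_closed[OF xj] by (rule m_comm)
        then show ?thesis using z'(3)[OF xj] by simp
      qed
      then show ?thesis
        by (auto simp: res_syzygy_def res_module_def free_power_simps intro!: restrict_ext)
    qed
    have ux: "u x \<in> carrier (free_power R k)" by (rule module_hom_closed[OF u x])
    have uxi: "u x i \<in> carrier R" using module_hom_closed[OF coordinate_hom[OF i] ux] by simp
    have "z \<odot>\<^bsub>free_power R k\<^esub> u x = \<zero>\<^bsub>free_power R k\<^esub>"
      using module_hom_smult[OF u z'(1) x] zx module_hom_zero[OF u X free_power_module] by simp
    from fun_cong[OF this, of i] have "z \<otimes> u x i = \<zero>" using i by (simp add: free_power_simps)
    then have "u x i \<otimes> z = \<zero>" using z'(1) uxi by (simp add: m_comm)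
    then show ?thesis
      using smult_eq_zero_in_max_ideal[OF ring_module_module uxi, of z] z' by simp
  qed
  \<comment> \<open>\<open>w y\<close> is a combination of the values of \<open>w\<close> on unit
    vectors with coefficients in the maximal ideal, so it lies in \<open>\<mm> X\<close>, on which
    \<open>\<gamma>\<close> vanishes.\<close>
  have functional: "\<gamma> (w y) = \<zero>"
    if \<gamma>: "\<gamma> \<in> module_hom R ?X (ring_module R)" and w: "w \<in> module_hom R (free_power R n) ?X"
      and ann: "\<And>a y. a \<in> \<mm> \<Longrightarrow> y \<in> carrier ?X \<Longrightarrow> a \<otimes> \<gamma> y = \<zero>"
      and y: "y \<in> carrier (free_power R n)" "\<And>i. i < n \<Longrightarrow> y i \<in> \<mm>" for \<gamma> w n y
  proof -
    have "\<gamma> (w y) = lincomb (ring_module R) y (\<lambda>i. \<gamma> (w (unit_vec n i))) n"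
      by (rule hom_free_power_eq[OF module_hom_comp[OF w \<gamma>] ring_module_module y(1)])
    also have "\<dots> = \<zero>\<^bsub>ring_module R\<^esub>"
      using ann[OF y(2) module_hom_closed[OF w unit_vec_closed]]
      by (intro lincomb_eq_zero[OF ring_module_module]) simp
    finally show ?thesis by simp
  qed
  show ?thesis
  proof (rule zero_if_generated_by_max_ideal[OF z p2(1)])
    fix \<gamma> x assume \<gamma>: "\<gamma> \<in> module_hom R ?X (ring_module R)" and x: "x \<in> carrier ?X"
      and ann: "\<And>a y. a \<in> \<mm> \<Longrightarrow> y \<in> carrier ?X \<Longrightarrow> a \<otimes> \<gamma> y = \<zero>"
    have c: "b (a x) \<in> carrier ?X" "v (u x) \<in> carrier ?X"
      by (intro module_hom_closed[OF ab(2)] module_hom_closed[OF ab(1)] module_hom_closed[OF v] module_hom_closed[OF u] x)+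
    have "\<gamma> x = \<gamma> (b (a x) \<oplus>\<^bsub>?X\<^esub> v (u x))" using id[OF x] by (rule arg_cong)
    also have "\<dots> = \<gamma> (b (a x)) \<oplus> \<gamma> (v (u x))" using module_hom_add[OF \<gamma> c] by simp
    also have "\<gamma> (b (a x)) = \<gamma> (b (g x))" using g(2)[OF Xsub[OF x]] by simp
    also have "\<dots> = \<zero>"
      by (rule functional[OF \<gamma> h ann XF[OF x] res_syzygy_carrier_max_ideal[OF F x]])
    also have "\<gamma> (v (u x)) = \<zero>"
      by (rule functional[OF \<gamma> v ann module_hom_closed[OF u x] um[OF x]])
    finally show "\<gamma> x = \<zero>" by simp
  qed
qed

text \<open>Counting lengths in \<open>Hom(-, M)\<close> of the first two steps of the resolution: as \<open>M\<close> and its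
  second syzygy have the same length up to free summands, \<open>Ext\<^sup>1(M, M) = 0\<close> forces
  \<open>Ext\<^sup>2(M, M) = 0\<close>.\<close>

lemma ext1_zero_first_syzygy:
  assumes art: "artinian_ring R" and F: "free_resolution R M F" and M: "module R M"
    and ext: "ext1_zero R M M" and stab: "stably_isomorphic R M (res_syzygy R F 1)"
  shows "ext1_zero R (res_syzygy R F 0) M"
proof -
  let ?X1 = "res_syzygy R F 0" and ?X2 = "res_syzygy R F 1" and ?P = "\<lambda>n. free_power R n"
  let ?L = "module_length R" and ?H = "\<lambda>Y. hom_module R Y M"
  note q0 = free_resolution_presentation[OF F M]
  have q1: "presentation R (rk F 1) (diff F 0) ?X1" "kernel_module R (rk F 1) (diff F 0) ?X1 = ?X2"
    using free_resolution_syzygy[OF F M, of 0] by simp_all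
  have X1: "module R ?X1" by (rule presentationD(1)[OF q1(1)])
  have X2: "module R ?X2" using kernel_module_module[OF q1(1)] q1(2) by simp
  obtain s t where iso: "isomorphic_modules R (direct_sum_module M (?P s)) (direct_sum_module ?X2 (?P t))"
    using stab by (auto simp: stably_isomorphic_def)
  note DM = direct_sum_module_module[OF M free_power_module[of s]]
    and DX = direct_sum_module_module[OF X2 free_power_module[of t]]

  have c0: "(\<lambda>x. x 0) \<in> module_hom R (?P 1) (ring_module R)" by (rule coordinate_hom) simp
  have fin1: "finite_length R (?P 1)"
  proof (rule finite_length_embedded[OF c0 free_power_module ring_module_module finite_length_ring_module[OF art]])
    fix x assume "x \<in> carrier (?P 1)" "x 0 = \<zero>\<^bsub>ring_module R\<^esub>"
    then show "x = \<zero>\<^bsub>?P 1\<^esub>" by (auto simp: free_power_simps PiE_iff extensional_def fun_eq_iff)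
  qed
  note LPf = length_free_power[OF fin1, THEN conjunct1] and LPl = length_free_power[OF fin1, THEN conjunct2]
  note l0 = length_presentation[OF q0(1) LPf, unfolded q0(2)]
  note l1 = length_presentation[OF q1(1) LPf, unfolded q1(2)]
  have fM: "finite_length R M" and fX2: "finite_length R ?X2" using l0 l1 by auto
  have fDM: "finite_length R (direct_sum_module M (?P s))"
    using length_direct_sum(1)[OF M free_power_module[of s]] fM LPf[of s] by simp
  have "?L M + ?L (?P s) = ?L (direct_sum_module M (?P s))"
    using length_direct_sum(2)[OF M free_power_module[of s]] fM LPf[of s] by simp
  also have "\<dots> = ?L (direct_sum_module ?X2 (?P t))"
    by (rule length_isomorphic(2)[OF iso DM DX fDM])
  also have "\<dots> = ?L ?X2 + ?L (?P t)"
    using length_direct_sum(2)[OF X2 free_power_module[of t]] fX2 LPf[of t] by simp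
  finally have e1: "?L M + s * ?L (?P 1) = ?L ?X2 + t * ?L (?P 1)" unfolding LPl[of s] LPl[of t] .
  have e2: "rk F 0 * ?L (?P 1) = ?L ?X1 + ?L M" "rk F 1 * ?L (?P 1) = ?L ?X2 + ?L ?X1"
    using l0(3) l1(3) unfolding LPl[of "rk F 0"] LPl[of "rk F 1"] by simp_all
  have pos: "?L (?P 1) > 0"
  proof -
    have zs: "submodule {\<zero>\<^bsub>?P 1\<^esub>} R (?P 1)"
      using submodule_zero[OF module.carrier_is_submodule[OF free_power_module[of 1]]]
      by (intro submoduleI' free_power_module) (auto simp: free_power_simps)
    have "unit_vec 1 0 \<in> carrier (?P 1)" by simp
    moreover have "unit_vec 1 0 \<noteq> \<zero>\<^bsub>?P 1\<^esub>"
    proof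
      assume "unit_vec 1 0 = \<zero>\<^bsub>?P 1\<^esub>"
      from fun_cong[OF this, of 0] have "\<one> = \<zero>" by (simp add: unit_vec_def free_power_simps)
      then show False
        using one_notin_max_ideal ideal_zero[OF ideal_max_ideal] by simp
    qed
    ultimately have "{\<zero>\<^bsub>?P 1\<^esub>} \<subset> carrier (?P 1)" using submodule_subset[OF zs] by blast
    from chain_le_module_length[OF fin1 submodule_chain.step[OF submodule_chain.base[OF zs] this
          module.carrier_is_submodule[OF free_power_module]]]
    show ?thesis by simp
  qed
  \<comment> \<open>Both sides are the length of the first syzygy plus that of the two stably
    isomorphic sums. The length of \<open>R\<close> is positive and cancels.\<close>
  have "(rk F 1 + t) * ?L (?P 1) = (rk F 0 + s) * ?L (?P 1)"
    using e1 e2 by (simp add: add_mult_distrib)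
  then have rank: "rk F 1 + t = rk F 0 + s" using pos by simp

  have ev: "(\<lambda>f. f (unit_vec 1 0)) \<in> module_hom R (?H (?P 1)) M"
    by (intro module_homI) (auto simp: module_hom_closed)
  have finH1: "finite_length R (?H (?P 1))"
  proof (rule finite_length_embedded[OF ev hom_module_module[OF free_power_module M] M fM])
    fix f assume f: "f \<in> carrier (?H (?P 1))" and z: "f (unit_vec 1 0) = \<zero>\<^bsub>M\<^esub>"
    interpret M: module R M by (rule M)
    have "f x = \<zero>\<^bsub>M\<^esub>" if x: "x \<in> carrier (?P 1)" for x
      using hom_free_power_eq[OF _ M x, of f] f z module_hom_closed[OF c0 x] by simp
    then show "f = \<zero>\<^bsub>?H (?P 1)\<^esub>" using f by (auto simp: fun_eq_iff extensional_def)
  qed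
  note HPf = length_hom_free_power[OF M finH1, THEN conjunct1]
    and HPl = length_hom_free_power[OF M finH1, THEN conjunct2]
  note h0 = length_hom_presentation[OF q0(1) M HPf, unfolded q0(2)]
  note h1 = length_hom_presentation[OF q1(1) M HPf, unfolded q1(2)]
  let ?r = "\<lambda>X f. \<lambda>x \<in> carrier X. f x"
  \<comment> \<open>Vanishing of the first Ext enters the count here: every map on the first syzygy
    is a restriction, so \<open>e3\<close> contains the full length of its Hom module, whereas
    \<open>e4\<close> contains only that of the image.\<close>
  have surj: "?r ?X1 ` carrier (?H (?P (rk F 0))) = carrier (?H ?X1)"
  proof
    show "?r ?X1 ` carrier (?H (?P (rk F 0))) \<subseteq> carrier (?H ?X1)" by (rule submodule_subset[OF h0(2)])
    show "carrier (?H ?X1) \<subseteq> ?r ?X1 ` carrier (?H (?P (rk F 0)))"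
    proof
      fix f assume f: "f \<in> carrier (?H ?X1)"
      then have f': "f \<in> module_hom R (kernel_module R (rk F 0) (aug F) M) M" unfolding q0(2) by simp
      obtain g where g: "g \<in> module_hom R (?P (rk F 0)) M"
        "\<And>x. x \<in> a_kernel (?P (rk F 0)) M (aug F) \<Longrightarrow> g x = f x"
        using ext1_zeroE[OF ext q0(1) M f'] by blast
      have K: "carrier ?X1 = a_kernel (?P (rk F 0)) M (aug F)"
        unfolding q0(2)[symmetric] by simp
      have "f = ?r ?X1 (restrict g (carrier (?P (rk F 0))))"
      proof (rule extensionalityI[of _ "carrier ?X1"])
        show "f \<in> extensional (carrier ?X1)" using f by simp
        show "f x = ?r ?X1 (restrict g (carrier (?P (rk F 0)))) x" if "x \<in> carrier ?X1" for x
          using that g(2)[of x] unfolding K by (simp add: a_kernel_iff)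
      qed simp
      moreover have "restrict g (carrier (?P (rk F 0))) \<in> carrier (?H (?P (rk F 0)))"
        using restrict_module_hom[OF g(1) free_power_module]
        by (simp only: hom_module_simps Int_iff restrict_extensional simp_thms)
      ultimately show "f \<in> ?r ?X1 ` carrier (?H (?P (rk F 0)))" by (rule image_eqI)
    qed
  qed
  have "?H ?X1\<lparr>carrier := carrier (?H ?X1)\<rparr> = ?H ?X1" by (simp del: hom_module_simps)
  then have "?L (?H (?P (rk F 0))) = ?L (?H M) + ?L (?H ?X1)" using h0(3) unfolding surj by (simp del: hom_module_simps)
  then have e3: "rk F 0 * ?L (?H (?P 1)) = ?L (?H M) + ?L (?H ?X1)" unfolding HPl[of "rk F 0"] .
  let ?I = "?r ?X2 ` carrier (?H (?P (rk F 1)))"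
  have e4: "rk F 1 * ?L (?H (?P 1)) = ?L (?H ?X1) + ?L (?H ?X2\<lparr>carrier := ?I\<rparr>)" using h1(3) unfolding HPl[of "rk F 1"] .
  have fHM: "finite_length R (?H M)" by (rule h0(1))
  have fHDM: "finite_length R (?H (direct_sum_module M (?P s)))"
    using length_hom_direct_sum(1)[OF M free_power_module[of s] M] fHM HPf[of s] by simp
  have fHX2: "finite_length R (?H ?X2)"
    using length_hom_direct_sum(1)[OF X2 free_power_module[of t] M]
      length_hom_isomorphic(1)[OF iso DM DX M] fHDM by simp
  have "?L (?H M) + ?L (?H (?P s)) = ?L (?H (direct_sum_module M (?P s)))"
    using length_hom_direct_sum(2)[OF M free_power_module[of s] M] fHM HPf[of s] by simp
  also have "\<dots> = ?L (?H (direct_sum_module ?X2 (?P t)))"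
    by (rule length_hom_isomorphic(2)[OF iso DM DX M fHDM])
  also have "\<dots> = ?L (?H ?X2) + ?L (?H (?P t))"
    using length_hom_direct_sum(2)[OF X2 free_power_module[of t] M] fHX2 HPf[of t] by simp
  finally have e5: "?L (?H M) + s * ?L (?H (?P 1)) = ?L (?H ?X2) + t * ?L (?H (?P 1))" unfolding HPl[of s] HPl[of t] .
  have "rk F 1 * ?L (?H (?P 1)) + t * ?L (?H (?P 1)) = rk F 0 * ?L (?H (?P 1)) + s * ?L (?H (?P 1))"
    using rank by (simp flip: add_mult_distrib)
  \<comment> \<open>With equal ranks \<open>rk F 1 + t = rk F 0 + s\<close>, \<open>e3\<close> and
    \<open>e4\<close> leave the length of \<open>?I\<close> plus the contribution of
    \<open>t\<close> equal to the length of Hom from \<open>M\<close> plus that of \<open>s\<close>;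
    by \<open>e5\<close> the length of \<open>?I\<close> is that of the whole Hom module of the
    second syzygy.\<close>
  then have "?L (?H ?X2\<lparr>carrier := ?I\<rparr>) = ?L (?H ?X2)" using e3 e4 e5 by simp
  then have I: "?I = carrier (?H ?X2)"
    by (rule submodule_length(2)[OF hom_module_module[OF X2 M] h1(2) fHX2])
  have K: "carrier ?X2 = a_kernel (?P (rk F 1)) ?X1 (diff F 0)"
    unfolding q1(2)[symmetric] by simp
  have "\<exists>g \<in> module_hom R (?P (rk F 1)) M. \<forall>x \<in> a_kernel (?P (rk F 1)) ?X1 (diff F 0). g x = f x"
    if f: "f \<in> module_hom R (kernel_module R (rk F 1) (diff F 0) ?X1) M" for f
  proof -
    have "restrict f (carrier ?X2) \<in> carrier (?H ?X2)"
      using restrict_module_hom[OF f[unfolded q1(2)] X2] by simp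
    then obtain g where g: "g \<in> module_hom R (?P (rk F 1)) M" "restrict f (carrier ?X2) = ?r ?X2 g"
      unfolding I[symmetric] by auto
    have "g x = f x" if "x \<in> carrier ?X2" for x using fun_cong[OF g(2), of x] that by simp
    then show ?thesis using g(1) unfolding K by (intro bexI[of _ g] ballI)
  qed
  then show ?thesis unfolding ext1_zero_def using q1(1) by (intro exI conjI ballI)
qed

section \<open>Freeness in the Artinian case and in the depth zero case\<close>

lemma free_if_artinian_periodic:
  assumes M: "module R M" and fg: "fin_gen_module R M" and rigid: "rigid_module R M"
    and art: "artinian_ring R" and per: "periodic_module R 2 M"
  shows "free_module R M"
proof -
  obtain z where z: "socle_element z" using socle_element_if_artinian[OF art] .
  obtain n p where p: "presentation R n p M" using presentation_if_fin_gen[OF M fg] .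
  \<comment> \<open>Positive syzygies are indexed from zero, so the second one is
    \<open>res_syzygy R F 1\<close>.\<close>
  obtain F where F: "minimal_free_resolution R M F" and stab: "stably_isomorphic R M (res_syzygy R F 1)"
    using per by (auto simp: periodic_module_def stably_isomorphic_syzygy_def numeral_2_eq_2)
  have res: "free_resolution R M F" using F by (simp add: minimal_free_resolution_def)
  let ?X = "res_syzygy R F 1"
  have X: "module R ?X" by (rule presentationD(1)[OF free_resolution_syzygy(1)[OF res M]])
  have ext: "ext1_zero R M M"
    using ext1_zero_of_Ext_module_1[OF _ res M M] rigid by (simp add: rigid_module_def)
  note SR = stably_isomorphic_stable_retract[OF stab M X]
  have X0: "carrier ?X = {\<zero>\<^bsub>?X\<^esub>}"
    by (rule second_syzygy_zero[OF z F M SR(2) ext1_zero_first_syzygy[OF art res M ext stab]])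
  \<comment> \<open>The zero module is a retract of the free power of rank \<open>0\<close>;
    \<open>M\<close>, being a stable retract of it, is then a retract of a free module.\<close>
  have "free_retract R ?X"
    unfolding free_retract_def
    by (rule exI[of _ 0], rule exI[of _ "\<lambda>_. \<zero>\<^bsub>free_power R 0\<^esub>"], rule exI[of _ "\<lambda>_. \<zero>\<^bsub>?X\<^esub>"])
      (intro conjI module_hom_const_zero free_power_module X, use X0 in simp)
  then have "free_retract R M" by (rule free_retract_if_stable_retract[OF SR(1) _ X p])
  then show ?thesis by (rule free_module_if_free_retract[OF z p])
qed

text \<open>Rigidity is moved from \<open>M\<close> to \<open>X\<close> in one argument at a time;
  replacing the second argument introduces maps into free modules, for which \<open>S\<close> is
  needed.\<close>

lemma ext1_zero_self_if_stably_isomorphic: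
  assumes M: "module R M" and extM: "ext1_zero R M M" and stab: "stably_isomorphic R M X"
    and X: "presentation R m r X" and S: "ext1_zero R X (ring_module R)"
  shows "ext1_zero R X X"
proof -
  note Xm = presentationD(1)[OF X]
  note SR = stably_isomorphic_stable_retract[OF stab M Xm]
  show ?thesis
    by (rule ext1_zero_stable_retract_right[OF SR(2)
          ext1_zero_stable_retract_left[OF SR(2) extM X M] S Xm M])
qed

lemma free_if_stable_syzygy_of_ideal:
  assumes M: "module R M" and fg: "fin_gen_module R M" and rigid: "rigid_module R M"
    and depth: "ring_depth R = 0" and I: "ideal I R" and tr: "totally_reflexive R (ideal_module R I)"
    and syz: "stably_isomorphic_syzygy R M n (ideal_module R I)"
  shows "free_module R M"
proof -
  let ?I = "ideal_module R I"
  obtain z where z: "socle_element z" using socle_element_if_depth_zero[OF depth] .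
  obtain n0 p where p: "presentation R n0 p M" using presentation_if_fin_gen[OF M fg] .
  obtain F0 where F0: "free_resolution R M F0" using free_resolution_exists[OF p] .
  have extM: "ext1_zero R M M"
    using ext1_zero_of_Ext_module_1[OF _ F0 M M] rigid by (simp add: rigid_module_def)
  have Im: "module R ?I" by (rule ideal_module_module[OF I])
  obtain n1 q where q: "presentation R n1 q ?I" using ideal_presentation[OF I] .
  have refl: "reflexive_module R ?I" using tr by (simp add: totally_reflexive_def)
  have extI: "zero_module (Ext_module R i ?I (ring_module R))"
    and extD: "zero_module (Ext_module R i (dual_module R ?I) (ring_module R))" if "i > 0" for i
    using tr that by (simp_all add: totally_reflexive_def)
  have D: "ext1_zero R (dual_module R ?I) (ring_module R)"
  proof -
    obtain m r where r: "presentation R m r (dual_module R ?I)" using dual_presentation[OF q] .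
    obtain G where "free_resolution R (dual_module R ?I) G" using free_resolution_exists[OF r] .
    then show ?thesis
      using ext1_zero_of_Ext_module_1[OF extD _ dual_module_module[OF Im] ring_module_module] by simp
  qed
  have free: "free_retract R ?I" if "ext1_zero R ?I ?I"
    by (rule free_retract_trivial_ideal[OF trivial_ideal_if_rigid[OF z I refl D that]])
  have SI: "ext1_zero R ?I (ring_module R)" if "free_resolution R ?I F" for F
    using ext1_zero_of_Ext_module_1[OF extI that Im ring_module_module] by simp
  show ?thesis
  proof (cases n)
    case 0
    then have stab: "stably_isomorphic R M ?I" using syz by (simp add: stably_isomorphic_syzygy_def)
    obtain F where F: "free_resolution R ?I F" using free_resolution_exists[OF q] .
    have "free_retract R ?I" by (intro free ext1_zero_self_if_stably_isomorphic[OF M extM stab q SI[OF F]])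
    then have "free_retract R M"
      by (rule free_retract_if_stable_retract[OF stably_isomorphic_stable_retract(1)[OF stab M Im] _ Im p])
    then show ?thesis by (rule free_module_if_free_retract[OF z p])
  next
    case (Suc k)
    then obtain F where F: "minimal_free_resolution R ?I F" and stab: "stably_isomorphic R M (res_syzygy R F k)"
      using syz by (auto simp: stably_isomorphic_syzygy_def)
    have res: "free_resolution R ?I F" using F by (simp add: minimal_free_resolution_def)
    note p0 = free_resolution_presentation[OF res Im] and pS = free_resolution_syzygy[OF res Im]
    \<comment> \<open>The syzygy of order \<open>j + 1\<close> has first Ext into \<open>R\<close>
      equal to the Ext of \<open>I\<close> in degree \<open>j + 2\<close>. The descent below needs
      this at every order, hence the vanishing in all positive degrees.\<close>
    have SS: "ext1_zero R (res_syzygy R F j) (ring_module R)" for j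
      by (rule ext1_zero_syzygy_of_Ext_module[OF extI res Im ring_module_module]) simp
    have desc: "ext1_zero R (res_syzygy R F j) (res_syzygy R F j) \<Longrightarrow> ext1_zero R ?I ?I" for j
    proof (induction j)
      case 0
      then show ?case
        using ext1_zero_of_kernel[OF p0(1) _ SI[OF res], unfolded p0(2), OF pS(1)] by simp
    next
      case (Suc j)
      have "ext1_zero R (res_syzygy R F j) (res_syzygy R F j)"
        by (rule ext1_zero_of_kernel[OF pS(1) _ SS, unfolded pS(2), OF pS(1) Suc.prems])
      then show ?case by (rule Suc.IH)
    qed
    \<comment> \<open>The descent has made \<open>I\<close> rigid, hence trivial. The retract
      property now climbs along the resolution to the syzygy that is stably isomorphic to
      \<open>M\<close>.\<close>
    have I_free: "free_retract R ?I"
      by (rule free[OF desc[OF ext1_zero_self_if_stably_isomorphic[OF M extM stab pS(1) SS]]])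
    have "free_retract R (res_syzygy R F j)" for j
    proof (induction j)
      case 0
      show ?case using free_retract_kernel_module[OF I_free p0(1)] unfolding p0(2) .
    next
      case (Suc j)
      show ?case using free_retract_kernel_module[OF Suc pS(1)] unfolding pS(2) .
    qed
    then have "free_retract R M"
      using free_retract_if_stable_retract[OF stably_isomorphic_stable_retract(1)[OF stab M] _ _ p]
        presentationD(1)[OF pS(1)] by blast
    then show ?thesis by (rule free_module_if_free_retract[OF z p])
  qed
qed

end

theorem proposition1p5:
  fixes R :: "('a, 'r) ring_scheme" and M :: "('a, 'b, 'm) module_scheme"
  assumes "noetherian_local_ring R"
    and "module R M" and "fin_gen_module R M"
    and "rigid_module R M"
    and "(artinian_ring R \<and> periodic_module R 2 M) \<or>
      (ring_depth R = 0 \<and>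
        (\<exists>I n. ideal I R \<and> totally_reflexive R (ideal_module R I) \<and>
          stably_isomorphic_syzygy R M n (ideal_module R I)))"
  shows "free_module R M"
  using assms(5) noetherian_local_ring.free_if_artinian_periodic[OF assms(1-4)]
    noetherian_local_ring.free_if_stable_syzygy_of_ideal[OF assms(1-4)]
  by blast

end
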